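(* Let $\Bbbk$ be an algebraically closed field of characteristic $p>0$. Every finite dimensional simple module over the restricted Yangian $Y_2^{[p]}$ is isomorphic to $L^{[p]}(\lambda(u))$ for some restricted tuple $\lambda(u)=(\lambda_1(u),\lambda_2(u))$.
   Context: **Yangian.** $\Bbbk$ is an algebraically closed field of characteristic $p>0$. $Y_2$ is the associative unital $\Bbbk$-algebra with generators $t_{i,j}^{(r)}$ ($1\le i,j\le 2$, $r>0$) and relations $$[t_{i,j}^{(r)},t_{k,l}^{(s)}]=\sum_{t=0}^{\min(r,s)-1}\left(t_{k,j}^{(t)}t_{i,l}^{(r+s-1-t)}-t_{k,j}^{(r+s-1-t)}t_{i,l}^{(t)}\right),\qquad t_{i,j}^{(0)}:=\delta_{i,j}.$$ Put $t_{i,j}(u)=\sum_{r\ge0}t_{i,j}^{(r)}u^{-r}$. The Drinfeld generators are defined by $t_{1,1}(u)=d_1(u)$, $t_{1,2}(u)=d_1(u)e(u)$, $t_{2,1}(u)=f(u)d_1(u)$, $t_{2,2}(u)=f(u)d_1(u)e(u)+d_2(u)$, with $d_i(u)=\sum_{r\ge0}d_i^{(r)}u^{-r}$, $e(u)=\sum_{r>0}e^{(r)}u^{-r}$, $f(u)=\sum_{r>0}f^{(r)}u^{-r}$. **Restricted Yangian.** Let $b_i(u)=\sum_{r\ge0}b_i^{(r)}u^{-r}:=d_i(u)d_i(u-1)\cdots d_i(u-p+1)$. The elements $b_i^{(rp)}$ ($i=1,2$, $r>0$), $(e^{(r)})^p$, $(f^{(r)})^p$ ($r>0$) are central; they generate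 the $p$-center $Z_p(Y_2)$, and $Z_p(Y_2)_+$ is the ideal of $Z_p(Y_2)$ generated by them. Put $Y_2^{[p]}:=Y_2/Y_2Z_p(Y_2)_+$; the same symbols denote images of generators in $Y_2^{[p]}$. **Restricted series.** $g(u)\in\Bbbk[[u^{-1}]]$ is restricted if $g(u)g(u-1)\cdots g(u-p+1)=1$ (this forces $g(u)\in1+u^{-1}\Bbbk[[u^{-1}]]$). A tuple $\lambda(u)=(\lambda_1(u),\lambda_2(u))$, $\lambda_i(u)=1+\sum_{r>0}\lambda_i^{(r)}u^{-r}$, is restricted if both $\lambda_1(u),\lambda_2(u)$ are. **Baby Verma and simple modules.** For restricted $\lambda(u)$, $Z^{[p]}(\lambda(u))$ is the quotient of $Y_2^{[p]}$ by the left ideal generated by all $e^{(r)}$ and all $d_i^{(r)}-\lambda_i^{(r)}$ ($i=1,2$, $r>0$). It has a unique maximal proper submodule; $L^{[p]}(\lambda(u))$ is the corresponding simple quotient. *)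

theory Defs
  imports
    "HOL-Algebra.Algebraic_Closure_Type"
    "HOL-Algebra.Generated_Rings"
    "HOL-Algebra.Module"
    "HOL-Algebra.QuotRing"
    "HOL-Library.Poly_Mapping"
    "HOL-Library.Numeral_Type"
begin

section \<open>Modules over noncommutative rings\<close>

text \<open>The locale \<^locale>\<open>module\<close> of the library asks for a commutative ring of scalars; this is the
  same locale over an arbitrary ring. As in the library, the fields \<^term>\<open>monoid.mult M\<close> and
  \<^term>\<open>one M\<close> of a module record carry no information, and \<^locale>\<open>submodule\<close> is reused.\<close>

locale left_module = R?: ring R + M?: abelian_group M
  for R :: "('a, 'c) ring_scheme" (structure) and M :: "('a, 'b, 'd) module_scheme" (structure) +
  assumes smult_closed [simp, intro]:
      "\<lbrakk>a \<in> carrier R; x \<in> carrier M\<rbrakk> \<Longrightarrow> a \<odot>\<^bsub>M\<^esub> x \<in> carrier M"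
    and smult_l_distr:
      "\<lbrakk>a \<in> carrier R; b \<in> carrier R; x \<in> carrier M\<rbrakk> \<Longrightarrow>
        (a \<oplus> b) \<odot>\<^bsub>M\<^esub> x = a \<odot>\<^bsub>M\<^esub> x \<oplus>\<^bsub>M\<^esub> b \<odot>\<^bsub>M\<^esub> x"
    and smult_r_distr:
      "\<lbrakk>a \<in> carrier R; x \<in> carrier M; y \<in> carrier M\<rbrakk> \<Longrightarrow>
        a \<odot>\<^bsub>M\<^esub> (x \<oplus>\<^bsub>M\<^esub> y) = a \<odot>\<^bsub>M\<^esub> x \<oplus>\<^bsub>M\<^esub> a \<odot>\<^bsub>M\<^esub> y"
    and smult_assoc1:
      "\<lbrakk>a \<in> carrier R; b \<in> carrier R; x \<in> carrier M\<rbrakk> \<Longrightarrow>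
        (a \<otimes> b) \<odot>\<^bsub>M\<^esub> x = a \<odot>\<^bsub>M\<^esub> (b \<odot>\<^bsub>M\<^esub> x)"
    and smult_one [simp]:
      "x \<in> carrier M \<Longrightarrow> \<one> \<odot>\<^bsub>M\<^esub> x = x"

definition simple_module :: "('a, 'c) ring_scheme \<Rightarrow> ('a, 'b, 'd) module_scheme \<Rightarrow> bool" where
  "simple_module R M \<longleftrightarrow> left_module R M \<and> carrier M \<noteq> {\<zero>\<^bsub>M\<^esub>} \<and>
     (\<forall>N. submodule N R M \<longrightarrow> N = {\<zero>\<^bsub>M\<^esub>} \<or> N = carrier M)"

definition maximal_submodule ::
  "'b set \<Rightarrow> ('a, 'c) ring_scheme \<Rightarrow> ('a, 'b, 'd) module_scheme \<Rightarrow> bool" where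
  "maximal_submodule N R M \<longleftrightarrow> submodule N R M \<and> N \<noteq> carrier M \<and>
     (\<forall>K. submodule K R M \<and> N \<subseteq> K \<and> K \<noteq> carrier M \<longrightarrow> K = N)"

definition isomorphic_modules ::
  "('a, 'c) ring_scheme \<Rightarrow> ('a, 'b, 'd) module_scheme \<Rightarrow> ('a, 'e, 'f) module_scheme \<Rightarrow> bool" where
  "isomorphic_modules R M N \<longleftrightarrow> (\<exists>h. bij_betw h (carrier M) (carrier N) \<and>
     (\<forall>x\<in>carrier M. \<forall>y\<in>carrier M. h (x \<oplus>\<^bsub>M\<^esub> y) = h x \<oplus>\<^bsub>N\<^esub> h y) \<and>
     (\<forall>a\<in>carrier R. \<forall>x\<in>carrier M. h (a \<odot>\<^bsub>M\<^esub> x) = a \<odot>\<^bsub>N\<^esub> h x))"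

definition quotient_module :: "('a, 'b, 'd) module_scheme \<Rightarrow> 'b set \<Rightarrow> ('a, 'b set) module" where
  "quotient_module M N =
    \<lparr>carrier = a_rcosets\<^bsub>M\<^esub> N, monoid.mult = undefined, one = undefined, ring.zero = N, add = set_add M,
     module.smult = (\<lambda>a A. \<Union>x\<in>A. N +>\<^bsub>M\<^esub> (a \<odot>\<^bsub>M\<^esub> x))\<rparr>"

definition regular_module :: "('a, 'c) ring_scheme \<Rightarrow> ('a, 'a) module" where
  "regular_module R =
    \<lparr>carrier = carrier R, monoid.mult = monoid.mult R, one = \<one>\<^bsub>R\<^esub>, ring.zero = \<zero>\<^bsub>R\<^esub>,
     add = add R, module.smult = monoid.mult R\<rparr>"

text \<open>Left ideals are the submodules of the regular module.\<close>

definition gen_left_ideal :: "('a, 'c) ring_scheme \<Rightarrow> 'a set \<Rightarrow> 'a set" where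
  "gen_left_ideal R S = \<Inter>{J. submodule J R (regular_module R) \<and> S \<subseteq> J}"

lemma left_module_regular: "ring R \<Longrightarrow> left_module R (regular_module R)"
proof -
  assume "ring R"
  then interpret ring R .
  have "abelian_group (regular_module R)"
  proof (rule abelian_groupI)
    show "\<exists>y\<in>carrier (regular_module R). y \<oplus>\<^bsub>regular_module R\<^esub> x = \<zero>\<^bsub>regular_module R\<^esub>"
      if "x \<in> carrier (regular_module R)" for x
      using that by (intro bexI[of _ "\<ominus>\<^bsub>R\<^esub> x"]) (auto simp: regular_module_def l_neg)
  qed (auto simp: regular_module_def a_ac)
  then show ?thesis
    by (intro left_module.intro left_module_axioms.intro \<open>ring R\<close>)
       (auto simp: regular_module_def l_distr r_distr m_assoc)
qed

lemma left_module_quotient: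
  assumes "left_module R M" and "submodule N R M"
  shows "left_module R (quotient_module M N)"
proof -
  interpret left_module R M by fact
  interpret N: submodule N R M by fact
  have "additive_subgroup N M"
    by (intro additive_subgroup.intro) (rule N.subgroup_axioms)
  then interpret A: abelian_subgroup N M
    by (rule abelian_subgroupI3) (rule M.abelian_group_axioms)
  have car: "carrier (quotient_module M N) = (\<lambda>x. N +>\<^bsub>M\<^esub> x) ` carrier M"
    by (auto simp: quotient_module_def A_RCOSETS_def RCOSETS_def a_r_coset_def)
  have add: "(N +>\<^bsub>M\<^esub> x) \<oplus>\<^bsub>quotient_module M N\<^esub> (N +>\<^bsub>M\<^esub> y) = N +>\<^bsub>M\<^esub> (x \<oplus>\<^bsub>M\<^esub> y)"
    if "x \<in> carrier M" "y \<in> carrier M" for x y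
    using that by (simp add: quotient_module_def A.a_rcos_sum)
  have zero: "\<zero>\<^bsub>quotient_module M N\<^esub> = N +>\<^bsub>M\<^esub> \<zero>\<^bsub>M\<^esub>"
    by (simp add: quotient_module_def M.a_coset_add_zero A.a_subset)
  have eqI: "N +>\<^bsub>M\<^esub> y = N +>\<^bsub>M\<^esub> x" if "x \<in> carrier M" "y \<in> N +>\<^bsub>M\<^esub> x" for x y
    by (rule M.a_repr_independence[OF that(2,1) N.subgroup_axioms, symmetric])
  have smult: "a \<odot>\<^bsub>quotient_module M N\<^esub> (N +>\<^bsub>M\<^esub> x) = N +>\<^bsub>M\<^esub> (a \<odot>\<^bsub>M\<^esub> x)"
    if a: "a \<in> carrier R" and x: "x \<in> carrier M" for a x
  proof -
    have "N +>\<^bsub>M\<^esub> (a \<odot>\<^bsub>M\<^esub> y) = N +>\<^bsub>M\<^esub> (a \<odot>\<^bsub>M\<^esub> x)" if y: "y \<in> N +>\<^bsub>M\<^esub> x" for y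
    proof -
      obtain n where n: "n \<in> N" "y = n \<oplus>\<^bsub>M\<^esub> x"
        using y unfolding a_r_coset_def r_coset_def by auto
      have nM: "n \<in> carrier M" using n(1) A.a_subset by blast
      have "a \<odot>\<^bsub>M\<^esub> y = a \<odot>\<^bsub>M\<^esub> n \<oplus>\<^bsub>M\<^esub> a \<odot>\<^bsub>M\<^esub> x"
        using a x n nM by (simp add: smult_r_distr)
      moreover have "a \<odot>\<^bsub>M\<^esub> n \<in> N" by (rule N.smult_closed[OF a n(1)])
      ultimately have "a \<odot>\<^bsub>M\<^esub> y \<in> N +>\<^bsub>M\<^esub> (a \<odot>\<^bsub>M\<^esub> x)"
        unfolding a_r_coset_def r_coset_def by auto
      then show ?thesis by (rule eqI[OF smult_closed[OF a x]])
    qed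
    moreover have "x \<in> N +>\<^bsub>M\<^esub> x" using x by (rule A.a_rcos_self)
    ultimately have "(\<Union>y\<in>N +>\<^bsub>M\<^esub> x. N +>\<^bsub>M\<^esub> (a \<odot>\<^bsub>M\<^esub> y)) = N +>\<^bsub>M\<^esub> (a \<odot>\<^bsub>M\<^esub> x)"
      by blast
    then show ?thesis by (simp add: quotient_module_def)
  qed
  have "abelian_group (quotient_module M N)"
  proof (rule abelian_groupI)
    show "\<exists>y\<in>carrier (quotient_module M N).
        y \<oplus>\<^bsub>quotient_module M N\<^esub> x = \<zero>\<^bsub>quotient_module M N\<^esub>"
      if "x \<in> carrier (quotient_module M N)" for x
    proof -
      obtain z where "z \<in> carrier M" "x = N +>\<^bsub>M\<^esub> z" using \<open>x \<in> _\<close> car by auto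
      then show ?thesis
        by (intro bexI[of _ "N +>\<^bsub>M\<^esub> (\<ominus>\<^bsub>M\<^esub> z)"]) (auto simp: car add zero M.l_neg)
    qed
  qed (auto simp: car add zero M.a_ac)
  then show ?thesis
    by (intro left_module.intro left_module_axioms.intro R.ring_axioms)
       (auto simp: car add smult smult_l_distr smult_r_distr smult_assoc1)
qed

section \<open>The ring of a type, and its two-sided ideals\<close>

lemma ring_ring_of_type: "ring (ring_of_type_algebra :: 'a::ring_1 ring)"
proof (rule ringI)
  show "abelian_group (ring_of_type_algebra :: 'a ring)"
  proof (rule abelian_groupI)
    show "\<exists>y\<in>carrier ring_of_type_algebra. y \<oplus>\<^bsub>ring_of_type_algebra\<^esub> x = \<zero>\<^bsub>ring_of_type_algebra\<^esub>"
      for x :: 'a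
      by (intro bexI[of _ "-x"]) (auto simp: ring_of_type_algebra_def)
  qed (auto simp: ring_of_type_algebra_def algebra_simps)
  show "Group.monoid (ring_of_type_algebra :: 'a ring)"
    by (rule monoidI) (auto simp: ring_of_type_algebra_def algebra_simps)
qed (auto simp: ring_of_type_algebra_def algebra_simps)

abbreviation gen_ideal :: "'a::ring_1 set \<Rightarrow> 'a set" where
  "gen_ideal S \<equiv> genideal ring_of_type_algebra S"

lemma ideal_gen_ideal: "ideal (gen_ideal S) (ring_of_type_algebra :: 'a::ring_1 ring)"
  by (rule ring.genideal_ideal[OF ring_ring_of_type]) (simp add: ring_of_type_algebra_def)

lemma gen_ideal_incl: "x \<in> S \<Longrightarrow> x \<in> gen_ideal S"
  by (auto simp: genideal_def)

lemma minus_ring_of_type: "\<ominus>\<^bsub>ring_of_type_algebra\<^esub> x = - (x :: 'a::ring_1)"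
  using abelian_group.minus_equality[OF ring.is_abelian_group[OF ring_ring_of_type], of "-x" x]
  by (auto simp: ring_of_type_algebra_def)

lemma gen_ideal_zero: "0 \<in> gen_ideal (S :: 'a::ring_1 set)"
  using additive_subgroup.zero_closed[OF ideal.axioms(1)[OF ideal_gen_ideal[of S]]]
  by (simp add: ring_of_type_algebra_def)

lemma gen_ideal_add: "x \<in> gen_ideal S \<Longrightarrow> y \<in> gen_ideal S \<Longrightarrow> x + y \<in> gen_ideal (S :: 'a::ring_1 set)"
  using additive_subgroup.a_closed[OF ideal.axioms(1)[OF ideal_gen_ideal[of S]], of x y]
  by (simp add: ring_of_type_algebra_def)

lemma gen_ideal_mult_left: "x \<in> gen_ideal S \<Longrightarrow> a * x \<in> gen_ideal (S :: 'a::ring_1 set)"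
  using ideal.I_l_closed[OF ideal_gen_ideal[of S], of x a] by (simp add: ring_of_type_algebra_def)

lemma gen_ideal_mult_right: "x \<in> gen_ideal S \<Longrightarrow> x * a \<in> gen_ideal (S :: 'a::ring_1 set)"
  using ideal.I_r_closed[OF ideal_gen_ideal[of S], of x a] by (simp add: ring_of_type_algebra_def)

lemma gen_ideal_uminus: "x \<in> gen_ideal S \<Longrightarrow> - x \<in> gen_ideal (S :: 'a::ring_1 set)"
  using gen_ideal_mult_left[of x S "-1"] by simp

definition ideal_rel :: "'a::ring_1 set \<Rightarrow> 'a \<Rightarrow> 'a \<Rightarrow> bool" where
  "ideal_rel S x y \<longleftrightarrow> x - y \<in> gen_ideal S"

lemma equivp_ideal_rel: "equivp (ideal_rel (S :: 'a::ring_1 set))"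
proof (rule equivpI)
  show "reflp (ideal_rel S)" by (auto intro!: reflpI simp: ideal_rel_def gen_ideal_zero)
  show "symp (ideal_rel S)"
  proof (rule sympI)
    fix x y assume "ideal_rel S x y"
    then show "ideal_rel S y x"
      using gen_ideal_uminus[of "x - y" S] by (simp add: ideal_rel_def)
  qed
  show "transp (ideal_rel S)"
  proof (rule transpI)
    fix x y z assume "ideal_rel S x y" "ideal_rel S y z"
    then show "ideal_rel S x z"
      using gen_ideal_add[of "x - y" S "y - z"] by (simp add: ideal_rel_def)
  qed
qed

lemma ideal_rel_add: "ideal_rel S x x' \<Longrightarrow> ideal_rel S y y' \<Longrightarrow> ideal_rel S (x + y) (x' + y')"
  using gen_ideal_add[of "x - x'" S "y - y'"] by (simp add: ideal_rel_def algebra_simps)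

lemma ideal_rel_uminus: "ideal_rel S x x' \<Longrightarrow> ideal_rel S (- x) (- x')"
  using gen_ideal_uminus[of "x - x'" S] by (simp add: ideal_rel_def algebra_simps)

lemma ideal_rel_diff: "ideal_rel S x x' \<Longrightarrow> ideal_rel S y y' \<Longrightarrow> ideal_rel S (x - y) (x' - y')"
  using ideal_rel_add[OF _ ideal_rel_uminus, of S x x' y y'] by simp

lemma ideal_rel_mult: "ideal_rel S x x' \<Longrightarrow> ideal_rel S y y' \<Longrightarrow> ideal_rel S (x * y) (x' * y')"
  using gen_ideal_add[OF gen_ideal_mult_left[of "y - y'" S x] gen_ideal_mult_right[of "x - x'" S y']]
  by (simp add: ideal_rel_def algebra_simps)

section \<open>Free associative algebras\<close>

datatype 'g free_monoid = Free_Word "'g list"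

instantiation free_monoid :: (type) monoid_add
begin

definition zero_free_monoid :: "'a free_monoid" where
  "0 = Free_Word []"

fun plus_free_monoid :: "'a free_monoid \<Rightarrow> 'a free_monoid \<Rightarrow> 'a free_monoid" where
  "Free_Word v + Free_Word w = Free_Word (v @ w)"

instance
proof
  fix a b c :: "'a free_monoid"
  show "a + b + c = a + (b + c)" by (cases a; cases b; cases c) simp
  show "0 + a = a" by (cases a) (simp add: zero_free_monoid_def)
  show "a + 0 = a" by (cases a) (simp add: zero_free_monoid_def)
qed

end

text \<open>The monoid algebra of the free monoid, with the convolution product of
  \<^theory>\<open>HOL-Library.Poly_Mapping\<close>.\<close>

type_synonym ('g, 'k) free_algebra = "'g free_monoid \<Rightarrow>\<^sub>0 'k"

definition free_gen :: "'g \<Rightarrow> ('g, 'k::field) free_algebra" where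
  "free_gen g = Poly_Mapping.single (Free_Word [g]) 1"

definition free_scalar :: "'k::field \<Rightarrow> ('g, 'k) free_algebra" where
  "free_scalar c = Poly_Mapping.single 0 c"

lemma free_monoid_plus_eq_0: "v + w = (0 :: 'g free_monoid) \<longleftrightarrow> v = 0 \<and> w = 0"
  by (cases v; cases w) (auto simp: zero_free_monoid_def)

definition const_coeff :: "('g, 'k::field) free_algebra \<Rightarrow> 'k" where
  "const_coeff x = Poly_Mapping.lookup x 0"

lemma const_coeff_hom:
  "const_coeff 0 = 0" "const_coeff 1 = 1"
  "const_coeff (x + y) = const_coeff x + const_coeff y"
  "const_coeff (x - y) = const_coeff x - const_coeff y"
  "const_coeff (- x) = - const_coeff x"
  "const_coeff (x * y) = const_coeff x * const_coeff y"
proof -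
  have *: "(\<Sum>q. Poly_Mapping.lookup y q when 0 = l + q) = (Poly_Mapping.lookup y 0 when l = 0)" for l
  proof (cases "l = 0")
    case False
    then have "(Poly_Mapping.lookup y q when 0 = l + q) = 0" for q
      using free_monoid_plus_eq_0[of l q] by (auto simp: when_def)
    then have "(\<lambda>q. Poly_Mapping.lookup y q when 0 = l + q) = (\<lambda>_. 0)" by (rule ext)
    with False show ?thesis by (simp only: Sum_any.neutral when_simps)
  next
    case True
    then have "(\<lambda>q. Poly_Mapping.lookup y q when 0 = l + q) =
               (\<lambda>q. Poly_Mapping.lookup y q when q = 0)" by (auto simp: when_def)
    with True show ?thesis by (simp only: Sum_any_when_equal when_simps simp_thms)
  qed
  have "Poly_Mapping.lookup (x * y) 0 = (\<Sum>l. Poly_Mapping.lookup x l * (\<Sum>q. Poly_Mapping.lookup y q when 0 = l + q))"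
    unfolding times_poly_mapping.rep_eq prod_fun_def ..
  also have "\<dots> = (\<Sum>l. Poly_Mapping.lookup x l * Poly_Mapping.lookup y 0 when l = 0)"
    unfolding * by (rule arg_cong[where f = Sum_any]) (auto simp: fun_eq_iff when_def)
  finally show "const_coeff (x * y) = const_coeff x * const_coeff y"
    unfolding const_coeff_def by (simp only: Sum_any_when_equal)
qed (simp_all add: const_coeff_def lookup_add lookup_minus lookup_one)

section \<open>The Yangian\<close>

text \<open>Indices $i,j\in\{1,2\}$ have the type \<^typ>\<open>2\<close>. The letter $(i,j,n)$ is the generator
  $t_{i,j}^{(n+1)}$, so that the letters are exactly the generators with $r>0$.\<close>

type_synonym 'k yangian_free = "(2 \<times> 2 \<times> nat, 'k) free_algebra"

definition free_t :: "2 \<Rightarrow> 2 \<Rightarrow> nat \<Rightarrow> 'k::field yangian_free" where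
  "free_t i j r = (if r = 0 then (if i = j then 1 else 0) else free_gen (i, j, r - 1))"

definition yangian_relators :: "'k::field yangian_free set" where
  "yangian_relators =
    {free_t i j r * free_t k l s - free_t k l s * free_t i j r -
       (\<Sum>a<min r s. free_t k j a * free_t i l (r + s - 1 - a)
                    - free_t k j (r + s - 1 - a) * free_t i l a) | i j k l r s. r > 0 \<and> s > 0}"

lemma const_coeff_free_t: "r > 0 \<Longrightarrow> const_coeff (free_t i j r) = 0"
  by (simp add: const_coeff_def free_t_def free_gen_def lookup_single zero_free_monoid_def)

lemma const_coeff_sum: "const_coeff (sum g A) = (\<Sum>a\<in>A. const_coeff (g a))"
  by (induction A rule: infinite_finite_induct) (simp_all add: const_coeff_hom)

lemma const_coeff_relator:
  assumes "x \<in> yangian_relators"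
  shows "const_coeff x = 0"
proof -
  obtain i j k l r s where rs: "r > 0" "s > 0" and x: "x =
      free_t i j r * free_t k l s - free_t k l s * free_t i j r -
       (\<Sum>a<min r s. free_t k j a * free_t i l (r + s - 1 - a)
                    - free_t k j (r + s - 1 - a) * free_t i l a)"
    using assms unfolding yangian_relators_def by blast
  have "const_coeff (free_t i' j' (r + s - 1 - a) :: 'a yangian_free) = 0"
    if "a \<in> {..<min r s}" for i' j' a
    by (rule const_coeff_free_t) (use that rs in simp)
  then have "const_coeff (\<Sum>a<min r s. free_t k j a * free_t i l (r + s - 1 - a)
      - free_t k j (r + s - 1 - a) * free_t i l a :: 'a yangian_free) = 0"
    unfolding const_coeff_sum by (intro sum.neutral ballI) (simp only: const_coeff_hom, simp)
  with rs show ?thesis by (simp only: x const_coeff_hom const_coeff_free_t) simp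
qed

lemma gen_ideal_hom_zero:
  fixes h :: "'a::ring_1 \<Rightarrow> 'k::field"
  assumes "h 0 = 0" "h 1 = 1" "\<And>x y. h (x + y) = h x + h y" "\<And>x y. h (x * y) = h x * h y"
    and "\<And>x. x \<in> S \<Longrightarrow> h x = 0" and x: "x \<in> gen_ideal S"
  shows "h x = 0"
proof -
  have H: "ring_hom_ring (ring_of_type_algebra :: 'a ring) (ring_of_type_algebra :: 'k ring) h"
    by (rule ring_hom_ringI[OF ring_ring_of_type ring_ring_of_type])
       (simp_all add: ring_of_type_algebra_def assms(2-4))
  have "ideal (a_kernel ring_of_type_algebra (ring_of_type_algebra :: 'k ring) h) ring_of_type_algebra"
    by (rule ring_hom_ring.kernel_is_ideal[OF H])
  moreover have "S \<subseteq> a_kernel ring_of_type_algebra (ring_of_type_algebra :: 'k ring) h"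
    by (rule subsetI) (simp add: a_kernel_def' ring_of_type_algebra_def assms(5))
  ultimately have "x \<in> a_kernel ring_of_type_algebra (ring_of_type_algebra :: 'k ring) h"
    using x unfolding genideal_def by blast
  then show ?thesis by (simp add: a_kernel_def' ring_of_type_algebra_def)
qed

lemma const_coeff_ideal_rel:
  assumes "ideal_rel yangian_relators x y"
  shows "const_coeff x = const_coeff y"
proof -
  have "const_coeff (x - y) = 0"
    by (rule gen_ideal_hom_zero[OF const_coeff_hom(1-3,6) const_coeff_relator
          assms[unfolded ideal_rel_def]])
  then show ?thesis by (simp add: const_coeff_hom)
qed

quotient_type (overloaded) 'k yangian = "'k::field yangian_free" / "ideal_rel yangian_relators"
  by (rule equivp_ideal_rel)

instantiation yangian :: (field) ring_1
begin

lift_definition zero_yangian :: "'a yangian" is 0 .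
lift_definition one_yangian :: "'a yangian" is 1 .
lift_definition plus_yangian :: "'a yangian \<Rightarrow> 'a yangian \<Rightarrow> 'a yangian" is "(+)"
  by (rule ideal_rel_add)
lift_definition minus_yangian :: "'a yangian \<Rightarrow> 'a yangian \<Rightarrow> 'a yangian" is "(-)"
  by (rule ideal_rel_diff)
lift_definition uminus_yangian :: "'a yangian \<Rightarrow> 'a yangian" is uminus
  by (rule ideal_rel_uminus)
lift_definition times_yangian :: "'a yangian \<Rightarrow> 'a yangian \<Rightarrow> 'a yangian" is "(*)"
  by (rule ideal_rel_mult)

instance
proof
  show "(0 :: 'a yangian) \<noteq> 1"
    by transfer (metis const_coeff_ideal_rel const_coeff_hom(1,2) zero_neq_one)
qed (transfer, simp add: algebra_simps ideal_rel_def gen_ideal_zero)+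

end

lift_definition yangian_scalar :: "'k::field \<Rightarrow> 'k yangian" is free_scalar .

lift_definition yangian_t :: "2 \<Rightarrow> 2 \<Rightarrow> nat \<Rightarrow> 'k::field yangian" is free_t .

lemma yangian_t_0: "yangian_t i j 0 = (if i = j then 1 else 0)"
  by transfer (auto simp: free_t_def ideal_rel_def gen_ideal_zero)

text \<open>A series in $u^{-1}$ is a formal power series whose variable \<^const>\<open>fps_X\<close> is $u^{-1}$.\<close>

definition t_series :: "2 \<Rightarrow> 2 \<Rightarrow> 'k::field yangian fps" where
  "t_series i j = Abs_fps (yangian_t i j)"

definition e_series :: "'k::field yangian fps" where
  "e_series = fps_left_inverse (t_series 1 1) 1 * t_series 1 2"

definition f_series :: "'k::field yangian fps" where
  "f_series = t_series 2 1 * fps_right_inverse (t_series 1 1) 1"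

definition d_series :: "2 \<Rightarrow> 'k::field yangian fps" where
  "d_series i = (if i = 1 then t_series 1 1
                 else t_series 2 2 - f_series * t_series 1 1 * e_series)"

lemma t_series_nth_0 [simp]: "fps_nth (t_series i j) 0 = (if i = j then 1 else 0)"
  by (simp add: t_series_def yangian_t_0)

lemma drinfeld_generators:
  "(t_series 1 1 :: 'k::field yangian fps) = d_series 1"
  "(t_series 1 2 :: 'k::field yangian fps) = d_series 1 * e_series"
  "(t_series 2 1 :: 'k::field yangian fps) = f_series * d_series 1"
  "(t_series 2 2 :: 'k::field yangian fps) = f_series * d_series 1 * e_series + d_series 2"
proof -
  let ?t = "t_series 1 1 :: 'k yangian fps"
  have eq: "fps_left_inverse ?t 1 = fps_right_inverse ?t 1"
    by (rule fps_left_inverse_eq_fps_right_inverse) simp_all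
  have l: "fps_left_inverse ?t 1 * ?t = 1" by (rule fps_left_inverse) simp
  have r: "?t * fps_right_inverse ?t 1 = 1" by (rule fps_right_inverse) simp
  show "t_series 1 1 = (d_series 1 :: 'k yangian fps)" by (simp add: d_series_def)
  show "t_series 1 2 = d_series 1 * (e_series :: 'k yangian fps)"
    by (simp add: d_series_def e_series_def eq r mult.assoc[symmetric])
  show "t_series 2 1 = f_series * (d_series 1 :: 'k yangian fps)"
    by (simp add: d_series_def f_series_def eq[symmetric] l mult.assoc)
  show "t_series 2 2 = f_series * d_series 1 * e_series + (d_series 2 :: 'k yangian fps)"
    by (simp add: d_series_def)
qed

lemma drinfeld_generators_nth_0:
  "fps_nth e_series 0 = 0" "fps_nth f_series 0 = 0" "fps_nth (d_series i) 0 = 1"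
  by (simp_all add: e_series_def f_series_def d_series_def)

section \<open>The restricted Yangian\<close>

text \<open>$g(u-j)$: the substitution $u\mapsto u-j$ sends $u^{-1}$ to
  $(u-j)^{-1}=\sum_{n\ge 1}j^{n-1}u^{-n}$.\<close>

definition shift_series :: "nat \<Rightarrow> 'a::ring_1 fps \<Rightarrow> 'a fps" where
  "shift_series j g = fps_compose g (Abs_fps (\<lambda>n. if n = 0 then 0 else of_nat j ^ (n - 1)))"

text \<open>$g(u)g(u-1)\cdots g(u-p+1)$, the factors in this order.\<close>

definition shift_product :: "nat \<Rightarrow> 'a::ring_1 fps \<Rightarrow> 'a fps" where
  "shift_product p g = prod_list (map (\<lambda>j. shift_series j g) [0..<p])"

definition p_center_gens :: "'k::field_prime_char yangian set" where
  "p_center_gens =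
     {fps_nth (shift_product CHAR('k) (d_series i)) (r * CHAR('k)) | i r. r > 0} \<union>
     {fps_nth e_series r ^ CHAR('k) | r. r > 0} \<union>
     {fps_nth f_series r ^ CHAR('k) | r. r > 0}"

text \<open>The unital subalgebra generated by the above elements.\<close>

definition p_center :: "'k::field_prime_char yangian set" where
  "p_center = generate_ring ring_of_type_algebra (range yangian_scalar \<union> p_center_gens)"

definition p_center_plus :: "'k::field_prime_char yangian set" where
  "p_center_plus = genideal (ring_of_type_algebra\<lparr>carrier := p_center\<rparr>) p_center_gens"

text \<open>The quotient of \<^typ>\<open>'k yangian\<close> by the two-sided ideal generated by
  \<^const>\<open>p_center_plus\<close>. It will be a ring with \<open>0 \<noteq> 1\<close> by the augmentation that sends all
  $t_{i,j}^{(r)}$ with $r>0$ to $0$.\<close>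

lift_definition augmentation :: "'k::field yangian \<Rightarrow> 'k" is const_coeff
  by (rule const_coeff_ideal_rel)

lemma augmentation_hom:
  "augmentation 0 = 0" "augmentation 1 = 1"
  "augmentation (x + y) = augmentation x + augmentation y"
  "augmentation (x - y) = augmentation x - augmentation y"
  "augmentation (x * y) = augmentation x * augmentation y"
  by (transfer, simp add: const_coeff_hom)+

lemma augmentation_sum: "augmentation (sum g A) = (\<Sum>a\<in>A. augmentation (g a))"
  by (induction A rule: infinite_finite_induct) (simp_all add: augmentation_hom)

lemma augmentation_power: "augmentation (x ^ n) = augmentation x ^ n"
  by (induction n) (simp_all add: augmentation_hom)

lemma augmentation_of_nat: "augmentation (of_nat n) = of_nat n"
  by (induction n) (simp_all add: augmentation_hom)

definition augmentation_fps :: "'k::field yangian fps \<Rightarrow> 'k fps" where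
  "augmentation_fps g = Abs_fps (\<lambda>n. augmentation (fps_nth g n))"

lemma augmentation_fps_hom:
  "augmentation_fps 1 = 1"
  "augmentation_fps (g - h) = augmentation_fps g - augmentation_fps h"
  "augmentation_fps (g * h) = augmentation_fps g * augmentation_fps h"
  by (auto simp: augmentation_fps_def fps_eq_iff augmentation_hom fps_mult_nth augmentation_sum)

lemma augmentation_fps_power: "augmentation_fps (g ^ n) = augmentation_fps g ^ n"
  by (induction n) (simp_all add: augmentation_fps_hom)

lemma augmentation_shift_series:
  "augmentation_fps (shift_series j g) = shift_series j (augmentation_fps g)"
proof -
  let ?a = "\<lambda>j. Abs_fps (\<lambda>n. if n = 0 then 0 else of_nat j ^ (n - 1))"
  have 1: "augmentation_fps (?a j) = (?a j :: 'a fps)"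
    by (auto simp: augmentation_fps_def fps_eq_iff augmentation_power augmentation_of_nat
        augmentation_hom)
  have 2: "augmentation (fps_nth h n) = fps_nth (augmentation_fps h) n"
    for h :: "'a yangian fps" and n
    by (simp add: augmentation_fps_def)
  show ?thesis
    by (rule fps_ext)
       (simp only: 2[symmetric], simp only: shift_series_def fps_compose_nth augmentation_sum
          augmentation_hom, simp only: 2 augmentation_fps_power 1)
qed

lemma augmentation_shift_product:
  "augmentation_fps (shift_product p g) = shift_product p (augmentation_fps g)"
  by (induction p) (simp_all add: shift_product_def augmentation_fps_hom augmentation_shift_series)

lemma augmentation_t_series: "augmentation_fps (t_series i j) = (if i = j then 1 else 0)"
proof -
  have *: "augmentation (yangian_t i j r) = (if i = j \<and> r = 0 then 1 else 0)" for r
  proof (cases "r = 0")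
    case True
    then show ?thesis by (simp add: yangian_t_0 augmentation_hom)
  next
    case False
    then show ?thesis by transfer (simp add: const_coeff_free_t)
  qed
  show ?thesis by (rule fps_ext) (simp add: augmentation_fps_def t_series_def *)
qed

lemma augmentation_drinfeld:
  "augmentation_fps e_series = 0" "augmentation_fps f_series = 0"
  "augmentation_fps (d_series i) = 1"
  by (simp_all add: e_series_def f_series_def d_series_def augmentation_fps_hom
      augmentation_t_series)

lemma shift_series_1: "shift_series j 1 = 1"
  by (simp add: shift_series_def)

lemma shift_product_1: "shift_product p 1 = 1"
  by (induction p) (simp_all add: shift_product_def shift_series_1)

lemma augmentation_p_center_gens:
  assumes "x \<in> p_center_gens"
  shows "augmentation (x :: 'k::field_prime_char yangian) = 0"
proof -
  have nth: "augmentation (fps_nth g n) = fps_nth (augmentation_fps g) n"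
    for g :: "'k yangian fps" and n
    by (simp add: augmentation_fps_def)
  have "CHAR('k) > 0" by (rule CHAR_pos)
  then show ?thesis
    using assms
    by (auto simp: p_center_gens_def augmentation_power nth augmentation_drinfeld
        augmentation_shift_product shift_product_1)
qed

lemma subring_p_center: "subring p_center (ring_of_type_algebra :: 'k::field_prime_char yangian ring)"
  unfolding p_center_def
  by (rule ring.generate_ring_is_subring[OF ring_ring_of_type]) (simp add: ring_of_type_algebra_def)

lemma p_center_gens_subset: "p_center_gens \<subseteq> p_center"
  unfolding p_center_def by (auto intro: generate_ring.incl)

lemma p_center_gens_subset_plus: "p_center_gens \<subseteq> p_center_plus"
  by (auto simp: p_center_plus_def genideal_def)

lemma augmentation_p_center_plus:
  assumes "x \<in> p_center_plus"
  shows "augmentation (x :: 'k::field_prime_char yangian) = 0"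
proof -
  let ?Y = "ring_of_type_algebra :: 'k yangian ring" and ?k = "ring_of_type_algebra :: 'k ring"
  let ?Z = "?Y\<lparr>carrier := p_center\<rparr>"
  have "ring ?Z"
    by (rule ring.subring_is_ring[OF ring_ring_of_type subring_p_center])
  then have "ring_hom_ring ?Z ?k augmentation"
    by (rule ring_hom_ringI[OF _ ring_ring_of_type])
       (auto simp: ring_of_type_algebra_def augmentation_hom)
  then have "ideal (a_kernel ?Z ?k augmentation) ?Z"
    by (rule ring_hom_ring.kernel_is_ideal)
  moreover have "p_center_gens \<subseteq> a_kernel ?Z ?k augmentation"
    using p_center_gens_subset augmentation_p_center_gens
    by (auto simp: a_kernel_def' ring_of_type_algebra_def)
  ultimately have "x \<in> a_kernel ?Z ?k augmentation"
    using assms unfolding p_center_plus_def genideal_def by blast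
  then show ?thesis by (simp add: a_kernel_def' ring_of_type_algebra_def)
qed

lemma augmentation_ideal_rel:
  assumes "ideal_rel p_center_plus x y"
  shows "augmentation x = augmentation y"
proof -
  have "augmentation (x - y) = 0"
    by (rule gen_ideal_hom_zero[OF augmentation_hom(1-3,5) augmentation_p_center_plus
          assms[unfolded ideal_rel_def]])
  then show ?thesis by (simp add: augmentation_hom)
qed

text \<open>As \<^const>\<open>p_center_plus\<close> consists of central elements, the ideal that is divided out here
  is $Y_2 Z_p(Y_2)_+$.\<close>

quotient_type (overloaded) 'k restricted_yangian =
  "'k::field_prime_char yangian" / "ideal_rel p_center_plus"
  by (rule equivp_ideal_rel)

instantiation restricted_yangian :: (field_prime_char) ring_1
begin

lift_definition zero_restricted_yangian :: "'a restricted_yangian" is 0 .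
lift_definition one_restricted_yangian :: "'a restricted_yangian" is 1 .
lift_definition plus_restricted_yangian ::
  "'a restricted_yangian \<Rightarrow> 'a restricted_yangian \<Rightarrow> 'a restricted_yangian" is "(+)"
  by (rule ideal_rel_add)
lift_definition minus_restricted_yangian ::
  "'a restricted_yangian \<Rightarrow> 'a restricted_yangian \<Rightarrow> 'a restricted_yangian" is "(-)"
  by (rule ideal_rel_diff)
lift_definition uminus_restricted_yangian ::
  "'a restricted_yangian \<Rightarrow> 'a restricted_yangian" is uminus
  by (rule ideal_rel_uminus)
lift_definition times_restricted_yangian ::
  "'a restricted_yangian \<Rightarrow> 'a restricted_yangian \<Rightarrow> 'a restricted_yangian" is "(*)"
  by (rule ideal_rel_mult)

instance
proof
  show "(0 :: 'a restricted_yangian) \<noteq> 1"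
    by transfer (metis augmentation_ideal_rel augmentation_hom(1,2) zero_neq_one)
qed (transfer, simp add: algebra_simps ideal_rel_def gen_ideal_zero)+

end

definition to_restricted :: "'k::field_prime_char yangian \<Rightarrow> 'k restricted_yangian" where
  "to_restricted = abs_restricted_yangian"

definition restricted_scalar :: "'k::field_prime_char \<Rightarrow> 'k restricted_yangian" where
  "restricted_scalar c = to_restricted (yangian_scalar c)"

definition restricted_d :: "2 \<Rightarrow> nat \<Rightarrow> 'k::field_prime_char restricted_yangian" where
  "restricted_d i r = to_restricted (fps_nth (d_series i) r)"

definition restricted_e :: "nat \<Rightarrow> 'k::field_prime_char restricted_yangian" where
  "restricted_e r = to_restricted (fps_nth e_series r)"

abbreviation restricted_yangian_ring :: "'k::field_prime_char restricted_yangian ring" where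
  "restricted_yangian_ring \<equiv> ring_of_type_algebra"

section \<open>Modules over the restricted Yangian\<close>

text \<open>The vector space structure of a module is given by the scalars of the algebra.\<close>

definition finite_dimensional ::
  "('k::field_prime_char restricted_yangian, 'm, 'd) module_scheme \<Rightarrow> bool" where
  "finite_dimensional M \<longleftrightarrow> (\<exists>B. finite B \<and> B \<subseteq> carrier M \<and>
     (\<forall>x\<in>carrier M. \<exists>c. x = (\<Oplus>\<^bsub>M\<^esub>b\<in>B. restricted_scalar (c b) \<odot>\<^bsub>M\<^esub> b)))"

definition restricted_series :: "'k::field_prime_char fps \<Rightarrow> bool" where
  "restricted_series g \<longleftrightarrow> shift_product CHAR('k) g = 1"

definition restricted_tuple :: "(2 \<Rightarrow> 'k::field_prime_char fps) \<Rightarrow> bool" where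
  "restricted_tuple \<mu> \<longleftrightarrow> (\<forall>i. fps_nth (\<mu> i) 0 = 1 \<and> restricted_series (\<mu> i))"

definition baby_verma :: "(2 \<Rightarrow> 'k::field_prime_char fps) \<Rightarrow>
    ('k restricted_yangian, 'k restricted_yangian set) module" where
  "baby_verma \<mu> = quotient_module (regular_module restricted_yangian_ring)
     (gen_left_ideal restricted_yangian_ring
       ({restricted_e r | r. r > 0} \<union>
        {restricted_d i r - restricted_scalar (fps_nth (\<mu> i) r) | i r. r > 0}))"

definition simple_quotient :: "(2 \<Rightarrow> 'k::field_prime_char fps) \<Rightarrow>
    ('k restricted_yangian, 'k restricted_yangian set set) module" where
  "simple_quotient \<mu> = quotient_module (baby_verma \<mu>)
     (THE N. maximal_submodule N restricted_yangian_ring (baby_verma \<mu>))"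

end

theory Submission
  imports Defs
begin

text \<open>A finite dimensional simple module has a vector killed by all $t_{1,2}^{(r)}$ on which the
  $t_{1,1}^{(r)}$ and $t_{2,2}^{(r)}$ act by scalars, because the $t_{1,2}^{(r)}$ commute and are
  nilpotent on a common eigenvector of the $t_{1,1}^{(r)}$. Nilpotency comes from
  $(e^{(r)})^p = 0$: on words in the $t_{1,2}^{(s)}$ applied to such an eigenvector, graded by the sum
  of the indices, $e^{(r)}$ has leading term $t_{1,2}^{(r)}$. So a word in which a letter occurs
  $p$ times equals a combination of words of the same length and smaller degree, and in a long word of
  small average index some letter does occur $p$ times. By the same argument for
  $(f^{(r)})^p = 0$ and words in the $t_{2,1}^{(s)}$ applied to the highest weight vector, the
  baby Verma module is a cyclic module over a commutative algebra in which every element without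
  constant term is nilpotent; hence the annihilator of a highest weight vector contains every
  proper left ideal above the defining one.

  The weight is restricted because $\<lambda>(u)\<lambda>(u-1)\cdots\<lambda>(u-p+1)$ is invariant under
  $u \mapsto u-1$ and has no terms $u^{-rp}$.\<close>

section \<open>Left ideals and algebras with central scalars\<close>

text \<open>Vectors are ring elements modulo a left ideal \<open>A\<close>, the annihilator of a
  chosen vector: \<open>w \<notin> A\<close> means that \<open>w\<close> moves this vector to a
  nonzero one, and an eigenvalue equation is a membership
  \<open>t * w - scalar c * w \<in> A\<close>. Hence the same lemmas serve the given module and the
  baby Verma module, where \<open>A\<close> is the defining left ideal and the vector is 1.

  The difficulty is that the elements with known p-th powers, e^{(r)} and f^{(r)}, do not commute,
  while the commuting t_{1,2}^{(r)} and t_{2,1}^{(r)} have no prescribed powers. The two families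
  differ by the factor d_1(u)^{-1}. Moving it through a word to an eigenvector loses degree, because
  d_1^{(b)} raises the degree by at most b - 1 instead of b; this is why the leading terms agree.
  The resulting nilpotency is not uniform: the length 4 r p from which words vanish depends on a
  bound r for the average index, so the letters involved have to be bounded first.\<close>

definition left_ideal :: "'a::ring_1 set \<Rightarrow> bool" where
  "left_ideal A \<longleftrightarrow> 0 \<in> A \<and> (\<forall>x\<in>A. \<forall>y\<in>A. x + y \<in> A) \<and> (\<forall>a. \<forall>x\<in>A. a * x \<in> A)"

lemma left_ideal_0: "left_ideal A \<Longrightarrow> 0 \<in> A"
  and left_ideal_add: "left_ideal A \<Longrightarrow> x \<in> A \<Longrightarrow> y \<in> A \<Longrightarrow> x + y \<in> A"
  and left_ideal_mult: "left_ideal A \<Longrightarrow> x \<in> A \<Longrightarrow> a * x \<in> A"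
  by (auto simp: left_ideal_def)

lemma left_ideal_uminus: "left_ideal A \<Longrightarrow> x \<in> A \<Longrightarrow> - x \<in> A"
  using left_ideal_mult[of A x "-1"] by simp

lemma left_ideal_diff: "left_ideal A \<Longrightarrow> x \<in> A \<Longrightarrow> y \<in> A \<Longrightarrow> x - y \<in> A"
  using left_ideal_add[of A x "-y"] left_ideal_uminus[of A y] by simp

lemma left_ideal_sum: "left_ideal A \<Longrightarrow> (\<And>i. i \<in> I \<Longrightarrow> g i \<in> A) \<Longrightarrow> sum g I \<in> A"
  by (induction I rule: infinite_finite_induct) (auto simp: left_ideal_0 left_ideal_add)

lemma left_ideal_cong: "left_ideal A \<Longrightarrow> x - y \<in> A \<Longrightarrow> x \<in> A \<longleftrightarrow> y \<in> A"
  using left_ideal_add[of A "x - y" y] left_ideal_diff[of A x "x - y"] by auto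

lemma left_ideal_annihilator: "left_ideal A \<Longrightarrow> left_ideal {a. a * v \<in> A}"
  by (auto simp: left_ideal_def algebra_simps)

text \<open>\<open>A\<close> absorbs factors on the left only, so \<open>a\<close> has to stand
  directly before \<open>w\<close>; this is what commutation provides. It is applied with a scalar
  \<open>b\<close>, to show that a nilpotent operator has eigenvalue 0.\<close>

lemma power_left_cong_power:
  fixes a b w :: "'a::ring_1"
  assumes "left_ideal A" and "a * w - b * w \<in> A" and "a * b = b * a"
  shows "a ^ n * w - b ^ n * w \<in> A"
proof (induction n)
  case 0
  then show ?case using assms(1) by (simp add: left_ideal_0)
next
  case (Suc n)
  have "b ^ n * a = a * b ^ n" by (metis assms(3) power_commuting_commutes)
  then have "a ^ Suc n * w - b ^ Suc n * w =
      a * (a ^ n * w - b ^ n * w) + b ^ n * (a * w - b * w)"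
    by (simp add: algebra_simps power_Suc2 del: power_Suc flip: mult.assoc)
       (simp add: power_commutes)
  then show ?case using Suc assms by (simp add: left_ideal_add left_ideal_mult)
qed

locale central_algebra =
  fixes scalar :: "'k::field \<Rightarrow> 'a::ring_1"
  assumes scalar_1 [simp]: "scalar 1 = 1"
    and scalar_add: "scalar (a + b) = scalar a + scalar b"
    and scalar_mult: "scalar (a * b) = scalar a * scalar b"
    and scalar_central: "scalar c * x = x * scalar c"
begin

lemma scalar_0 [simp]: "scalar 0 = 0"
  using scalar_add[of 0 0] by simp

lemma scalar_uminus: "scalar (- c) = - scalar c"
  using scalar_add[of c "- c"] by (simp add: eq_neg_iff_add_eq_0 add.commute)

lemma scalar_diff: "scalar (a - b) = scalar a - scalar b"
  using scalar_add[of a "- b"] by (simp add: scalar_uminus)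

lemma scalar_sum: "scalar (sum g I) = (\<Sum>i\<in>I. scalar (g i))"
  by (induction I rule: infinite_finite_induct) (auto simp: scalar_add)

lemma scalar_power: "scalar (c ^ n) = scalar c ^ n"
  by (induction n) (auto simp: scalar_mult)

lemma scalar_of_nat: "scalar (of_nat n) = of_nat n"
  by (induction n) (auto simp: scalar_add)

lemma scalar_left_commute: "x * (scalar c * y) = scalar c * (x * y)"
  by (metis mult.assoc scalar_central)

lemma scalar_inverse: "c \<noteq> 0 \<Longrightarrow> scalar (inverse c) * (scalar c * x) = x"
  by (simp add: mult.assoc[symmetric] scalar_mult[symmetric])

lemma left_ideal_scalar_cancel:
  "left_ideal A \<Longrightarrow> c \<noteq> 0 \<Longrightarrow> scalar c * x \<in> A \<Longrightarrow> x \<in> A"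
  using left_ideal_mult[of A "scalar c * x" "scalar (inverse c)"] by (simp add: scalar_inverse)

subsection \<open>Spans modulo a left ideal\<close>

text \<open>The preimage of the linear span of \<open>U\<close> in the quotient by \<open>A\<close>.
  Scaling is a rule for elements of \<open>U\<close> only; for a left ideal \<open>A\<close> it
  extends to the whole set by \<open>lin_span_scalar\<close>.\<close>

inductive_set lin_span :: "'a set \<Rightarrow> 'a set \<Rightarrow> 'a set" for U A where
  base: "a \<in> A \<Longrightarrow> a \<in> lin_span U A"
| scal: "x \<in> U \<Longrightarrow> scalar c * x \<in> lin_span U A"
| add: "y \<in> lin_span U A \<Longrightarrow> z \<in> lin_span U A \<Longrightarrow> y + z \<in> lin_span U A"

lemma lin_span_incl: "x \<in> U \<Longrightarrow> x \<in> lin_span U A"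
  using lin_span.scal[of x U 1] by simp

lemma lin_span_scalar:
  assumes "left_ideal A" and "y \<in> lin_span U A"
  shows "scalar c * y \<in> lin_span U A"
  using assms(2)
proof induction
  case (base b)
  then show ?case by (intro lin_span.base left_ideal_mult assms)
next
  case (scal x b)
  then show ?case using lin_span.scal[of x U "c * b"] by (simp add: scalar_mult mult.assoc)
next
  case (add y z)
  then show ?case by (simp add: distrib_left lin_span.add)
qed

lemma lin_span_mult:
  assumes "left_ideal A" and "\<And>x. x \<in> U \<Longrightarrow> a * x \<in> lin_span Y A"
    and "z \<in> lin_span U A"
  shows "a * z \<in> lin_span Y A"
  using assms(3)
proof induction
  case (base b)
  then show ?case by (intro lin_span.base left_ideal_mult assms)
next
  case (scal x c)
  then show ?case by (simp add: scalar_left_commute assms lin_span_scalar)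
next
  case (add y z)
  then show ?case by (simp add: distrib_left lin_span.add)
qed

lemma lin_span_sub:
  assumes "left_ideal A" and "U \<subseteq> lin_span Y A" and "z \<in> lin_span U A"
  shows "z \<in> lin_span Y A"
  using lin_span_mult[OF assms(1), of U 1 Y z] assms by auto

lemma lin_span_mono:
  assumes "U \<subseteq> Y" and "z \<in> lin_span U A"
  shows "z \<in> lin_span Y A"
  using assms(2,1) by induction (auto intro: lin_span.intros)

lemma lin_span_uminus: "left_ideal A \<Longrightarrow> y \<in> lin_span U A \<Longrightarrow> - y \<in> lin_span U A"
  using lin_span_scalar[of A y U "-1"] by (simp add: scalar_uminus)

lemma lin_span_diff:
  "left_ideal A \<Longrightarrow> y \<in> lin_span U A \<Longrightarrow> z \<in> lin_span U A \<Longrightarrow> y - z \<in> lin_span U A"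
  using lin_span.add[of y U A "-z"] lin_span_uminus[of A z U] by simp

lemma lin_span_0: "left_ideal A \<Longrightarrow> 0 \<in> lin_span U A"
  by (intro lin_span.base left_ideal_0)

lemma lin_span_sum:
  "left_ideal A \<Longrightarrow> (\<And>i. i \<in> I \<Longrightarrow> g i \<in> lin_span U A) \<Longrightarrow> sum g I \<in> lin_span U A"
  by (induction I rule: infinite_finite_induct) (auto simp: lin_span_0 lin_span.add)

subsection \<open>Common eigenvectors of commuting elements\<close>

definition subspace_above :: "'a set \<Rightarrow> 'a set \<Rightarrow> bool" where
  "subspace_above A S \<longleftrightarrow> A \<subseteq> S \<and> (\<forall>x\<in>S. \<forall>y\<in>S. x + y \<in> S) \<and> (\<forall>c. \<forall>x\<in>S. scalar c * x \<in> S)"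

lemma subspace_above_sum:
  "subspace_above A S \<Longrightarrow> left_ideal A \<Longrightarrow> (\<And>i. i \<in> I \<Longrightarrow> g i \<in> S) \<Longrightarrow> sum g I \<in> S"
  by (induction I rule: infinite_finite_induct) (auto simp: subspace_above_def left_ideal_0 subsetD)

text \<open>The quotient of \<open>S\<close> by \<open>A\<close> has dimension at most \<open>n\<close>: any \<open>n + 1\<close> elements are dependent.
  Sequences instead of sets make repetitions harmless.\<close>

definition dim_mod_le :: "nat \<Rightarrow> 'a set \<Rightarrow> 'a set \<Rightarrow> bool" where
  "dim_mod_le n S A \<longleftrightarrow> (\<forall>s. (\<forall>i. s i \<in> S) \<longrightarrow>
     (\<exists>\<alpha>. (\<exists>i\<le>n. \<alpha> i \<noteq> 0) \<and> (\<Sum>i\<le>n. scalar (\<alpha> i) * s i) \<in> A))"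

lemma dim_mod_leE:
  assumes "dim_mod_le n S A" and "\<And>i. s i \<in> S"
  obtains \<alpha> where "\<exists>i\<le>n. \<alpha> i \<noteq> 0" and "(\<Sum>i\<le>n. scalar (\<alpha> i) * s i) \<in> A"
  using assms unfolding dim_mod_le_def by blast

lemma dim_mod_le_self: "left_ideal A \<Longrightarrow> dim_mod_le 0 A A"
  unfolding dim_mod_le_def by (intro allI impI exI[of _ "\<lambda>_. 1"]) auto

lemma dim_mod_le_subset: "dim_mod_le n S A \<Longrightarrow> S' \<subseteq> S \<Longrightarrow> dim_mod_le n S' A"
  unfolding dim_mod_le_def by blast

text \<open>One step of Gaussian elimination: a vector that involves \<open>x\<close> serves as
  pivot, and multiples of it are subtracted from the others, which then lie in \<open>S\<close>. A
  relation between the results is a relation between the original vectors.\<close>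

lemma dim_mod_le_extend:
  assumes S: "subspace_above A S" and A: "left_ideal A" and n: "dim_mod_le n S A"
  shows "dim_mod_le (Suc n) {u + scalar c * x | u c. u \<in> S} A"
  unfolding dim_mod_le_def
proof (intro allI impI)
  fix s :: "nat \<Rightarrow> 'a" assume s: "\<forall>i. s i \<in> {u + scalar c * x | u c. u \<in> S}"
  then have "\<forall>i. \<exists>u c. s i = u + scalar c * x \<and> u \<in> S" by blast
  then obtain u c where uc: "\<And>i. s i = u i + scalar (c i) * x" "\<And>i. u i \<in> S" by metis
  show "\<exists>\<alpha>. (\<exists>i\<le>Suc n. \<alpha> i \<noteq> 0) \<and> (\<Sum>i\<le>Suc n. scalar (\<alpha> i) * s i) \<in> A"
  proof (cases "\<forall>i\<le>Suc n. c i = 0")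
    case True
    obtain \<alpha> where \<alpha>: "\<exists>i\<le>n. \<alpha> i \<noteq> 0" "(\<Sum>i\<le>n. scalar (\<alpha> i) * u i) \<in> A"
      using n uc(2) unfolding dim_mod_le_def by blast
    have "(\<Sum>i\<le>Suc n. scalar ((\<alpha>(Suc n := 0)) i) * s i) = (\<Sum>i\<le>n. scalar (\<alpha> i) * u i)"
      by (simp add: uc True)
    then have "(\<Sum>i\<le>Suc n. scalar ((\<alpha>(Suc n := 0)) i) * s i) \<in> A" by (rule ssubst) (rule \<alpha>(2))
    moreover obtain i where "i \<le> n" "\<alpha> i \<noteq> 0" using \<alpha>(1) by blast
    then have "\<exists>i\<le>Suc n. (\<alpha>(Suc n := 0)) i \<noteq> 0" by (intro exI[of _ i]) auto
    ultimately show ?thesis by (intro exI[of _ "\<alpha>(Suc n := 0)"] conjI)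
  next
    case False
    then obtain j where j: "j \<le> Suc n" "c j \<noteq> 0" by blast
    \<comment> \<open>The transposition moves the pivot \<open>j\<close> to the last place, so that
      the other vectors are indexed by 0 to \<open>n\<close>, as the bound for \<open>S\<close>
      requires.\<close>
    define \<tau> where "\<tau> = Transposition.transpose j (Suc n)"
    have \<tau>: "\<tau> permutes {..Suc n}" unfolding \<tau>_def using j(1) by (simp add: permutes_swap_id)
    have \<tau>\<tau>: "\<tau> (\<tau> i) = i" for i by (simp add: \<tau>_def)
    have \<tau>n: "\<tau> (Suc n) = j" by (simp add: \<tau>_def)
    define s' where "s' i = s (\<tau> i) - scalar (c (\<tau> i) / c j) * s j" for i
    have "s' i = u (\<tau> i) + scalar (- (c (\<tau> i) / c j)) * u j" for i
    proof -
      have "scalar (c (\<tau> i) / c j) * (scalar (c j) * x) = scalar (c (\<tau> i)) * x"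
        using j(2) by (simp add: mult.assoc[symmetric] scalar_mult[symmetric])
      then show ?thesis by (simp add: s'_def uc(1) scalar_uminus algebra_simps)
    qed
    then have "s' i \<in> S" for i using S uc(2) unfolding subspace_above_def by simp
    then obtain \<beta> where \<beta>: "\<exists>i\<le>n. \<beta> i \<noteq> 0" "(\<Sum>i\<le>n. scalar (\<beta> i) * s' i) \<in> A"
      using n unfolding dim_mod_le_def by blast
    define \<gamma> where "\<gamma> = \<beta>(Suc n := - (\<Sum>i\<le>n. \<beta> i * (c (\<tau> i) / c j)))"
    have "(\<Sum>i\<le>Suc n. scalar (\<gamma> i) * s (\<tau> i)) = (\<Sum>i\<le>n. scalar (\<beta> i) * s' i)"
      by (simp add: \<gamma>_def s'_def \<tau>n scalar_uminus scalar_sum scalar_mult right_diff_distrib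
          sum_subtractf sum_distrib_right mult.assoc del: times_divide_eq_right)
    moreover have "(\<Sum>i\<le>Suc n. scalar (\<gamma> (\<tau> i)) * s i) = (\<Sum>i\<le>Suc n. scalar (\<gamma> i) * s (\<tau> i))"
      using sum.permute[OF \<tau>, of "\<lambda>i. scalar (\<gamma> (\<tau> i)) * s i"] \<tau>\<tau>
      by (simp add: o_def del: sum.atMost_Suc)
    ultimately have "(\<Sum>i\<le>Suc n. scalar (\<gamma> (\<tau> i)) * s i) \<in> A" using \<beta>(2) by metis
    moreover obtain i where i: "i \<le> n" "\<beta> i \<noteq> 0" using \<beta>(1) by blast
    then have "\<gamma> (\<tau> (\<tau> i)) \<noteq> 0" "\<tau> i \<le> Suc n"
      using permutes_in_image[OF \<tau>, of i] by (auto simp: \<gamma>_def \<tau>\<tau>)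
    ultimately show ?thesis by (intro exI[of _ "\<lambda>i. \<gamma> (\<tau> i)"]) blast
  qed
qed

text \<open>Append \<open>x\<close> to \<open>n + 1\<close> vectors of \<open>S'\<close>. In a
  dependence relation its coefficient vanishes, since otherwise \<open>x\<close> would lie in
  \<open>S'\<close>; what remains is a relation within \<open>S'\<close>.\<close>

lemma dim_mod_le_proper:
  assumes "dim_mod_le (Suc n) S A" and S': "subspace_above A S'" and A: "left_ideal A"
    and sub: "S' \<subseteq> S" and x: "x \<in> S" "x \<notin> S'"
  shows "dim_mod_le n S' A"
  unfolding dim_mod_le_def
proof (intro allI impI)
  fix s :: "nat \<Rightarrow> 'a" assume s: "\<forall>i. s i \<in> S'"
  have "\<forall>i. (s(Suc n := x)) i \<in> S" using s sub x by auto
  then obtain \<alpha> where \<alpha>: "\<exists>i\<le>Suc n. \<alpha> i \<noteq> 0"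
    "(\<Sum>i\<le>Suc n. scalar (\<alpha> i) * (s(Suc n := x)) i) \<in> A"
    using assms(1) unfolding dim_mod_le_def by blast
  define y where "y = (\<Sum>i\<le>n. scalar (\<alpha> i) * s i)"
  have y: "y + scalar (\<alpha> (Suc n)) * x \<in> A" using \<alpha>(2) by (simp add: y_def)
  have yS: "y \<in> S'" unfolding y_def
    using s S' by (intro subspace_above_sum[OF S' A]) (auto simp: subspace_above_def)
  have "\<alpha> (Suc n) = 0"
  proof (rule ccontr)
    assume ne: "\<alpha> (Suc n) \<noteq> 0"
    have "scalar (-1) * y + (y + scalar (\<alpha> (Suc n)) * x) \<in> S'"
      using S' yS y unfolding subspace_above_def by blast
    then have "scalar (\<alpha> (Suc n)) * x \<in> S'" by (simp add: scalar_uminus)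
    then have "scalar (inverse (\<alpha> (Suc n))) * (scalar (\<alpha> (Suc n)) * x) \<in> S'"
      using S' unfolding subspace_above_def by blast
    then show False using x ne by (simp add: scalar_inverse)
  qed
  then show "\<exists>\<alpha>. (\<exists>i\<le>n. \<alpha> i \<noteq> 0) \<and> (\<Sum>i\<le>n. scalar (\<alpha> i) * s i) \<in> A"
    using \<alpha>(1) y by (intro exI[of _ \<alpha>]) (auto simp: y_def le_Suc_eq)
qed

section \<open>Eigenvectors from annihilating polynomials\<close>

definition poly_at :: "'k poly \<Rightarrow> 'a \<Rightarrow> 'a" where
  "poly_at q t = (\<Sum>i\<le>degree q. scalar (coeff q i) * t ^ i)"

lemma poly_at_le: "degree q \<le> n \<Longrightarrow> poly_at q t = (\<Sum>i\<le>n. scalar (coeff q i) * t ^ i)"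
  unfolding poly_at_def by (rule sum.mono_neutral_left) (auto simp: coeff_eq_0)

lemma poly_at_linear_factor: "poly_at ([:- c, 1:] * q) t = (t - scalar c) * poly_at q t"
proof -
  let ?n = "degree q"
  have deg: "degree ([:- c, 1:] * q) \<le> Suc ?n"
    using degree_mult_le[of "[:- c, 1:]" q] by simp
  have 1: "(\<Sum>i\<le>Suc ?n. scalar (coeff (pCons 0 q) i) * t ^ i) = t * poly_at q t"
    unfolding sum.atMost_Suc_shift by (simp add: poly_at_def sum_distrib_left scalar_left_commute)
  have 2: "(\<Sum>i\<le>Suc ?n. scalar (coeff q i) * t ^ i) = poly_at q t"
    by (rule poly_at_le[symmetric]) simp
  have "poly_at ([:- c, 1:] * q) t =
      (\<Sum>i\<le>Suc ?n. scalar (coeff (pCons 0 q) i) * t ^ i) -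
      scalar c * (\<Sum>i\<le>Suc ?n. scalar (coeff q i) * t ^ i)"
    unfolding poly_at_le[OF deg] sum_distrib_left sum_subtractf[symmetric]
    by (intro sum.cong refl) (simp add: scalar_add scalar_diff scalar_uminus scalar_mult algebra_simps)
  then show ?thesis unfolding 1 2 by (simp add: algebra_simps)
qed

text \<open>Split linear factors off \<open>q\<close> one at a time. If the cofactor still kills
  \<open>w\<close>, continue with it; otherwise it carries \<open>w\<close> to an eigenvector for
  the removed root, which stays in \<open>S\<close> because \<open>S\<close> is stable under
  \<open>t\<close>.\<close>

lemma eigenvector_of_annihilating_poly:
  assumes closed: "\<And>q :: 'k poly. degree q > 0 \<Longrightarrow> \<exists>c. poly q c = 0"
    and A: "left_ideal A" and S: "subspace_above A S" "\<And>x. x \<in> S \<Longrightarrow> t * x \<in> S"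
    and w: "w \<in> S" "w \<notin> A"
    and q: "q \<noteq> 0" "poly_at q t * w \<in> A"
  shows "\<exists>c w'. w' \<in> S \<and> w' \<notin> A \<and> t * w' - scalar c * w' \<in> A"
  using q
proof (induction "degree q" arbitrary: q)
  case 0
  then obtain a where a: "q = [:a:]" by (metis degree_eq_zeroE)
  then have "scalar a * w \<in> A" "a \<noteq> 0" using 0 by (auto simp: poly_at_def)
  then show ?case using left_ideal_scalar_cancel[OF A] w by blast
next
  case (Suc n)
  then obtain c where "poly q c = 0" using closed[of q] by auto
  then obtain q' where q': "q = [:- c, 1:] * q'" by (auto simp: poly_eq_0_iff_dvd)
  then have q'0: "q' \<noteq> 0" using Suc by auto
  then have "n = degree q'" using Suc(2) unfolding q' by (subst (asm) degree_mult_eq) auto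
  show ?case
  proof (cases "poly_at q' t * w \<in> A")
    case True
    then show ?thesis using Suc(1) \<open>n = degree q'\<close> q'0 by blast
  next
    case False
    have "t ^ i * w \<in> S" for i
      using w by (induction i) (auto simp: mult.assoc S(2))
    then have "poly_at q' t * w \<in> S" unfolding poly_at_def sum_distrib_right mult.assoc
      using S(1) by (intro subspace_above_sum[OF S(1) A]) (auto simp: subspace_above_def)
    moreover have "t * (poly_at q' t * w) - scalar c * (poly_at q' t * w) \<in> A"
      using Suc.prems(2) unfolding q' poly_at_linear_factor by (simp add: algebra_simps)
    ultimately show ?thesis using False by blast
  qed
qed

text \<open>Induction on the dimension bound rather than on \<open>F\<close>, which consists of
  infinite families of generators in the applications. If some \<open>t\<close> does not act on
  \<open>w\<close> by a scalar, its eigenspace in \<open>S\<close> misses \<open>w\<close>, so it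
  has smaller dimension, and it is stable under \<open>F\<close> by commutativity. Commutation is
  asked for only modulo \<open>A\<close> and on \<open>S\<close>, since t_{1,1} and t_{2,2} are
  shown to commute only in that sense.\<close>

lemma common_eigenvector:
  assumes closed: "\<And>q :: 'k poly. degree q > 0 \<Longrightarrow> \<exists>c. poly q c = 0"
    and A: "left_ideal A" and "subspace_above A S" "\<And>t x. t \<in> F \<Longrightarrow> x \<in> S \<Longrightarrow> t * x \<in> S"
    and "w \<in> S" "w \<notin> A" and "dim_mod_le n S A"
    and "\<And>t t' x. t \<in> F \<Longrightarrow> t' \<in> F \<Longrightarrow> x \<in> S \<Longrightarrow> t * t' * x - t' * t * x \<in> A"
  shows "\<exists>w'. w' \<in> S \<and> w' \<notin> A \<and> (\<forall>t\<in>F. \<exists>c. t * w' - scalar c * w' \<in> A)"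
  using assms(3-)
proof (induction n arbitrary: S w)
  case 0
  have "\<forall>i. (\<lambda>_::nat. w) i \<in> S" using 0 by simp
  then obtain \<alpha> where "\<alpha> (0::nat) \<noteq> 0" "scalar (\<alpha> 0) * w \<in> A"
    using 0(5) unfolding dim_mod_le_def by auto
  then show ?case using left_ideal_scalar_cancel[OF A] 0 by blast
next
  case (Suc n)
  show ?case
  proof (cases "\<forall>t\<in>F. \<exists>c. t * w - scalar c * w \<in> A")
    case True
    then show ?thesis using Suc by blast
  next
    case False
    then obtain t where t: "t \<in> F" "\<And>c. t * w - scalar c * w \<notin> A" by blast
    \<comment> \<open>The \<open>n + 2\<close> vectors \<open>t ^ i * w\<close> are dependent, and a
      relation between them is an annihilating polynomial.\<close>
    have "t ^ i * w \<in> S" for i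
      using Suc t(1) by (induction i) (auto simp: mult.assoc)
    then obtain \<alpha> where \<alpha>: "\<exists>i\<le>Suc n. \<alpha> i \<noteq> 0" "(\<Sum>i\<le>Suc n. scalar (\<alpha> i) * (t ^ i * w)) \<in> A"
      by (rule dim_mod_leE[OF Suc(6), of "\<lambda>i. t ^ i * w"])
    define q where "q = (\<Sum>i\<le>Suc n. monom (\<alpha> i) i)"
    have cq: "coeff q i = (if i \<le> Suc n then \<alpha> i else 0)" for i
    proof -
      have "coeff q i = (\<Sum>k\<le>Suc n. if k = i then \<alpha> k else 0)"
        unfolding q_def coeff_sum by (intro sum.cong) auto
      then show ?thesis by (simp del: sum.atMost_Suc add: sum.delta)
    qed
    have q0: "q \<noteq> 0" using \<alpha>(1) cq by (metis coeff_0)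
    have "degree q \<le> Suc n" by (rule degree_le) (simp add: cq)
    then have "poly_at q t * w = (\<Sum>i\<le>Suc n. scalar (\<alpha> i) * (t ^ i * w))"
      unfolding poly_at_le[OF \<open>degree q \<le> Suc n\<close>] sum_distrib_right
      by (intro sum.cong) (auto simp: cq mult.assoc)
    then have "poly_at q t * w \<in> A" using \<alpha>(2) by simp
    then obtain c w' where w': "w' \<in> S" "w' \<notin> A" "t * w' - scalar c * w' \<in> A"
      using eigenvector_of_annihilating_poly[OF closed A Suc(2) Suc(3)[OF t(1)] Suc(4,5) q0] by blast
    define S' where "S' = {x\<in>S. t * x - scalar c * x \<in> A}"
    have "A \<subseteq> S" using Suc(2) by (simp add: subspace_above_def)
    have S': "subspace_above A S'"
      unfolding subspace_above_def
    proof (intro conjI ballI allI)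
      show "A \<subseteq> S'"
        using \<open>A \<subseteq> S\<close> A by (auto simp: S'_def intro: left_ideal_diff left_ideal_mult)
      fix x y assume xy: "x \<in> S'" "y \<in> S'"
      have "t * (x + y) - scalar c * (x + y) = (t * x - scalar c * x) + (t * y - scalar c * y)"
        by (simp add: algebra_simps)
      then show "x + y \<in> S'"
        using xy Suc(2) A by (auto simp: S'_def subspace_above_def intro: left_ideal_add)
    next
      fix b x assume x: "x \<in> S'"
      have "t * (scalar b * x) - scalar c * (scalar b * x) = scalar b * (t * x - scalar c * x)"
        by (simp add: right_diff_distrib scalar_left_commute[of t]
            scalar_left_commute[of "scalar c" b])
      then show "scalar b * x \<in> S'"
        using x Suc(2) A by (auto simp: S'_def subspace_above_def intro: left_ideal_mult)
    qed
    have stable: "t' * x \<in> S'" if "t' \<in> F" "x \<in> S'" for t' x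
    proof -
      have "t * (t' * x) - scalar c * (t' * x) =
          (t * t' * x - t' * t * x) + t' * (t * x - scalar c * x)"
        by (simp add: algebra_simps scalar_left_commute[of t'])
      then show ?thesis
        using that t(1) Suc(3,7) A by (auto simp: S'_def intro!: left_ideal_add left_ideal_mult)
    qed
    have "dim_mod_le n S' A"
      by (rule dim_mod_le_proper[OF Suc(6) S' A _ Suc(4)]) (use t(2) in \<open>auto simp: S'_def\<close>)
    then have "\<exists>w''. w'' \<in> S' \<and> w'' \<notin> A \<and> (\<forall>t\<in>F. \<exists>c. t * w'' - scalar c * w'' \<in> A)"
      using w' Suc(7) by (intro Suc.IH[OF S' stable, of w']) (auto simp: S'_def)
    then show ?thesis by (auto simp: S'_def)
  qed
qed

lemma lin_span_empty:
  assumes "left_ideal A" and "z \<in> lin_span {} A"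
  shows "z \<in> A"
  using assms(2) by induction (auto intro: left_ideal_add assms)

lemma subspace_above_lin_span:
  "left_ideal A \<Longrightarrow> subspace_above A (lin_span U A)"
  by (auto simp: subspace_above_def intro: lin_span.base lin_span.add lin_span_scalar)

lemma dim_mod_le_lin_span:
  assumes A: "left_ideal A" and "finite B"
  shows "dim_mod_le (card B) (lin_span B A) A"
  using assms(2)
proof induction
  case empty
  have "lin_span {} A \<subseteq> A" using lin_span_empty[OF A] by blast
  then show ?case using dim_mod_le_subset[OF dim_mod_le_self[OF A]] by simp
next
  case (insert b B)
  have "x \<in> {u + scalar c * b | u c. u \<in> lin_span B A}" if "x \<in> lin_span (insert b B) A" for x
    using that
  proof induction
    case (base a)
    then show ?case
      by (intro CollectI exI[of _ a] exI[of _ 0]) (simp add: lin_span.base)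
  next
    case (scal y c)
    show ?case
    proof (cases "y = b")
      case True
      then show ?thesis
        by (intro CollectI exI[of _ 0] exI[of _ c]) (simp add: lin_span_0[OF A])
    next
      case False
      then have "scalar c * y \<in> lin_span B A" using scal by (intro lin_span.scal) auto
      then show ?thesis
        by (intro CollectI exI[of _ "scalar c * y"] exI[of _ 0]) simp
    qed
  next
    case (add y z)
    then obtain u c u' c' where "y = u + scalar c * b" "u \<in> lin_span B A"
      "z = u' + scalar c' * b" "u' \<in> lin_span B A" by blast
    then show ?case
      by (intro CollectI exI[of _ "u + u'"] exI[of _ "c + c'"])
        (simp add: lin_span.add scalar_add algebra_simps)
  qed
  then have "lin_span (insert b B) A \<subseteq> {u + scalar c * b | u c. u \<in> lin_span B A}" by blast
  from dim_mod_le_subset[OF dim_mod_le_extend[OF subspace_above_lin_span[OF A] A insert.IH] this]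
  show ?case using insert by simp
qed

end

section \<open>Words in commuting operators\<close>

text \<open>Common frame for t_{1,2} over t_{1,1} and for t_{2,1} over t_{1,1} or t_{2,2}; the sign
  \<open>\<epsilon>\<close> distinguishes the cases. On the right of \<open>exchange\<close> every
  \<open>x\<close> stands to the left of its \<open>d\<close>, so that repeated use pushes the
  \<open>d\<close> onto \<open>v\<close>, where they act by scalars.\<close>

locale exchange_relations = central_algebra scalar for scalar :: "'k::field \<Rightarrow> 'a::ring_1" +
  fixes x d :: "nat \<Rightarrow> 'a" and \<epsilon> :: 'k and A :: "'a set" and v :: 'a
  assumes left_ideal: "left_ideal A"
    and x_0: "x 0 = 0" and d_0: "d 0 = 1"
    and x_commute: "x r * x s = x s * x r"
    and exchange: "d b * x s = x s * d b + scalar \<epsilon> *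
      (\<Sum>a<min b s. x a * d (b + s - 1 - a) - x (b + s - 1 - a) * d a)"
    and weight: "\<exists>c. d b * v - scalar c * v \<in> A"
begin

definition word :: "nat list \<Rightarrow> 'a" where
  "word ss = prod_list (map x ss)"

text \<open>Filtration by degree, separately for each length. Letters 0 are excluded
  (\<open>x 0 = 0\<close>), so there is no nonempty word of degree 0; the descent in
  \<open>long_words_vanish\<close> ends there.\<close>

definition words :: "nat \<Rightarrow> nat \<Rightarrow> 'a set" where
  "words n D = {word ss * v | ss. length ss = n \<and> 0 \<notin> set ss \<and> sum_list ss \<le> D}"

abbreviation V :: "nat \<Rightarrow> nat \<Rightarrow> 'a set" where
  "V n D \<equiv> lin_span (words n D) A"

lemmas V_intros = lin_span.add lin_span_0[OF left_ideal] lin_span_diff[OF left_ideal]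
  lin_span_sum[OF left_ideal] lin_span_scalar[OF left_ideal]

lemma word_simps [simp]: "word [] = 1" "word (s # ss) = x s * word ss"
  by (simp_all add: word_def)

lemma V_mono: "w \<in> V n D \<Longrightarrow> D \<le> D' \<Longrightarrow> w \<in> V n D'"
  by (rule lin_span_mono) (auto simp: words_def intro: le_trans)

lemma word_in_V: "0 \<notin> set ss \<Longrightarrow> word ss * v \<in> V (length ss) (sum_list ss)"
  by (rule lin_span_incl) (auto simp: words_def)

lemma x_V:
  assumes "w \<in> V n D"
  shows "x s * w \<in> V (Suc n) (D + s)"
proof (cases "s = 0")
  case True
  then show ?thesis by (simp add: x_0 V_intros)
next
  case False
  show ?thesis
  proof (rule lin_span_mult[OF left_ideal _ assms])
    fix w assume "w \<in> words n D"
    then obtain ss where "w = word ss * v" "length ss = n" "0 \<notin> set ss" "sum_list ss \<le> D"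
      by (auto simp: words_def)
    then show "x s * w \<in> V (Suc n) (D + s)"
      using False by (intro lin_span_incl)
        (auto simp: words_def mult.assoc intro!: exI[of _ "s # ss"])
  qed
qed

text \<open>Commuting \<open>d b\<close> past a letter costs one unit of degree, so \<open>d b\<close> raises the degree
  by at most \<open>b - 1\<close>.\<close>

lemma d_word:
  assumes "0 \<notin> set ss"
  shows "d b * (word ss * v) \<in> V (length ss) (sum_list ss + (b - 1))"
  using assms
proof (induction ss arbitrary: b)
  case Nil
  obtain c where c: "d b * v - scalar c * v \<in> A" using weight by blast
  have "scalar c * v \<in> V 0 0"
    by (rule lin_span.scal) (auto simp: words_def)
  then have "(d b * v - scalar c * v) + scalar c * v \<in> V 0 0"
    by (intro lin_span.add lin_span.base[OF c])
  then show ?case by (auto intro: V_mono)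
next
  case (Cons s ss)
  define w where "w = word ss * v"
  define n where "n = length ss"
  define D where "D = sum_list ss"
  have IH: "d b * w \<in> V n (D + (b - 1))" for b
    using Cons by (simp add: w_def n_def D_def)
  have s: "s > 0" using Cons by auto
  have "x a * (d (b + s - 1 - a) * w) - x (b + s - 1 - a) * (d a * w)
      \<in> V (Suc n) (D + s + (b - 1))" if "a \<in> {..<min b s}" for a
  proof (rule V_intros)
    have "x a * (d (b + s - 1 - a) * w) \<in> V (Suc n) (D + (b + s - 1 - a - 1) + a)"
      by (intro x_V IH)
    then show "x a * (d (b + s - 1 - a) * w) \<in> V (Suc n) (D + s + (b - 1))"
      by (rule V_mono) (use that in auto)
    \<comment> \<open>The bound is sharp for \<open>a = 0\<close> only: then \<open>d 0 = 1\<close>,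
      and \<open>a - 1\<close> is 0 in the natural numbers.\<close>
    have "x (b + s - 1 - a) * (d a * w) \<in> V (Suc n) (D + (a - 1) + (b + s - 1 - a))"
      by (intro x_V IH)
    then show "x (b + s - 1 - a) * (d a * w) \<in> V (Suc n) (D + s + (b - 1))"
      by (rule V_mono) (use that in auto)
  qed
  then have "scalar \<epsilon> * (\<Sum>a<min b s. x a * (d (b + s - 1 - a) * w) - x (b + s - 1 - a) * (d a * w))
      \<in> V (Suc n) (D + s + (b - 1))"
    by (intro lin_span_scalar lin_span_sum left_ideal)
  moreover have "x s * (d b * w) \<in> V (Suc n) (D + s + (b - 1))"
    by (rule V_mono[OF x_V[OF IH]]) simp
  ultimately have "x s * (d b * w) + scalar \<epsilon> * (\<Sum>a<min b s. x a * (d (b + s - 1 - a) * w)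
      - x (b + s - 1 - a) * (d a * w)) \<in> V (Suc n) (D + s + (b - 1))" by (rule lin_span.add[rotated])
  also have "x s * (d b * w) + scalar \<epsilon> * (\<Sum>a<min b s. x a * (d (b + s - 1 - a) * w)
      - x (b + s - 1 - a) * (d a * w)) = d b * x s * w"
    unfolding exchange
    by (simp only: distrib_right mult.assoc sum_distrib_right left_diff_distrib)
  finally show ?case by (simp add: w_def n_def D_def mult.assoc add_ac)
qed

lemma d_V:
  assumes "w \<in> V n D"
  shows "d b * w \<in> V n (D + (b - 1))"
proof (rule lin_span_mult[OF left_ideal _ assms])
  fix w assume "w \<in> words n D"
  then obtain ss where "w = word ss * v" "length ss = n" "0 \<notin> set ss" "sum_list ss \<le> D"
    by (auto simp: words_def)
  then show "d b * w \<in> V n (D + (b - 1))"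
    using d_word[of ss b] by (auto intro: V_mono)
qed

lemma word_extract:
  assumes "k \<le> count_list ss q"
  shows "\<exists>ss'. word ss = x q ^ k * word ss' \<and> length ss = k + length ss' \<and>
    sum_list ss = k * q + sum_list ss' \<and> set ss' \<subseteq> set ss"
  using assms
proof (induction ss arbitrary: k)
  case Nil
  then show ?case by (intro exI[of _ "[]"]) auto
next
  case (Cons s ss)
  show ?case
  proof (cases "s = q \<and> k > 0")
    case True
    then obtain k' where k': "k = Suc k'" by (cases k) auto
    then obtain ss' where "word ss = x q ^ k' * word ss'" "length ss = k' + length ss'"
      "sum_list ss = k' * q + sum_list ss'" "set ss' \<subseteq> set ss"
      using Cons.IH[of k'] Cons.prems True by auto
    then show ?thesis using True k' by (intro exI[of _ ss']) (auto simp: mult.assoc)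
  next
    case False
    then have "k \<le> count_list ss q" using Cons.prems by (auto split: if_splits)
    then obtain ss' where ss': "word ss = x q ^ k * word ss'" "length ss = k + length ss'"
      "sum_list ss = k * q + sum_list ss'" "set ss' \<subseteq> set ss"
      using Cons.IH[of k] by blast
    have "word (s # ss) = (x s * x q ^ k) * word ss'" by (simp add: ss'(1) mult.assoc)
    also have "x s * x q ^ k = x q ^ k * x s"
      by (rule power_commuting_commutes[OF x_commute, symmetric])
    finally have "word (s # ss) = x q ^ k * word (s # ss')" by (simp add: mult.assoc)
    then show ?thesis using ss' by (intro exI[of _ "s # ss'"]) auto
  qed
qed

end

text \<open>\<open>dinv\<close> collects the coefficients of d(u)^{-1}, needed because e(u) =
  d_1(u)^{-1} t_{1,2}(u) and f(u) = t_{2,1}(u) d_1(u)^{-1}.\<close>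

locale invertible_exchange_relations = exchange_relations scalar x d \<epsilon> A v
  for scalar :: "'k::field \<Rightarrow> 'a::ring_1" and x d \<epsilon> A v +
  fixes dinv :: "nat \<Rightarrow> 'a"
  assumes dinv_0: "dinv 0 = 1"
    and dinv: "b > 0 \<Longrightarrow> (\<Sum>a=0..b. d a * dinv (b - a)) = 0"
begin

text \<open>Solve the convolution identity for \<open>dinv b\<close>. The summand with indices
  \<open>a\<close> and \<open>b - a\<close> raises the degree by at most (b - a - 1) + (a - 1), each
  bracket cut off at 0, hence by at most b - 1: the inverse obeys the same bound as
  \<open>d\<close>.\<close>

lemma dinv_V: "w \<in> V n D \<Longrightarrow> dinv b * w \<in> V n (D + (b - 1))"
proof (induction b rule: less_induct)
  case (less b)
  show ?case
  proof (cases "b = 0")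
    case True
    then show ?thesis using less by (simp add: dinv_0)
  next
    case False
    have "(\<Sum>a=0..b. d a * dinv (b - a)) = dinv b + (\<Sum>a=1..b. d a * dinv (b - a))"
      by (subst sum.atLeast_Suc_atMost) (simp_all add: d_0)
    then have "dinv b = - (\<Sum>a=1..b. d a * dinv (b - a))"
      using dinv[of b] False by (simp add: add_eq_0_iff2)
    then have "dinv b * w = 0 - (\<Sum>a=1..b. d a * (dinv (b - a) * w))"
      by (simp add: sum_distrib_right mult.assoc)
    also have "\<dots> \<in> V n (D + (b - 1))"
    proof (intro V_intros)
      fix a assume a: "a \<in> {1..b}"
      have "d a * (dinv (b - a) * w) \<in> V n (D + (b - a - 1) + (a - 1))"
        using a less by (intro d_V less.IH) auto
      then show "d a * (dinv (b - a) * w) \<in> V n (D + (b - 1))"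
        by (rule V_mono) (use a in auto)
    qed
    finally show ?thesis .
  qed
qed

text \<open>In the graded space of the degree filtration, \<open>f\<close> has the same symbol as
  \<open>x r\<close>.\<close>

definition leading :: "'a \<Rightarrow> nat \<Rightarrow> bool" where
  "leading f r \<longleftrightarrow> (\<forall>n D w. w \<in> V n D \<longrightarrow> f * w - x r * w \<in> V (Suc n) (D + r - 1))"

text \<open>The shape of f^{(r)}; \<open>leading_left\<close> treats that of e^{(r)}. In every
  summand but one, a factor \<open>dinv\<close> of positive index costs one unit of degree.\<close>

lemma leading_right:
  assumes "r > 0"
  shows "leading (\<Sum>a=0..r. x a * dinv (r - a)) r"
  unfolding leading_def
proof (intro allI impI)
  fix n D w assume w: "w \<in> V n D"
  have "(\<Sum>a=0..r. x a * dinv (r - a)) * w - x r * w = (\<Sum>a\<in>{0..<r}. x a * (dinv (r - a) * w))"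
    by (simp add: sum.last_plus dinv_0 sum_distrib_right distrib_right mult.assoc)
  also have "\<dots> \<in> V (Suc n) (D + r - 1)"
  proof (intro V_intros)
    fix a assume "a \<in> {0..<r}"
    then show "x a * (dinv (r - a) * w) \<in> V (Suc n) (D + r - 1)"
      by (intro V_mono[OF x_V[OF dinv_V[OF w]]]) auto
  qed
  finally show "(\<Sum>a=0..r. x a * dinv (r - a)) * w - x r * w \<in> V (Suc n) (D + r - 1)" .
qed

lemma leading_left:
  assumes "r > 0"
  shows "leading (\<Sum>a=0..r. dinv a * x (r - a)) r"
  unfolding leading_def
proof (intro allI impI)
  fix n D w assume w: "w \<in> V n D"
  have "(\<Sum>a=0..r. dinv a * x (r - a)) * w - x r * w = (\<Sum>a\<in>{Suc 0..r}. dinv a * (x (r - a) * w))"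
    by (subst sum.atLeast_Suc_atMost) (simp_all add: dinv_0 sum_distrib_right distrib_right mult.assoc)
  also have "\<dots> \<in> V (Suc n) (D + r - 1)"
  proof (intro V_intros)
    fix a assume "a \<in> {Suc 0..r}"
    then show "dinv a * (x (r - a) * w) \<in> V (Suc n) (D + r - 1)"
      by (intro V_mono[OF dinv_V[OF x_V[OF w]]]) auto
  qed
  finally show "(\<Sum>a=0..r. dinv a * x (r - a)) * w - x r * w \<in> V (Suc n) (D + r - 1)" .
qed

text \<open>With \<open>?z\<close> the error for \<open>k\<close>, the error for
  \<open>k + 1\<close> is \<open>f * ?z\<close> plus the error of one further factor
  \<open>f\<close> on \<open>x r ^ k * w\<close>; both stay below the top degree.\<close>

lemma leading_power:
  assumes f: "leading f r" and r: "r > 0" and w: "w \<in> V n D"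
  shows "f ^ k * w - x r ^ k * w \<in> V (n + k) (D + r * k - 1)"
proof (induction k)
  case 0
  then show ?case by (simp add: V_intros)
next
  case (Suc k)
  let ?z = "f ^ k * w - x r ^ k * w"
  have xk: "x r ^ k * w \<in> V (n + k) (D + r * k)"
  proof (induction k)
    case (Suc k)
    then show ?case using x_V[of "x r ^ k * w" "n + k" "D + r * k" r] by (simp add: mult.assoc add_ac)
  qed (use w in simp)
  have 1: "f * (x r ^ k * w) - x r * (x r ^ k * w) \<in> V (Suc (n + k)) (D + r * k + r - 1)"
    using f xk unfolding leading_def by blast
  have "f * ?z - x r * ?z \<in> V (Suc (n + k)) (D + r * k - 1 + r - 1)"
    using f Suc unfolding leading_def by blast
  moreover have "x r * ?z \<in> V (Suc (n + k)) (D + r * k - 1 + r)"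
    by (rule x_V[OF Suc])
  ultimately have 2: "(f * ?z - x r * ?z) + x r * ?z \<in> V (Suc (n + k)) (D + r * k - 1 + r)"
    by (intro lin_span.add) (erule V_mono, simp)+
  show ?case
  proof (cases "D + r * k = 0")
    \<comment> \<open>Here the subtraction in \<open>D + r * k - 1\<close> is cut off at 0. Since
      \<open>r > 0\<close>, this forces \<open>k = 0\<close>, and the claim is the estimate for a
      single factor.\<close>
    case True
    then have "k = 0" "D = 0" using r by auto
    then show ?thesis using 1 by simp
  next
    case False
    have "f ^ Suc k * w - x r ^ Suc k * w = ((f * ?z - x r * ?z) + x r * ?z) +
        (f * (x r ^ k * w) - x r * (x r ^ k * w))"
      by (simp add: algebra_simps)
    also have "\<dots> \<in> V (Suc (n + k)) (D + r * k + r - 1)"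
      by (intro lin_span.add[OF V_mono[OF 2] 1]) (use False in linarith)
    finally show ?thesis by (simp add: add_ac)
  qed
qed

end

text \<open>Pigeonhole. As the average index is at most r, at most half of the letters exceed 2 r.
  If every letter occurred fewer than p times, at most 2 r (p - 1) of them would be at most 2 r, so
  the length would be at most 4 r (p - 1). This is the origin of the constant 4.\<close>

lemma repeated_letter:
  assumes "length ss \<ge> 4 * r * p" and "sum_list ss \<le> length ss * r" and "0 \<notin> set ss"
    and "r > 0" "p > 0"
  shows "\<exists>q. count_list ss q \<ge> p"
proof (rule ccontr)
  assume "\<not> (\<exists>q. p \<le> count_list ss q)"
  then have less: "count_list ss q \<le> p - 1" for q
    using \<open>p > 0\<close> by (simp add: not_le) (metis Suc_pred less_Suc_eq_le)
  define m where "m = 2 * r"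
  have "length (filter (\<lambda>q. q \<le> m) ss) \<le> (\<Sum>q\<in>{1..m}. count_list ss q)"
    using \<open>0 \<notin> set ss\<close>
  proof (induction ss)
    case (Cons s ss)
    have "(\<Sum>q\<in>{1..m}. count_list (s # ss) q) =
        (\<Sum>q\<in>{1..m}. count_list ss q) + (\<Sum>q\<in>{1..m}. if s = q then 1 else 0)"
      by (subst sum.distrib[symmetric], intro sum.cong) auto
    also have "(\<Sum>q\<in>{1..m}. if s = q then 1 else 0) = (if s \<le> m then 1 else (0::nat))"
      using Cons.prems by (auto simp: sum.delta')
    finally show ?case using Cons by auto
  qed simp
  also have "(\<Sum>q\<in>{1..m}. count_list ss q) \<le> m * (p - 1)"
    using sum_mono[of "{1..m}" "count_list ss" "\<lambda>_. p - 1"] less by simp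
  finally have small: "length (filter (\<lambda>q. q \<le> m) ss) \<le> m * (p - 1)" .
  have "m * length (filter (\<lambda>q. \<not> q \<le> m) ss) \<le> sum_list ss"
    by (induction ss) auto
  then have "m * length (filter (\<lambda>q. \<not> q \<le> m) ss) \<le> length ss * r"
    using assms(2) by (rule le_trans)
  then have "r * (2 * length (filter (\<lambda>q. \<not> q \<le> m) ss)) \<le> r * length ss"
    unfolding m_def by (simp only: mult_ac)
  then have "2 * length (filter (\<lambda>q. \<not> q \<le> m) ss) \<le> length ss"
    using \<open>r > 0\<close> by (simp only: mult_le_cancel1)
  moreover have "2 * length (filter (\<lambda>q. q \<le> m) ss) \<le> 4 * r * (p - 1)"
    using small by (simp add: m_def)
  ultimately have "length ss \<le> 4 * r * (p - 1)"
    using sum_length_filter_compl[of "\<lambda>q. q \<le> m" ss] by linarith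
  moreover have "4 * r * (p - 1) < 4 * r * p" using assms(4,5) by simp
  ultimately show False using assms(1) by linarith
qed

context invertible_exchange_relations
begin

text \<open>Descent in the degree with the length fixed. Lowering \<open>D\<close> preserves
  \<open>D \<le> n * r\<close>, so a repeated letter is available at every stage, and in degree 0 no
  word of positive length is left.\<close>

theorem long_words_vanish:
  assumes lead: "\<And>r. r > 0 \<Longrightarrow> \<exists>f. leading f r \<and> f ^ p = 0"
    and p: "p > 0" and r: "r > 0" and n: "4 * r * p \<le> n" and D: "D \<le> n * r" and w: "w \<in> V n D"
  shows "w \<in> A"
  using D w
proof (induction D arbitrary: w)
  case 0
  have "0 < 4 * r * p" using r p by simp
  then have "n \<noteq> 0" using n by linarith
  then have "words n 0 = {}" by (auto simp: words_def neq_Nil_conv)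
  with 0 show ?case
    using lin_span_empty[OF left_ideal] by simp
next
  case (Suc D)
  have "words n (Suc D) \<subseteq> V n D"
  proof
    fix w assume "w \<in> words n (Suc D)"
    then obtain ss where ss: "w = word ss * v" "length ss = n" "0 \<notin> set ss" "sum_list ss \<le> Suc D"
      by (auto simp: words_def)
    obtain q where "count_list ss q \<ge> p"
      using repeated_letter[of r p ss] ss n Suc.prems r p by auto
    then obtain ss' where ss': "word ss = x q ^ p * word ss'" "length ss = p + length ss'"
      "sum_list ss = p * q + sum_list ss'" "set ss' \<subseteq> set ss"
      using word_extract by blast
    have "q \<in> set ss" using \<open>count_list ss q \<ge> p\<close> p count_notin[of q ss] by (cases "q \<in> set ss") auto
    then have q: "q > 0" using ss(3) by (metis gr0I)
    then obtain f where f: "leading f q" "f ^ p = 0" using lead by blast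
    have "f ^ p * (word ss' * v) - x q ^ p * (word ss' * v) \<in>
        V (length ss' + p) (sum_list ss' + q * p - 1)"
      using ss ss' by (intro leading_power f q word_in_V) auto
    then have "scalar (-1) * (f ^ p * (word ss' * v) - x q ^ p * (word ss' * v)) \<in>
        V (length ss' + p) (sum_list ss' + q * p - 1)"
      by (rule V_intros)
    moreover have "scalar (-1) * (f ^ p * (word ss' * v) - x q ^ p * (word ss' * v)) = w"
      using f ss ss' by (simp add: scalar_uminus mult.assoc)
    ultimately have "w \<in> V (length ss' + p) (sum_list ss' + q * p - 1)" by simp
    then show "w \<in> V n D"
      using ss ss' by (auto simp: add_ac mult.commute intro: V_mono)
  qed
  then have "w \<in> V n D" using Suc.prems lin_span_sub[OF left_ideal] by blast
  then show ?case using Suc by simp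
qed

corollary power_vanish:
  assumes "\<And>r. r > 0 \<Longrightarrow> \<exists>f. leading f r \<and> f ^ p = 0" and "p > 0"
  shows "\<exists>n. x r ^ n * v \<in> A"
proof (cases "r = 0")
  case True
  then show ?thesis using left_ideal by (intro exI[of _ 1]) (simp add: x_0 left_ideal_0)
next
  case False
  have "word (replicate n r) = x r ^ n" for n by (induction n) auto
  then have "x r ^ (4 * r * p) * v \<in> V (4 * r * p) (4 * r * p * r)"
    using word_in_V[of "replicate (4 * r * p) r"] False by (auto simp: sum_list_replicate)
  then show ?thesis
    using long_words_vanish[OF assms, of r "4 * r * p" "4 * r * p * r"] False by blast
qed

end

section \<open>Relations in the restricted Yangian\<close>

lemma poly_mapping_single_induct:
  assumes "\<And>k c. P (Poly_Mapping.single k c)" and "\<And>f g. P f \<Longrightarrow> P g \<Longrightarrow> P (f + g)"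
  shows "P (f :: 'b \<Rightarrow>\<^sub>0 'c::comm_monoid_add)"
proof (induction f rule: update_induct)
  case const
  show ?case using assms(1)[of undefined 0] by simp
next
  case (update f a b)
  have "Poly_Mapping.update a b f = f + Poly_Mapping.single a b"
    using update(1) by (intro poly_mapping_eqI)
      (auto simp: lookup_update lookup_add lookup_single when_def in_keys_iff)
  then show ?case using assms update by simp
qed

lemma free_scalar_central: "free_scalar c * x = x * (free_scalar c :: ('g, 'k::field) free_algebra)"
  by (induction x rule: poly_mapping_single_induct)
     (simp_all add: free_scalar_def mult_single mult.commute algebra_simps)

lemma single_Free_Word:
  "Poly_Mapping.single (Free_Word gs) c = free_scalar c * prod_list (map free_gen gs)"
proof (induction gs arbitrary: c)
  case Nil
  then show ?case by (simp add: free_scalar_def zero_free_monoid_def)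
next
  case (Cons g gs)
  have "Poly_Mapping.single (Free_Word (g # gs)) c =
      free_gen g * Poly_Mapping.single (Free_Word gs) c"
    by (simp add: free_gen_def mult_single)
  then show ?case
    by (simp add: Cons mult.assoc[symmetric] free_scalar_central[symmetric])
qed

interpretation yangian: central_algebra "yangian_scalar :: 'k::field \<Rightarrow> 'k yangian"
proof
  fix a b c :: 'k and x :: "'k yangian"
  show "yangian_scalar 1 = (1 :: 'k yangian)"
    by transfer (simp add: free_scalar_def ideal_rel_def gen_ideal_zero)
  show "yangian_scalar (a + b) = (yangian_scalar a + yangian_scalar b :: 'k yangian)"
    by transfer (simp add: free_scalar_def single_add ideal_rel_def gen_ideal_zero)
  show "yangian_scalar (a * b) = (yangian_scalar a * yangian_scalar b :: 'k yangian)"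
    by transfer (simp add: free_scalar_def mult_single ideal_rel_def gen_ideal_zero)
  show "yangian_scalar c * x = x * yangian_scalar c"
    by transfer (simp add: free_scalar_central ideal_rel_def gen_ideal_zero)
qed

lemma to_restricted_hom:
  "to_restricted 0 = 0" "to_restricted 1 = 1"
  "to_restricted (x + y) = to_restricted x + to_restricted y"
  "to_restricted (x - y) = to_restricted x - to_restricted y"
  "to_restricted (x * y) = to_restricted x * to_restricted y"
  by (simp_all add: to_restricted_def zero_restricted_yangian_def one_restricted_yangian_def
      plus_restricted_yangian.abs_eq minus_restricted_yangian.abs_eq times_restricted_yangian.abs_eq)

lemma to_restricted_sum: "to_restricted (sum g I) = (\<Sum>i\<in>I. to_restricted (g i))"
  by (induction I rule: infinite_finite_induct) (simp_all add: to_restricted_hom)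

lemma to_restricted_power: "to_restricted (x ^ n) = to_restricted x ^ n"
  by (induction n) (simp_all add: to_restricted_hom)

lemma surj_to_restricted: "\<exists>y. x = to_restricted y"
  unfolding to_restricted_def by (metis Quotient_restricted_yangian Quotient_abs_rep)

interpretation restricted: central_algebra
  "restricted_scalar :: 'k::field_prime_char \<Rightarrow> 'k restricted_yangian"
proof
  fix a b c :: 'k and x :: "'k restricted_yangian"
  show "restricted_scalar 1 = (1 :: 'k restricted_yangian)"
    by (simp add: restricted_scalar_def to_restricted_hom)
  show "restricted_scalar (a + b) = (restricted_scalar a + restricted_scalar b :: 'k restricted_yangian)"
    by (simp add: restricted_scalar_def yangian.scalar_add to_restricted_hom)
  show "restricted_scalar (a * b) = (restricted_scalar a * restricted_scalar b :: 'k restricted_yangian)"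
    by (simp add: restricted_scalar_def yangian.scalar_mult to_restricted_hom)
  obtain y where "x = to_restricted y" using surj_to_restricted by blast
  then show "restricted_scalar c * x = x * restricted_scalar c"
    by (simp add: restricted_scalar_def to_restricted_hom[symmetric] yangian.scalar_central)
qed

definition restricted_t :: "2 \<Rightarrow> 2 \<Rightarrow> nat \<Rightarrow> 'k::field_prime_char restricted_yangian" where
  "restricted_t i j r = to_restricted (yangian_t i j r)"

lemma restricted_t_0: "restricted_t i j 0 = (if i = j then 1 else 0)"
  by (simp add: restricted_t_def yangian_t_0 to_restricted_hom)

lemma yangian_t_commutator:
  assumes "r > 0" "s > 0"
  shows "yangian_t i j r * yangian_t k l s - yangian_t k l s * yangian_t i j r =
    (\<Sum>a<min r s. yangian_t k j a * yangian_t i l (r + s - 1 - a)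
       - yangian_t k j (r + s - 1 - a) * (yangian_t i l a :: 'k::field yangian))"
proof -
  have sum: "(\<Sum>a\<in>I. abs_yangian (g a)) = abs_yangian (sum g I)"
    for g :: "nat \<Rightarrow> 'k yangian_free" and I
    by (induction I rule: infinite_finite_induct)
       (simp_all add: zero_yangian_def plus_yangian.abs_eq)
  have t: "yangian_t i j r = abs_yangian (free_t i j r :: 'k yangian_free)" for i j r
    by (simp add: yangian_t_def)
  have "ideal_rel yangian_relators
      (free_t i j r * free_t k l s - free_t k l s * free_t i j r)
      (\<Sum>a<min r s. free_t k j a * free_t i l (r + s - 1 - a)
         - free_t k j (r + s - 1 - a) * free_t i l a :: 'k yangian_free)"
    unfolding ideal_rel_def
    by (rule gen_ideal_incl, unfold yangian_relators_def, rule CollectI,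
        rule exI[of _ i], rule exI[of _ j], rule exI[of _ k], rule exI[of _ l],
        rule exI[of _ r], rule exI[of _ s], intro conjI refl assms)
  then show ?thesis
    by (simp add: t sum times_yangian.abs_eq minus_yangian.abs_eq yangian.abs_eq_iff)
qed

text \<open>For \<open>r = 0\<close> or \<open>s = 0\<close> the sum is empty and t^{(0)} is 0 or 1,
  so both sides vanish; the relation can then be used without side conditions.\<close>

lemma restricted_t_commutator:
  "restricted_t i j r * restricted_t k l s - restricted_t k l s * restricted_t i j r =
    (\<Sum>a<min r s. restricted_t k j a * restricted_t i l (r + s - 1 - a)
       - restricted_t k j (r + s - 1 - a) * (restricted_t i l a :: 'k::field_prime_char restricted_yangian))"
proof (cases "r = 0 \<or> s = 0")
  case True
  then show ?thesis by (auto simp: restricted_t_0)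
next
  case False
  then show ?thesis
    using arg_cong[OF yangian_t_commutator[of r s i j k l], of "to_restricted :: 'k yangian \<Rightarrow> _"]
    by (simp add: restricted_t_def to_restricted_hom to_restricted_sum)
qed

text \<open>For equal index pairs the right side of the relation is a sum of commutators within the
  same family. One of their upper indices is \<open>a\<close>, which is less than
  \<open>min r s\<close>; hence the induction.\<close>

lemma restricted_t_commute:
  "restricted_t i j r * restricted_t i j s =
    restricted_t i j s * (restricted_t i j r :: 'k::field_prime_char restricted_yangian)"
proof (induction "min r s" arbitrary: r s rule: less_induct)
  case less
  let ?t = "restricted_t i j :: nat \<Rightarrow> 'k restricted_yangian"
  have "?t r * ?t s - ?t s * ?t r =
      (\<Sum>a<min r s. ?t a * ?t (r + s - 1 - a) - ?t (r + s - 1 - a) * ?t a)"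
    by (rule restricted_t_commutator)
  also have "\<dots> = 0"
  proof (rule sum.neutral, rule ballI)
    fix a assume "a \<in> {..<min r s}"
    then have "min a (r + s - 1 - a) < min r s" by auto
    from less[OF this] show "?t a * ?t (r + s - 1 - a) - ?t (r + s - 1 - a) * ?t a = 0" by simp
  qed
  finally show ?case by simp
qed

lemma restricted_yangian_induct [case_names one scalar add mult]:
  fixes x :: "'k::field_prime_char restricted_yangian"
  assumes "P 1" and "\<And>c x. P x \<Longrightarrow> P (restricted_scalar c * x)"
    and "\<And>x y. P x \<Longrightarrow> P y \<Longrightarrow> P (x + y)"
    and "\<And>i j r x. P x \<Longrightarrow> P (restricted_t i j r * x)"
  shows "P x"
proof -
  let ?h = "\<lambda>y :: 'k yangian_free. to_restricted (abs_yangian y)"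
  have hom: "?h (y + z) = ?h y + ?h z" "?h (y * z) = ?h y * ?h z" for y z
    by (simp_all add: to_restricted_hom[symmetric] plus_yangian.abs_eq times_yangian.abs_eq)
  have one: "?h 1 = 1"
    by (simp add: to_restricted_hom[symmetric] one_yangian_def)
  have scal: "?h (free_scalar c) = restricted_scalar c" for c
    by (simp add: restricted_scalar_def yangian_scalar_def)
  have gen: "?h (free_gen g) = (case g of (i, j, n) \<Rightarrow> restricted_t i j (Suc n))" for g
    by (cases g) (simp add: restricted_t_def yangian_t_def free_t_def)
  obtain y where "x = to_restricted y" using surj_to_restricted by blast
  moreover obtain z where "y = abs_yangian z" by (metis Quotient_yangian Quotient_abs_rep)
  moreover have "P (?h z)"
  proof (induction z rule: poly_mapping_single_induct)
    case (1 w c)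
    obtain gs where w: "w = Free_Word gs" by (cases w)
    have "P (?h (prod_list (map free_gen gs)))"
      by (induction gs) (auto simp: one hom gen assms split: prod.split)
    then show ?case by (simp add: w single_Free_Word hom scal assms)
  next
    case (2 f g)
    then show ?case by (simp add: hom assms)
  qed
  ultimately show ?thesis by simp
qed

subsection \<open>The Drinfeld generators\<close>

definition restricted_dinv :: "nat \<Rightarrow> 'k::field_prime_char restricted_yangian" where
  "restricted_dinv r = to_restricted (fps_nth (fps_left_inverse (t_series 1 1) 1) r)"

definition restricted_f :: "nat \<Rightarrow> 'k::field_prime_char restricted_yangian" where
  "restricted_f r = to_restricted (fps_nth f_series r)"

lemma to_restricted_fps_mult:
  "to_restricted (fps_nth (g * h) n) =
    (\<Sum>i=0..n. to_restricted (fps_nth g i) * to_restricted (fps_nth h (n - i)))"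
  by (simp add: fps_mult_nth to_restricted_sum to_restricted_hom)

lemma to_restricted_t_series: "to_restricted (fps_nth (t_series i j) r) = restricted_t i j r"
  by (simp add: t_series_def restricted_t_def)

text \<open>A left inverse occurs in the definition of e(u) and a right inverse in that of f(u);
  identifying them allows the single family \<open>restricted_dinv\<close> for both.\<close>

lemma t_series_inverse_eq:
  "fps_right_inverse (t_series i i) 1 = (fps_left_inverse (t_series i i) 1 :: 'k::field yangian fps)"
  by (rule fps_left_inverse_eq_fps_right_inverse[symmetric]) simp_all

lemma restricted_dinv_0: "restricted_dinv 0 = 1"
  by (simp add: restricted_dinv_def to_restricted_hom)

lemma restricted_t_dinv:
  assumes "r > 0"
  shows "(\<Sum>a=0..r. restricted_t 1 1 a * restricted_dinv (r - a)) =
    (0 :: 'k::field_prime_char restricted_yangian)"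
proof -
  have "t_series 1 1 * fps_left_inverse (t_series 1 1) 1 = (1 :: 'k yangian fps)"
    unfolding t_series_inverse_eq[symmetric] by (rule fps_right_inverse) simp
  then have "to_restricted (fps_nth (t_series 1 1 * fps_left_inverse (t_series 1 1) 1) r) =
      (0 :: 'k restricted_yangian)"
    using assms by (simp add: to_restricted_hom)
  then show ?thesis
    by (simp only: to_restricted_fps_mult to_restricted_t_series restricted_dinv_def)
qed

lemma restricted_e_eq: "restricted_e r = (\<Sum>a=0..r. restricted_dinv a * restricted_t 1 2 (r - a))"
  unfolding restricted_e_def e_series_def to_restricted_fps_mult restricted_dinv_def
  by (simp add: to_restricted_t_series)

lemma restricted_f_eq: "restricted_f r = (\<Sum>a=0..r. restricted_t 2 1 a * restricted_dinv (r - a))"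
  unfolding restricted_f_def f_series_def to_restricted_fps_mult restricted_dinv_def
    t_series_inverse_eq
  by (simp add: to_restricted_t_series)

lemma restricted_e_0: "restricted_e 0 = 0"
  by (simp add: restricted_e_def drinfeld_generators_nth_0 to_restricted_hom)

lemma restricted_d_1: "restricted_d 1 r = restricted_t 1 1 r"
  by (simp add: restricted_d_def drinfeld_generators(1)[symmetric] to_restricted_t_series)

lemma restricted_t_12_eq: "restricted_t 1 2 r = (\<Sum>a=0..r. restricted_d 1 a * restricted_e (r - a))"
  unfolding to_restricted_t_series[symmetric] drinfeld_generators(2) to_restricted_fps_mult
  by (simp add: restricted_d_def restricted_e_def)

text \<open>The coefficients \<open>g\<close> come from f(u) d_1(u). This form suffices to replace
  t_{2,2}^{(r)} by d_2^{(r)} modulo a left ideal that contains all e^{(r)}.\<close>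

lemma restricted_t_22_eq:
  "\<exists>g. restricted_t 2 2 r = (\<Sum>a=0..r. g a * restricted_e (r - a)) + restricted_d 2 r"
  unfolding to_restricted_t_series[symmetric] drinfeld_generators(4) fps_add_nth to_restricted_hom
    to_restricted_fps_mult
  by (intro exI[of _ "\<lambda>a. to_restricted (fps_nth (f_series * d_series 1) a)"])
     (simp add: restricted_d_def restricted_e_def to_restricted_fps_mult)

lemma to_restricted_p_center_gens:
  assumes "x \<in> p_center_gens"
  shows "to_restricted x = 0"
proof -
  have "ideal_rel p_center_plus x 0"
    using assms p_center_gens_subset_plus by (auto simp: ideal_rel_def intro: gen_ideal_incl)
  then show ?thesis
    by (simp add: to_restricted_def zero_restricted_yangian_def restricted_yangian.abs_eq_iff)
qed

lemma restricted_e_power: "r > 0 \<Longrightarrow> restricted_e r ^ CHAR('k) = (0 :: 'k::field_prime_char restricted_yangian)"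
  unfolding restricted_e_def to_restricted_power[symmetric]
  by (rule to_restricted_p_center_gens) (auto simp: p_center_gens_def)

lemma restricted_f_power: "r > 0 \<Longrightarrow> restricted_f r ^ CHAR('k) = (0 :: 'k::field_prime_char restricted_yangian)"
  unfolding restricted_f_def to_restricted_power[symmetric]
  by (rule to_restricted_p_center_gens) (auto simp: p_center_gens_def)

subsection \<open>Restricted series\<close>

context central_algebra
begin

text \<open>Both differences stand rightmost, where a left ideal containing them absorbs the factors
  in front; this arrangement relies on centrality of the scalars.\<close>

lemma mult_diff_scalar:
  "a * b - scalar c * scalar e = a * (b - scalar e) + scalar e * (a - scalar c)"
  by (simp add: right_diff_distrib scalar_central[of e a] scalar_central[of e "scalar c"])

lemma fps_mult_cong_scalar:
  assumes A: "left_ideal A"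
    and "\<And>n. fps_nth g n - scalar (fps_nth \<gamma> n) \<in> A" "\<And>n. fps_nth h n - scalar (fps_nth \<eta> n) \<in> A"
  shows "fps_nth (g * h) n - scalar (fps_nth (\<gamma> * \<eta>) n) \<in> A"
proof -
  have "fps_nth (g * h) n - scalar (fps_nth (\<gamma> * \<eta>) n) =
    (\<Sum>i=0..n. fps_nth g i * (fps_nth h (n - i) - scalar (fps_nth \<eta> (n - i))) +
       scalar (fps_nth \<eta> (n - i)) * (fps_nth g i - scalar (fps_nth \<gamma> i)))"
    unfolding fps_mult_nth scalar_sum sum_subtractf[symmetric] scalar_mult
    by (intro sum.cong refl mult_diff_scalar)
  also have "\<dots> \<in> A"
    using assms by (intro left_ideal_sum left_ideal_add left_ideal_mult)
  finally show ?thesis .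
qed

lemma fps_power_cong_scalar:
  assumes "left_ideal A" "\<And>n. fps_nth g n - scalar (fps_nth \<gamma> n) \<in> A"
  shows "fps_nth (g ^ k) n - scalar (fps_nth (\<gamma> ^ k) n) \<in> A"
proof (induction k arbitrary: n)
  case 0
  then show ?case using assms(1) by (cases n) (simp_all add: left_ideal_0)
next
  case (Suc k)
  then show ?case unfolding power_Suc by (intro fps_mult_cong_scalar assms)
qed

lemma shift_series_cong_scalar:
  assumes A: "left_ideal A" and g: "\<And>n. fps_nth g n - scalar (fps_nth \<gamma> n) \<in> A"
  shows "fps_nth (shift_series j g) n - scalar (fps_nth (shift_series j \<gamma>) n) \<in> A"
proof -
  let ?a = "Abs_fps (\<lambda>n. if n = 0 then 0 else of_nat j ^ (n - 1)) :: 'a fps"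
  let ?b = "Abs_fps (\<lambda>n. if n = 0 then 0 else of_nat j ^ (n - 1)) :: 'k fps"
  have "fps_nth ?a n - scalar (fps_nth ?b n) \<in> A" for n
    using A by (simp add: scalar_power scalar_of_nat left_ideal_0)
  then have p: "fps_nth (?a ^ i) n - scalar (fps_nth (?b ^ i) n) \<in> A" for i n
    by (intro fps_power_cong_scalar A)
  have "fps_nth (shift_series j g) n - scalar (fps_nth (shift_series j \<gamma>) n) =
    (\<Sum>i=0..n. fps_nth g i * (fps_nth (?a ^ i) n - scalar (fps_nth (?b ^ i) n)) +
       scalar (fps_nth (?b ^ i) n) * (fps_nth g i - scalar (fps_nth \<gamma> i)))"
    unfolding shift_series_def fps_compose_nth scalar_sum sum_subtractf[symmetric] scalar_mult
    by (intro sum.cong refl mult_diff_scalar)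
  also have "\<dots> \<in> A"
    using assms p by (intro left_ideal_sum left_ideal_add left_ideal_mult)
  finally show ?thesis .
qed

lemma shift_product_cong_scalar:
  assumes A: "left_ideal A" and g: "\<And>n. fps_nth g n - scalar (fps_nth \<gamma> n) \<in> A"
  shows "fps_nth (shift_product k g) n - scalar (fps_nth (shift_product k \<gamma>) n) \<in> A"
proof (induction k arbitrary: n)
  case 0
  then show ?case using A by (cases n) (simp_all add: shift_product_def left_ideal_0)
next
  case (Suc k)
  have "shift_product (Suc k) g = shift_product k g * shift_series k g"
    "shift_product (Suc k) \<gamma> = shift_product k \<gamma> * shift_series k \<gamma>"
    by (simp_all add: shift_product_def)
  then show ?case
    using fps_mult_cong_scalar[OF A Suc shift_series_cong_scalar[OF A g]] by simp
qed

end

section \<open>The substitution of u - 1 for u in scalar series\<close>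

definition shift_var :: "nat \<Rightarrow> 'k::field fps" where
  "shift_var j = Abs_fps (\<lambda>n. if n = 0 then 0 else of_nat j ^ (n - 1))"

lemma shift_var_mult: "shift_var j * (1 - fps_const (of_nat j) * fps_X) = (fps_X :: 'k::field fps)"
proof (rule fps_ext)
  fix n
  have *: "shift_var j * (1 - fps_const (of_nat j) * fps_X) =
      shift_var j - fps_const (of_nat j) * (shift_var j * fps_X :: 'k fps)"
    by (simp add: right_diff_distrib mult.left_commute)
  show "fps_nth (shift_var j * (1 - fps_const (of_nat j) * fps_X)) n = fps_nth (fps_X :: 'k fps) n"
    unfolding * by (cases n; cases "n - 1") (simp_all add: shift_var_def)
qed

text \<open>Replacing u by u - 1 turns 1 / (u - j) into 1 / (u - j - 1). Both sides are compared
  after multiplication by 1 - (j + 1) X with X = u^{-1}, which is nonzero and can be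
  cancelled.\<close>

lemma shift_var_compose: "shift_var j oo shift_var 1 = (shift_var (Suc j) :: 'k::field fps)"
proof -
  let ?a = "shift_var 1 :: 'k fps" and ?s = "shift_var j oo shift_var 1 :: 'k fps"
  let ?K = "\<lambda>j. fps_const (of_nat j) :: 'k fps"
  have a0: "fps_nth ?a 0 = 0" by (simp add: shift_var_def)
  have a: "?a * (1 - fps_X) = fps_X" using shift_var_mult[of 1] by simp
  have K: "?K (Suc j) = 1 + ?K j"
    by (rule fps_ext) simp
  have "(shift_var j * (1 - ?K j * fps_X)) oo ?a = ?s * ((1 - ?K j * fps_X) oo ?a)"
    by (rule fps_compose_mult_distrib[OF a0])
  also have "(1 - ?K j * fps_X) oo ?a = 1 - ?K j * ?a"
    using a0 by (simp add: fps_compose_sub_distrib fps_compose_mult_distrib)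
  finally have "?a = ?s * (1 - ?K j * ?a)"
    using a0 unfolding shift_var_mult by simp
  then have "?a * (1 - fps_X) = ?s * ((1 - ?K j * ?a) * (1 - fps_X))"
    by (metis mult.assoc)
  also have "(1 - ?K j * ?a) * (1 - fps_X) = 1 - fps_X - ?K j * (?a * (1 - fps_X))"
    by (simp add: left_diff_distrib mult.assoc)
  also have "\<dots> = 1 - ?K (Suc j) * fps_X" unfolding a K by (simp add: distrib_right)
  finally have "?s * (1 - ?K (Suc j) * fps_X) = shift_var (Suc j) * (1 - ?K (Suc j) * fps_X)"
    unfolding shift_var_mult a by simp
  moreover have "1 - ?K (Suc j) * fps_X \<noteq> 0"
  proof
    assume "1 - ?K (Suc j) * fps_X = 0"
    then have "fps_nth (1 - ?K (Suc j) * fps_X) 0 = 0" by (simp only: fps_zero_nth)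
    then show False by simp
  qed
  ultimately show ?thesis by (simp only: mult_cancel_right) blast
qed

lemma shift_series_eq: "shift_series j g = g oo (shift_var j :: 'k::field fps)"
  by (simp add: shift_series_def shift_var_def)

lemma shift_series_Suc: "shift_series j g oo shift_var 1 = (shift_series (Suc j) g :: 'k::field fps)"
proof -
  have "fps_nth (shift_var j :: 'k fps) 0 = 0" "fps_nth (shift_var 1 :: 'k fps) 0 = 0"
    by (simp_all add: shift_var_def)
  then show ?thesis
    unfolding shift_series_eq by (simp only: fps_compose_assoc[symmetric] shift_var_compose)
qed

lemma shift_product_eq_prod: "shift_product n g = (\<Prod>j<n. shift_series j (g :: 'k::field fps))"
  by (induction n) (simp_all add: shift_product_def)

text \<open>The shift moves each factor to the next one, and the last returns to the first because u
  - p = u in characteristic p.\<close>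

lemma shift_product_shift_invariant:
  "shift_product CHAR('k) g oo shift_var 1 = shift_product CHAR('k) (g :: 'k::field_prime_char fps)"
proof -
  obtain q where q: "CHAR('k) = Suc q" using CHAR_pos[where 'a='k] gr0_implies_Suc by blast
  have "shift_var CHAR('k) = (shift_var 0 :: 'k fps)"
    unfolding shift_var_def of_nat_CHAR of_nat_0 ..
  then have last: "shift_series (Suc q) g = shift_series 0 g"
    by (simp add: shift_series_eq q)
  have "shift_product CHAR('k) g oo shift_var 1 = (\<Prod>j<Suc q. shift_series (Suc j) g)"
    unfolding q shift_product_eq_prod
    by (subst fps_compose_prod_distrib) (simp_all only: shift_series_Suc, simp add: shift_var_def)
  also have "\<dots> = (\<Prod>j<Suc q. shift_series j g)"
    unfolding prod.lessThan_Suc_shift[of _ q, where g="\<lambda>j. shift_series j g"]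
    by (simp add: last mult.commute)
  finally show ?thesis unfolding q shift_product_eq_prod .
qed

text \<open>The start of the expansion (u - 1)^{-n} = u^{-n} + n u^{-n-1} + ...; the second
  coefficient detects divisibility of \<open>n\<close> by the characteristic.\<close>

lemma shift_var_power_nth:
  "fps_nth (shift_var 1 ^ n) n = (1 :: 'k::field)"
  "fps_nth (shift_var 1 ^ n) (Suc n) = (of_nat n :: 'k::field)"
proof -
  let ?g = "Abs_fps (\<lambda>_. 1) :: 'k fps"
  have "shift_var 1 = fps_X * ?g"
    by (rule fps_ext) (simp add: shift_var_def)
  then have eq: "shift_var 1 ^ n = fps_X ^ n * ?g ^ n" by (simp add: power_mult_distrib)
  have g0: "fps_nth (?g ^ n) 0 = 1" for n by (induction n) simp_all
  have g1: "fps_nth (?g ^ n) (Suc 0) = of_nat n" for n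
    by (induction n) (simp_all add: fps_mult_nth g0)
  show "fps_nth (shift_var 1 ^ n) n = (1 :: 'k)" "fps_nth (shift_var 1 ^ n) (Suc n) = (of_nat n :: 'k)"
    unfolding eq by (simp_all add: fps_X_power_mult_nth g0 g1 Suc_diff_le)
qed

text \<open>If \<open>c u\<^sup>-\<^sup>n\<close> is the lowest term of a shift-invariant series without constant term, comparing the
  coefficients of \<open>u\<^sup>-\<^sup>n\<^sup>-\<^sup>1\<close> yields \<open>n c = 0\<close>, so \<open>n\<close> is divisible by the characteristic.\<close>

lemma shift_invariant_eq_1:
  fixes b :: "'k::field_prime_char fps"
  assumes inv: "b oo shift_var 1 = b" and "fps_nth b 0 = 1"
    and b: "\<And>r. r > 0 \<Longrightarrow> fps_nth b (r * CHAR('k)) = 0"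
  shows "b = 1"
proof (rule ccontr)
  assume "b \<noteq> 1"
  define q where "q = b - 1"
  define n where "n = subdegree q"
  have "q \<noteq> 0" using \<open>b \<noteq> 1\<close> by (simp add: q_def)
  then have qn: "fps_nth q n \<noteq> 0" by (simp add: n_def)
  have low: "fps_nth q i = 0" if "i < n" for i
    using that unfolding n_def by (rule nth_less_subdegree_zero)
  have "fps_nth q 0 = 0" by (simp add: q_def assms(2))
  then have "n > 0" using qn by (metis gr0I)
  have q_inv: "q oo shift_var 1 = q"
    unfolding q_def fps_compose_sub_distrib inv fps_compose_1 ..
  have "fps_nth (q oo shift_var 1) (Suc n) =
      (\<Sum>i\<in>{n, Suc n}. fps_nth q i * fps_nth (shift_var 1 ^ i) (Suc n))"
    unfolding fps_compose_nth
  proof (rule sum.mono_neutral_right)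
    show "\<forall>i\<in>{0..Suc n} - {n, Suc n}. fps_nth q i * fps_nth (shift_var 1 ^ i) (Suc n) = 0"
    proof
      fix i assume "i \<in> {0..Suc n} - {n, Suc n}"
      then have "i < n" by auto
      then show "fps_nth q i * fps_nth (shift_var 1 ^ i) (Suc n) = 0" by (simp only: low mult_zero_left)
    qed
  qed auto
  also have "\<dots> = fps_nth q n * of_nat n + fps_nth q (Suc n)"
    by (simp only: shift_var_power_nth sum.insert finite.intros insert_iff empty_iff n_not_Suc_n
        simp_thms sum.empty mult_1_right add_0_right)
  finally have "of_nat n = (0 :: 'k)" using qn by (simp only: q_inv) simp
  then have "CHAR('k) dvd n" by (simp only: of_nat_eq_0_iff_char_dvd)
  then obtain r where "n = CHAR('k) * r" by (elim dvdE)
  then have n: "n = r * CHAR('k)" by (simp only: mult.commute)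
  then have "r > 0" using \<open>n > 0\<close> by (cases r) auto
  then have "fps_nth b n = 0" unfolding n by (rule b)
  then show False using qn \<open>n > 0\<close> by (simp add: q_def)
qed

text \<open>In the restricted quotient b_i^{(rp)} = 0, while modulo \<open>A\<close> it is congruent
  to the corresponding coefficient of the shifted product of \<open>\<gamma>\<close>. Since
  \<open>A\<close> is proper, that coefficient is 0, and \<open>shift_invariant_eq_1\<close>
  applies.\<close>

lemma restricted_series_of_character:
  fixes A :: "'k::field_prime_char restricted_yangian set"
  assumes A: "left_ideal A" "1 \<notin> A"
    and "\<And>r. restricted_d i r - restricted_scalar (fps_nth \<gamma> r) \<in> A" and "fps_nth \<gamma> 0 = 1"
  shows "restricted_series \<gamma>"
proof -
  \<comment> \<open>The shifted products are formed in the Yangian itself, so \<open>A\<close> is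
    pulled back along the projection.\<close>
  define B where "B = {y. to_restricted y \<in> A}"
  have B: "left_ideal B"
    using A(1) by (auto simp: left_ideal_def B_def to_restricted_hom)
  let ?b = "shift_product CHAR('k) \<gamma>"
  have "fps_nth (d_series i) n - yangian_scalar (fps_nth \<gamma> n) \<in> B" for n
    using assms(3)[of n] by (simp add: B_def to_restricted_hom restricted_d_def restricted_scalar_def)
  then have *: "fps_nth (shift_product CHAR('k) (d_series i)) n - yangian_scalar (fps_nth ?b n) \<in> B" for n
    by (rule yangian.shift_product_cong_scalar[OF B])
  have "fps_nth ?b (r * CHAR('k)) = 0" if "r > 0" for r
  proof -
    have "to_restricted (fps_nth (shift_product CHAR('k) (d_series i)) (r * CHAR('k))) =
        (0 :: 'k restricted_yangian)"
      using that by (intro to_restricted_p_center_gens) (auto simp: p_center_gens_def)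
    then have "- restricted_scalar (fps_nth ?b (r * CHAR('k))) \<in> A"
      using *[of "r * CHAR('k)"] by (simp add: B_def to_restricted_hom restricted_scalar_def)
    from left_ideal_uminus[OF A(1) this]
    have "restricted_scalar (fps_nth ?b (r * CHAR('k))) * 1 \<in> A" by simp
    then show ?thesis using restricted.left_ideal_scalar_cancel[OF A(1)] A(2) by blast
  qed
  moreover have "fps_nth (shift_product n \<gamma>) 0 = 1" for n
    using assms(4) by (induction n) (simp_all add: shift_product_def shift_series_def)
  ultimately have "?b = 1"
    by (intro shift_invariant_eq_1 shift_product_shift_invariant)
  then show ?thesis by (simp add: restricted_series_def)
qed

section \<open>Highest weight vectors\<close>

text \<open>The type is the ring of integers modulo 2, where \<open>2\<close> denotes 0.\<close>

lemma two_cases: "(i :: 2) = 1 \<or> i = 2"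
proof (induction i)
  case (of_int z)
  then have "z = 0 \<or> z = 1" by auto
  then show ?case by auto
qed

text \<open>The commutator is taken with t_{1,2} first: this order yields products with t_{1,2} on
  the left, and it accounts for the sign -1.\<close>

lemma invertible_exchange_relations_12:
  fixes A :: "'k::field_prime_char restricted_yangian set"
  assumes "left_ideal A" and "\<And>r. \<exists>c. restricted_t 1 1 r * v - restricted_scalar c * v \<in> A"
  shows "invertible_exchange_relations restricted_scalar (restricted_t 1 2) (restricted_t 1 1) (-1) A v
    restricted_dinv"
proof
  let ?x = "restricted_t 1 2 :: nat \<Rightarrow> 'k restricted_yangian" and ?d = "restricted_t 1 1 :: nat \<Rightarrow> 'k restricted_yangian"
  fix b s :: nat
  show "?d b * ?x s = ?x s * ?d b + restricted_scalar (- 1) *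
      (\<Sum>a<min b s. ?x a * ?d (b + s - 1 - a) - ?x (b + s - 1 - a) * ?d a)"
    using restricted_t_commutator[of 1 2 s 1 1 b, where 'k='k]
    by (simp add: restricted.scalar_uminus min.commute add.commute algebra_simps)
qed (use assms in \<open>auto simp: restricted_t_0 restricted_t_commute restricted_t_dinv restricted_dinv_0\<close>)

lemma exchange_relations_21:
  fixes A :: "'k::field_prime_char restricted_yangian set"
  assumes "left_ideal A" and "\<And>r. \<exists>c. restricted_t i i r * v - restricted_scalar c * v \<in> A"
  shows "exchange_relations restricted_scalar (restricted_t 2 1) (restricted_t i i)
    (if i = 1 then 1 else - 1) A v"
proof
  let ?x = "restricted_t 2 1 :: nat \<Rightarrow> 'k restricted_yangian" and ?d = "restricted_t i i :: nat \<Rightarrow> 'k restricted_yangian"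
  fix b s :: nat
  have "i = 1 \<or> i = 2" by (rule two_cases)
  then show "?d b * ?x s = ?x s * ?d b + restricted_scalar (if i = 1 then 1 else - 1) *
      (\<Sum>a<min b s. ?x a * ?d (b + s - 1 - a) - ?x (b + s - 1 - a) * ?d a)"
  proof
    assume "i = 1"
    then show ?thesis using restricted_t_commutator[of 1 1 b 2 1 s, where 'k='k]
      by (simp add: algebra_simps)
  next
    assume "i = 2"
    then show ?thesis using restricted_t_commutator[of 2 1 s 2 2 b, where 'k='k]
      by (simp add: restricted.scalar_uminus min.commute add.commute algebra_simps)
  qed
qed (use assms in \<open>auto simp: restricted_t_0 restricted_t_commute\<close>)

lemma invertible_exchange_relations_21:
  fixes A :: "'k::field_prime_char restricted_yangian set"
  assumes "left_ideal A" and "\<And>r. \<exists>c. restricted_t 1 1 r * v - restricted_scalar c * v \<in> A"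
  shows "invertible_exchange_relations restricted_scalar (restricted_t 2 1) (restricted_t 1 1) 1 A v
    restricted_dinv"
  using exchange_relations_21[OF assms]
  by (auto simp: invertible_exchange_relations_def invertible_exchange_relations_axioms_def
      restricted_dinv_0 restricted_t_dinv)

subsection \<open>Existence of highest weight vectors\<close>

text \<open>The class of 1 modulo \<open>A\<close> is the highest weight vector. The condition uses
  the t_{i,i} because the exchange relations concern them; \<open>highest_weight_d\<close> and
  \<open>highest_weightI\<close> translate to the Drinfeld generators.\<close>

definition highest_weight :: "(2 \<Rightarrow> 'k::field_prime_char fps) \<Rightarrow> 'k restricted_yangian set \<Rightarrow> bool" where
  "highest_weight \<mu> A \<longleftrightarrow> left_ideal A \<and> (\<forall>r. restricted_t 1 2 r \<in> A) \<and>
     (\<forall>i r. restricted_t i i r - restricted_scalar (fps_nth (\<mu> i) r) \<in> A)"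

text \<open>The t_{1,1} supply an eigenvector \<open>v\<close> on which each t_{1,2}^{(r)} is
  nilpotent. The exponent depends on \<open>r\<close> and on the vector, so all such vectors are
  gathered into a subspace \<open>S\<close>; a common eigenvector of the t_{1,2} in \<open>S\<close>
  must have eigenvalues 0.\<close>

lemma annihilated_by_t_12:
  fixes A :: "'k::{alg_closed_field, field_prime_char} restricted_yangian set"
  assumes A: "left_ideal A" "1 \<notin> A" and fin: "restricted.dim_mod_le n UNIV A"
  shows "\<exists>w. w \<notin> A \<and> (\<forall>r. restricted_t 1 2 r * w \<in> A)"
proof -
  let ?x = "restricted_t 1 2 :: nat \<Rightarrow> 'k restricted_yangian" and ?d = "restricted_t 1 1 :: nat \<Rightarrow> 'k restricted_yangian"
  have closed: "\<exists>c. poly q c = 0" if "degree q > 0" for q :: "'k poly"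
    using alg_closed_imp_poly_has_root[OF that] .
  have UNIV: "restricted.subspace_above A UNIV"
    by (simp add: restricted.subspace_above_def)
  have "\<exists>w'. w' \<in> UNIV \<and> w' \<notin> A \<and> (\<forall>t\<in>range ?d. \<exists>c. t * w' - restricted_scalar c * w' \<in> A)"
    by (rule restricted.common_eigenvector[OF closed A(1) UNIV _ UNIV_I A(2) fin])
       (use A in \<open>auto simp: restricted_t_commute left_ideal_0 image_iff\<close>)
  then obtain v where v: "v \<notin> A" "\<And>r. \<exists>c. ?d r * v - restricted_scalar c * v \<in> A" by auto
  interpret invertible_exchange_relations restricted_scalar ?x ?d "-1" A v restricted_dinv
    by (rule invertible_exchange_relations_12[OF A(1) v(2)])
  have "\<exists>f. leading f r \<and> f ^ CHAR('k) = 0" if "r > 0" for r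
    using leading_left[OF that] restricted_e_power[OF that] unfolding restricted_e_eq by blast
  from power_vanish[OF this CHAR_pos] have vanish: "\<exists>n. ?x r ^ n * v \<in> A" for r .
  define S where "S = {w. \<forall>r. \<exists>n. ?x r ^ n * w \<in> A}"
  have larger: "?x r ^ (m + n) * w \<in> A" if "?x r ^ n * w \<in> A" for r m n w
    using left_ideal_mult[OF A(1) that, of "?x r ^ m"] by (simp add: power_add mult.assoc)
  have S: "restricted.subspace_above A S"
    unfolding restricted.subspace_above_def
  proof (intro conjI ballI allI subsetI)
    fix w assume "w \<in> A"
    then show "w \<in> S" unfolding S_def by (auto intro!: exI[of _ 0])
  next
    fix w w' assume w: "w \<in> S" "w' \<in> S"
    show "w + w' \<in> S"
      unfolding S_def
    proof (intro CollectI allI)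
      fix r
      obtain m n where "?x r ^ m * w \<in> A" "?x r ^ n * w' \<in> A" using w unfolding S_def by blast
      then have "?x r ^ (n + m) * w + ?x r ^ (m + n) * w' \<in> A"
        by (intro left_ideal_add A larger)
      then show "\<exists>n. ?x r ^ n * (w + w') \<in> A"
        by (intro exI[of _ "m + n"]) (simp add: distrib_left add.commute)
    qed
  next
    fix c w assume w: "w \<in> S"
    show "restricted_scalar c * w \<in> S"
      unfolding S_def
    proof (intro CollectI allI)
      fix r
      obtain n where "?x r ^ n * w \<in> A" using w unfolding S_def by blast
      then show "\<exists>n. ?x r ^ n * (restricted_scalar c * w) \<in> A"
        using left_ideal_mult[OF A(1)] by (intro exI[of _ n]) (simp add: restricted.scalar_left_commute)
    qed
  qed
  have stable: "t * w \<in> S" if t: "t \<in> range ?x" and w: "w \<in> S" for t w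
    unfolding S_def
  proof (intro CollectI allI)
    fix r
    obtain n where n: "?x r ^ n * w \<in> A" using w unfolding S_def by blast
    obtain s where "t = ?x s" using t by auto
    then have "?x r ^ n * t = t * ?x r ^ n"
      using power_commuting_commutes[OF restricted_t_commute] by simp
    then have "?x r ^ n * (t * w) = t * (?x r ^ n * w)" by (simp only: mult.assoc[symmetric])
    then have "?x r ^ n * (t * w) \<in> A" using left_ideal_mult[OF A(1) n, of t] by simp
    then show "\<exists>n. ?x r ^ n * (t * w) \<in> A" by blast
  qed
  have "v \<in> S" using vanish by (simp add: S_def)
  have "\<exists>w. w \<in> S \<and> w \<notin> A \<and> (\<forall>t\<in>range ?x. \<exists>c. t * w - restricted_scalar c * w \<in> A)"
    by (rule restricted.common_eigenvector[OF closed A(1) S stable \<open>v \<in> S\<close> v(1)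
          restricted.dim_mod_le_subset[OF fin subset_UNIV]])
       (use A in \<open>auto simp: restricted_t_commute left_ideal_0 image_iff\<close>)
  then obtain w where w: "w \<in> S" "w \<notin> A" "\<And>r. \<exists>c. ?x r * w - restricted_scalar c * w \<in> A" by auto
  have "?x r * w \<in> A" for r
  proof -
    obtain c where c: "?x r * w - restricted_scalar c * w \<in> A" using w(3) by blast
    obtain n where n: "?x r ^ n * w \<in> A" using w(1) unfolding S_def by blast
    have "?x r ^ n * w - restricted_scalar c ^ n * w \<in> A"
      by (rule power_left_cong_power[OF A(1) c]) (simp add: restricted.scalar_central)
    from left_ideal_diff[OF A(1) n this] have "restricted_scalar (c ^ n) * w \<in> A"
      by (simp add: restricted.scalar_power)
    then have "c ^ n = 0" using restricted.left_ideal_scalar_cancel[OF A(1)] w(2) by blast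
    then have "c = 0" by simp
    then show ?thesis using c by simp
  qed
  then show ?thesis using w(2) by blast
qed

text \<open>In the commutator of t_{1,2}^{(r)} with t_{i,i}^{(s)}, taken in the right order, every
  product ends in some t_{1,2}, which kills \<open>w\<close>.\<close>

lemma t_12_kernel_stable:
  fixes A :: "'k::field_prime_char restricted_yangian set"
  assumes A: "left_ideal A" and w: "\<And>r. restricted_t 1 2 r * w \<in> A"
  shows "restricted_t 1 2 r * (restricted_t i i s * w) \<in> A"
proof -
  let ?t = "restricted_t :: 2 \<Rightarrow> 2 \<Rightarrow> nat \<Rightarrow> 'k restricted_yangian"
  have S: "(\<Sum>a\<in>I. g a * ?t 1 2 (m a) - h a * ?t 1 2 (l a)) * w \<in> A" for I :: "nat set" and g h m l
    unfolding sum_distrib_right left_diff_distrib mult.assoc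
    by (intro left_ideal_sum left_ideal_diff left_ideal_mult[OF A w] A)
  have T: "?t i i s * ?t 1 2 r * w \<in> A"
    unfolding mult.assoc by (rule left_ideal_mult[OF A w])
  have "i = 1 \<or> i = 2" by (rule two_cases)
  then show ?thesis
  proof
    assume i: "i = 1"
    have "?t 1 2 r * (?t i i s * w) = ?t i i s * ?t 1 2 r * w -
        (?t i i s * ?t 1 2 r - ?t 1 2 r * ?t i i s) * w"
      by (simp add: algebra_simps)
    also have "\<dots> \<in> A"
      unfolding i restricted_t_commutator[of 1 1 s 1 2 r] using T[unfolded i]
      by (intro left_ideal_diff[OF A] S)
    finally show ?thesis .
  next
    assume i: "i = 2"
    have "?t 1 2 r * (?t i i s * w) = ?t i i s * ?t 1 2 r * w +
        (?t 1 2 r * ?t i i s - ?t i i s * ?t 1 2 r) * w"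
      by (simp add: algebra_simps)
    also have "\<dots> \<in> A"
      unfolding i restricted_t_commutator[of 1 2 r 2 2 s] using T[unfolded i]
      by (intro left_ideal_add[OF A] S)
    finally show ?thesis .
  qed
qed

text \<open>On the subspace \<open>S\<close> killed by all t_{1,2}, the t_{1,1} and t_{2,2} commute
  modulo \<open>A\<close>, because each product in their commutator ends in a t_{1,2}. A common
  eigenvector in \<open>S\<close> is therefore a highest weight vector.\<close>

lemma exists_highest_weight:
  fixes A :: "'k::{alg_closed_field, field_prime_char} restricted_yangian set"
  assumes A: "left_ideal A" "1 \<notin> A" and fin: "restricted.dim_mod_le n UNIV A"
  shows "\<exists>v \<mu>. v \<notin> A \<and> (\<forall>i. fps_nth (\<mu> i) 0 = 1) \<and> highest_weight \<mu> {a. a * v \<in> A}"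
proof -
  let ?t = "restricted_t :: 2 \<Rightarrow> 2 \<Rightarrow> nat \<Rightarrow> 'k restricted_yangian"
  define F where "F = {?t i i r | i r. True}"
  define S where "S = {w. \<forall>r. ?t 1 2 r * w \<in> A}"
  have closed: "\<exists>c. poly q c = 0" if "degree q > 0" for q :: "'k poly"
    using alg_closed_imp_poly_has_root[OF that] .
  have S: "restricted.subspace_above A S"
    unfolding restricted.subspace_above_def S_def
    using left_ideal_mult[OF A(1)] left_ideal_add[OF A(1)]
    by (simp add: subset_iff distrib_left restricted.scalar_left_commute[of "?t 1 2 _"])
  have stable: "t * w \<in> S" if "t \<in> F" "w \<in> S" for t w
    using that t_12_kernel_stable[OF A(1), of w] by (auto simp: S_def F_def)
  have t12: "?t 1 2 r * w \<in> A" if "w \<in> S" for r w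
    using that by (simp add: S_def)
  have comm_12: "(?t 1 1 r * ?t 2 2 s - ?t 2 2 s * ?t 1 1 r) * w \<in> A" if "w \<in> S" for r s w
    unfolding restricted_t_commutator[of 1 1 r 2 2 s] sum_distrib_right left_diff_distrib mult.assoc
    using t12[OF that] by (intro left_ideal_sum left_ideal_diff left_ideal_mult[OF A(1) t12[OF that]] A)
  have comm: "t * t' * w - t' * t * w \<in> A" if t: "t \<in> F" "t' \<in> F" and w: "w \<in> S" for t t' w
  proof -
    obtain i r j s where t: "t = ?t i i r" "t' = ?t j j s" using t unfolding F_def by blast
    consider "i = j" | "i = 1" "j = 2" | "i = 2" "j = 1"
      using two_cases[of i] two_cases[of j] by auto
    then show ?thesis
    proof cases
      case 1
      show ?thesis
        unfolding t 1 restricted_t_commute[of j j r s] diff_self by (rule left_ideal_0[OF A(1)])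
    next
      case 2
      then show ?thesis using comm_12[OF w, of r s] by (simp add: t left_diff_distrib)
    next
      case 3
      then show ?thesis using left_ideal_uminus[OF A(1) comm_12[OF w, of s r]]
        by (simp add: t left_diff_distrib)
    qed
  qed
  obtain w where w: "w \<notin> A" "\<And>r. ?t 1 2 r * w \<in> A" using annihilated_by_t_12[OF A fin] by blast
  then have "w \<in> S" by (simp add: S_def)
  have "\<exists>w. w \<in> S \<and> w \<notin> A \<and> (\<forall>t\<in>F. \<exists>c. t * w - restricted_scalar c * w \<in> A)"
    by (rule restricted.common_eigenvector[OF closed A(1) S stable \<open>w \<in> S\<close> w(1)
          restricted.dim_mod_le_subset[OF fin subset_UNIV] comm])
  then obtain v where v: "v \<in> S" "v \<notin> A"
    and eigen: "\<forall>t\<in>F. \<exists>c. t * v - restricted_scalar c * v \<in> A" by blast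
  have "\<exists>c. ?t i i r * v - restricted_scalar c * v \<in> A" for i r
    using eigen unfolding F_def by blast
  then obtain c where c: "\<And>i r. ?t i i r * v - restricted_scalar (c i r) * v \<in> A" by metis
  define \<mu> where "\<mu> i = Abs_fps (c i)" for i
  \<comment> \<open>As t_{i,i}^{(0)} = 1 and \<open>v\<close> is nonzero modulo \<open>A\<close>,
    the eigenvalue series starts with 1.\<close>
  have "c i 0 = 1" for i
  proof -
    have "restricted_scalar (1 - c i 0) * v \<in> A"
      using c[of i 0] by (simp add: restricted_t_0 restricted.scalar_diff left_diff_distrib)
    then show ?thesis using restricted.left_ideal_scalar_cancel[OF A(1), of "1 - c i 0"] v(2) by auto
  qed
  moreover have "highest_weight \<mu> {a. a * v \<in> A}"
    using v c left_ideal_annihilator[OF A(1)]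
    by (auto simp: highest_weight_def S_def \<mu>_def left_diff_distrib)
  ultimately show ?thesis using v(2) by (intro exI[of _ v] exI[of _ \<mu>]) (simp add: \<mu>_def)
qed

subsection \<open>The baby Verma module is local\<close>


lemma restricted_d_0: "restricted_d i 0 = 1"
  by (simp add: restricted_d_def drinfeld_generators_nth_0 to_restricted_hom)

lemma highest_weight_e:
  assumes "highest_weight \<mu> A"
  shows "restricted_e r \<in> A"
  unfolding restricted_e_eq using assms
  by (auto simp: highest_weight_def intro!: left_ideal_sum left_ideal_mult)

lemma restricted_t_22_cong:
  fixes A :: "'k::field_prime_char restricted_yangian set"
  assumes "left_ideal A" "\<And>r. restricted_e r \<in> A"
  shows "restricted_t 2 2 r - restricted_d 2 r \<in> A"
proof -
  obtain g :: "nat \<Rightarrow> 'k restricted_yangian"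
    where "restricted_t 2 2 r = (\<Sum>a=0..r. g a * restricted_e (r - a)) + restricted_d 2 r"
    using restricted_t_22_eq by blast
  then have "restricted_t 2 2 r - restricted_d 2 r = (\<Sum>a=0..r. g a * restricted_e (r - a))" by simp
  also have "\<dots> \<in> A" by (intro left_ideal_sum left_ideal_mult assms)
  finally show ?thesis .
qed

lemma highest_weight_d:
  assumes "highest_weight \<mu> A"
  shows "restricted_d i r - restricted_scalar (fps_nth (\<mu> i) r) \<in> A"
proof -
  have A: "left_ideal A" and *: "restricted_t i i r - restricted_scalar (fps_nth (\<mu> i) r) \<in> A"
    using assms by (auto simp: highest_weight_def)
  have "i = 1 \<or> i = 2" by (rule two_cases)
  then show ?thesis
  proof
    assume "i = 2"
    then show ?thesis
      using left_ideal_diff[OF A * restricted_t_22_cong[OF A highest_weight_e[OF assms], of r]]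
      by simp
  qed (use * in \<open>simp add: restricted_d_1\<close>)
qed

text \<open>For the left ideal that defines the baby Verma module. It is generated by elements of
  positive index; index 0 is covered by e^{(0)} = 0 and d_i^{(0)} = 1.\<close>

lemma highest_weightI:
  assumes A: "left_ideal A" and e: "\<And>r. r > 0 \<Longrightarrow> restricted_e r \<in> A"
    and d: "\<And>i r. r > 0 \<Longrightarrow> restricted_d i r - restricted_scalar (fps_nth (\<mu> i) r) \<in> A"
    and \<mu>: "\<And>i. fps_nth (\<mu> i) 0 = 1"
  shows "highest_weight \<mu> A"
proof -
  have e': "restricted_e r \<in> A" for r
    using e[of r] A by (cases "r = 0") (auto simp: restricted_e_0 left_ideal_0)
  have d': "restricted_d i r - restricted_scalar (fps_nth (\<mu> i) r) \<in> A" for i r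
    using d[of r i] A by (cases "r = 0") (auto simp: restricted_d_0 \<mu> left_ideal_0)
  have "restricted_t i i r - restricted_scalar (fps_nth (\<mu> i) r) \<in> A" for i r
  proof -
    have "i = 1 \<or> i = 2" by (rule two_cases)
    then show ?thesis
    proof
      assume "i = 2"
      then show ?thesis
        using left_ideal_add[OF A restricted_t_22_cong[OF A e', of r] d'[of 2 r]] by simp
    qed (use d'[of i r] in \<open>simp add: restricted_d_1\<close>)
  qed
  moreover have "restricted_t 1 2 r \<in> A" for r
    unfolding restricted_t_12_eq by (intro left_ideal_sum left_ideal_mult A e')
  ultimately show ?thesis using A by (simp add: highest_weight_def)
qed

section \<open>The baby Verma module as a span of words in t_{2,1}\<close>

abbreviation lower_word :: "nat list \<Rightarrow> 'k::field_prime_char restricted_yangian" where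
  "lower_word \<equiv> exchange_relations.word (restricted_t 2 1)"

text \<open>The bound \<open>r\<close> on the letters makes all sufficiently long words vanish.
  Every element involves finitely many letters, so a suitable \<open>r\<close> exists, and it may be
  enlarged.\<close>

definition lower_words :: "nat \<Rightarrow> nat \<Rightarrow> 'k::field_prime_char restricted_yangian set" where
  "lower_words n r = {lower_word ss | ss. n \<le> length ss \<and> set ss \<subseteq> {1..r}}"

text \<open>The span contains 1 and is stable under all generators: t_{i,i} preserves it by
  \<open>d_word\<close>, t_{2,1} prepends a letter, and t_{1,2} moves through a word because its
  commutator with t_{2,1} consists of products of t_{2,2} and t_{1,1}.\<close>

lemma lower_words_span:
  fixes A :: "'k::field_prime_char restricted_yangian set"
  assumes "highest_weight \<mu> A"
  shows "x \<in> restricted.lin_span {lower_word ss | ss. 0 \<notin> set ss} A"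
proof -
  let ?t = "restricted_t :: 2 \<Rightarrow> 2 \<Rightarrow> nat \<Rightarrow> 'k restricted_yangian"
  let ?W = "{lower_word ss | ss. 0 \<notin> set ss} :: 'k restricted_yangian set"
  let ?P = "restricted.lin_span ?W A"
  have A: "left_ideal A" and t12: "\<And>r. ?t 1 2 r \<in> A"
    and tii: "\<And>i r. \<exists>c. ?t i i r * 1 - restricted_scalar c * 1 \<in> A"
    using assms by (auto simp: highest_weight_def)
  note scal = restricted.lin_span_scalar[OF A]
  note closed = restricted.lin_span_mult[OF A]
  have word: "lower_word [] = (1 :: 'k restricted_yangian)"
    "lower_word (s # ss) = ?t 2 1 s * lower_word ss" for s ss
    using exchange_relations.word_simps[OF exchange_relations_21[OF A tii]] by blast+
  have tii_P: "?t i i r * y \<in> ?P" if "y \<in> ?P" for i r y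
  proof (rule closed[OF _ that])
    interpret exchange_relations restricted_scalar "?t 2 1" "?t i i" "if i = 1 then 1 else - 1" A 1
      by (rule exchange_relations_21[OF A tii])
    fix w assume "w \<in> ?W"
    then obtain ss where ss: "w = lower_word ss" "0 \<notin> set ss" by blast
    then have "?t i i r * w \<in> V (length ss) (sum_list ss + (r - 1))"
      using d_word[of ss r] by simp
    then show "?t i i r * w \<in> ?P"
      by (rule restricted.lin_span_mono[rotated]) (auto simp: words_def)
  qed
  have t21_P: "?t 2 1 r * y \<in> ?P" if "y \<in> ?P" for r y
  proof (rule closed[OF _ that])
    fix w assume "w \<in> ?W"
    then obtain ss where ss: "w = lower_word ss" "0 \<notin> set ss" by blast
    show "?t 2 1 r * w \<in> ?P"
    proof (cases "r = 0")
      case True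
      then show ?thesis by (simp add: restricted_t_0 restricted.lin_span_0[OF A])
    next
      case False
      then show ?thesis using ss
        by (intro restricted.lin_span_incl) (auto intro!: exI[of _ "r # ss"] simp: word)
    qed
  qed
  have t12_word: "?t 1 2 r * lower_word ss \<in> ?P" if "0 \<notin> set ss" for r ss
    using that
  proof (induction ss arbitrary: r)
    case Nil
    then show ?case using t12 by (simp add: word restricted.lin_span.base)
  next
    case (Cons s ss)
    define w where "w = (lower_word ss :: 'k restricted_yangian)"
    have w: "w \<in> ?P" using Cons unfolding w_def by (intro restricted.lin_span_incl) auto
    have IH: "?t 1 2 r * w \<in> ?P" for r using Cons by (simp add: w_def)
    have "?t 1 2 r * lower_word (s # ss) =
        ?t 2 1 s * (?t 1 2 r * w) + (?t 1 2 r * ?t 2 1 s - ?t 2 1 s * ?t 1 2 r) * w"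
      by (simp add: word w_def algebra_simps)
    also have "\<dots> \<in> ?P"
      unfolding restricted_t_commutator[of 1 2 r 2 1 s] sum_distrib_right left_diff_distrib mult.assoc
      by (intro restricted.lin_span.add t21_P IH restricted.lin_span_sum[OF A]
          restricted.lin_span_diff[OF A] tii_P w)
    finally show ?case .
  qed
  have t12_P: "?t 1 2 r * y \<in> ?P" if "y \<in> ?P" for r y
    by (rule closed[OF _ that]) (use t12_word in blast)
  show ?thesis
  proof (induction x rule: restricted_yangian_induct)
    case one
    have "(1 :: 'k restricted_yangian) \<in> ?W" using word(1) by (intro CollectI exI[of _ "[]"]) simp
    then show ?case by (rule restricted.lin_span_incl)
  next
    case (mult i j r x)
    consider "i = j" | "i = 1" "j = 2" | "i = 2" "j = 1"
      using two_cases[of i] two_cases[of j] by auto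
    then show ?case using mult by cases (auto intro: tii_P t12_P t21_P)
  qed (auto intro: scal restricted.lin_span.add)
qed

text \<open>The empty word supplies the constant term \<open>c\<close>; the letters of any other
  word are bounded by their sum, and two bounds are merged by their maximum.\<close>

lemma lower_words_decomposition:
  fixes A :: "'k::field_prime_char restricted_yangian set"
  assumes hw: "highest_weight \<mu> A"
  shows "\<exists>c r. x - restricted_scalar c \<in> restricted.lin_span (lower_words 1 r) A"
proof -
  have A: "left_ideal A"
    and tii: "\<And>r. \<exists>c. restricted_t 1 1 r * 1 - restricted_scalar c * 1 \<in> A"
    using hw by (auto simp: highest_weight_def)
  have mono: "y \<in> restricted.lin_span (lower_words 1 r) A \<Longrightarrow> r \<le> r' \<Longrightarrow>
      y \<in> restricted.lin_span (lower_words 1 r') A" for y r r'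
    by (rule restricted.lin_span_mono[rotated]) (force simp: lower_words_def)+
  show ?thesis
    using lower_words_span[OF hw, of x]
  proof induction
    case (base a)
    then show ?case by (intro exI[of _ 0]) (auto intro: restricted.lin_span.base)
  next
    case (scal w b)
    then obtain ss where ss: "w = lower_word ss" "0 \<notin> set ss" by blast
    show ?case
    proof (cases ss)
      case Nil
      then have "w = 1"
        using ss exchange_relations.word_simps(1)[OF exchange_relations_21[OF A tii]] by simp
      then show ?thesis by (intro exI[of _ b]) (simp add: restricted.lin_span_0[OF A])
    next
      case (Cons s ss')
      have "1 \<le> q \<and> q \<le> sum_list ss" if "q \<in> set ss" for q
        using ss(2) that member_le_sum_list[of q ss] by (cases q) auto
      then have "w \<in> lower_words 1 (sum_list ss)"
        using ss(1) Cons unfolding lower_words_def by (intro CollectI exI[of _ ss]) auto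
      then show ?thesis
        by (intro exI[of _ 0] exI[of _ "sum_list ss"]) (auto intro: restricted.lin_span.scal)
    qed
  next
    case (add y z)
    then obtain b r c s where
      "y - restricted_scalar b \<in> restricted.lin_span (lower_words 1 r) A"
      "z - restricted_scalar c \<in> restricted.lin_span (lower_words 1 s) A" by blast
    then have "(y - restricted_scalar b) + (z - restricted_scalar c) \<in>
        restricted.lin_span (lower_words 1 (max r s)) A"
      by (intro restricted.lin_span.add) (erule mono, simp)+
    then show ?case
      by (intro exI[of _ "b + c"] exI[of _ "max r s"]) (simp add: restricted.scalar_add algebra_simps)
  qed
qed

lemma long_lower_words_vanish:
  fixes A :: "'k::field_prime_char restricted_yangian set"
  assumes hw: "highest_weight \<mu> A" and "r > 0"
  shows "lower_words (4 * r * CHAR('k)) r \<subseteq> A"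
proof
  have A: "left_ideal A"
    and tii: "\<And>r. \<exists>c. restricted_t 1 1 r * 1 - restricted_scalar c * 1 \<in> A"
    using hw by (auto simp: highest_weight_def)
  interpret invertible_exchange_relations restricted_scalar
    "restricted_t 2 1 :: nat \<Rightarrow> 'k restricted_yangian" "restricted_t 1 1" 1 A 1 restricted_dinv
    by (rule invertible_exchange_relations_21[OF A tii])
  fix w :: "'k restricted_yangian" assume "w \<in> lower_words (4 * r * CHAR('k)) r"
  then obtain ss where ss: "w = word ss" "4 * r * CHAR('k) \<le> length ss" "set ss \<subseteq> {1..r}"
    unfolding lower_words_def by blast
  have lead: "\<exists>f. leading f r \<and> f ^ CHAR('k) = 0" if "r > 0" for r
    using leading_right[OF that] restricted_f_power[OF that] unfolding restricted_f_eq by blast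
  have "sum_list ss \<le> length ss * r"
    using ss(3) by (induction ss) auto
  moreover have "0 \<notin> set ss" using ss(3) by auto
  then have "w \<in> V (length ss) (sum_list ss)"
    using word_in_V[of ss] ss(1) by simp
  ultimately show "w \<in> A"
    using long_words_vanish[OF lead CHAR_pos \<open>r > 0\<close> ss(2)] V_mono by blast
qed

text \<open>An element with nonzero constant term is invertible modulo \<open>A\<close>, because its remaining part is
  nilpotent. The inverse is not constructed: multiplication by longer and longer words shows, by
  descending induction on the length, that the left ideal contains all words.\<close>

lemma constant_term_unit:
  fixes A L :: "'k::field_prime_char restricted_yangian set"
  assumes hw: "highest_weight \<mu> A" and L: "left_ideal L" "A \<subseteq> L"
    and "x \<in> L" "c \<noteq> 0" and x: "x - restricted_scalar c \<in> restricted.lin_span (lower_words 1 r) A"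
  shows "1 \<in> L"
proof -
  have A: "left_ideal A"
    and tii: "\<And>r. \<exists>c. restricted_t 1 1 r * 1 - restricted_scalar c * 1 \<in> A"
    using hw by (auto simp: highest_weight_def)
  interpret exchange_relations restricted_scalar
    "restricted_t 2 1 :: nat \<Rightarrow> 'k restricted_yangian" "restricted_t 1 1"
    "if (1::2) = 1 then 1 else - 1" A 1
    by (rule exchange_relations_21[OF A tii])
  have append: "word (ss @ ss') = word ss * word ss'" for ss ss'
    by (induction ss) (simp_all add: mult.assoc)
  \<comment> \<open>\<open>long_lower_words_vanish\<close> asks for a positive bound, and
    \<open>r\<close> may be 0.\<close>
  define r' where "r' = Suc r"
  have x': "x - restricted_scalar c \<in> restricted.lin_span (lower_words 1 r') A"
    by (rule restricted.lin_span_mono[OF _ x]) (force simp: lower_words_def r'_def)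
  have span_L: "y \<in> L" if "y \<in> restricted.lin_span U A" "U \<subseteq> L" for y U
    using that(1)
  proof induction
    case (base a)
    then show ?case using L(2) by blast
  next
    case (scal y b)
    then show ?case using that(2) left_ideal_mult[OF L(1)] by blast
  next
    case (add y z)
    then show ?case by (intro left_ideal_add L)
  qed
  have "lower_words (4 * r' * CHAR('k)) r' \<subseteq> L"
    using long_lower_words_vanish[OF hw, of r'] L(2) by (auto simp: r'_def)
  moreover have step: "lower_words n r' \<subseteq> L" if n: "lower_words (Suc n) r' \<subseteq> L" for n
  proof
    fix w :: "'k restricted_yangian" assume "w \<in> lower_words n r'"
    then obtain ss where ss: "w = word ss" "n \<le> length ss" "set ss \<subseteq> {1..r'}"
      unfolding lower_words_def by blast
    \<comment> \<open>Multiplication by \<open>w\<close> turns words of length at least 1 into words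
      of length at least \<open>n + 1\<close>, which lie in \<open>L\<close> by assumption.
      Subtracting from \<open>w * x \<in> L\<close> leaves the multiple of \<open>w\<close> by
      \<open>c\<close>.\<close>
    have "w * (x - restricted_scalar c) \<in> restricted.lin_span (lower_words (Suc n) r') A"
    proof (rule restricted.lin_span_mult[OF A _ x'])
      fix y :: "'k restricted_yangian" assume "y \<in> lower_words 1 r'"
      then obtain ss' where ss': "y = word ss'" "1 \<le> length ss'" "set ss' \<subseteq> {1..r'}"
        unfolding lower_words_def by blast
      have "w * y = word (ss @ ss')" "Suc n \<le> length (ss @ ss')" "set (ss @ ss') \<subseteq> {1..r'}"
        using ss ss' by (simp_all only: append set_append Un_least, simp)
      then have "w * y \<in> lower_words (Suc n) r'"
        unfolding lower_words_def by blast
      then show "w * y \<in> restricted.lin_span (lower_words (Suc n) r') A"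
        by (rule restricted.lin_span_incl)
    qed
    from left_ideal_diff[OF L(1) left_ideal_mult[OF L(1) \<open>x \<in> L\<close>] span_L[OF this n]]
    have "w * x - w * (x - restricted_scalar c) \<in> L" .
    also have "w * x - w * (x - restricted_scalar c) = restricted_scalar c * w"
      by (simp add: right_diff_distrib restricted.scalar_central)
    finally show "w \<in> L" using restricted.left_ideal_scalar_cancel[OF L(1)] \<open>c \<noteq> 0\<close> by blast
  qed
  ultimately have "lower_words 0 r' \<subseteq> L"
    by (intro inc_induct[of 0 "4 * r' * CHAR('k)" "\<lambda>n. lower_words n r' \<subseteq> L"]) (simp_all add: step)
  moreover have "(1 :: 'k restricted_yangian) \<in> lower_words 0 r'"
    unfolding lower_words_def by (intro CollectI exI[of _ "[]"]) simp
  ultimately show ?thesis by blast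
qed

text \<open>Elements of a proper left ideal above \<open>A\<close> have constant term 0. If
  \<open>x\<close> has constant term 0, then \<open>1 - x\<close> has constant term 1, so two such
  ideals never add up to the whole ring.\<close>

lemma highest_weight_local:
  fixes A K L :: "'k::field_prime_char restricted_yangian set"
  assumes hw: "highest_weight \<mu> A" and K: "left_ideal K" "A \<subseteq> K" "1 \<notin> K"
    and L: "left_ideal L" "A \<subseteq> L" "1 \<notin> L"
    and "x \<in> K"
  shows "1 - x \<notin> L"
proof
  assume "1 - x \<in> L"
  have A: "left_ideal A" using hw by (simp add: highest_weight_def)
  obtain c r where x: "x - restricted_scalar c \<in> restricted.lin_span (lower_words 1 r) A"
    using lower_words_decomposition[OF hw] by blast
  then have "c = 0" using constant_term_unit[OF hw K(1,2) \<open>x \<in> K\<close>] K(3) by blast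
  then have "(1 - x) - restricted_scalar 1 \<in> restricted.lin_span (lower_words 1 r) A"
    using restricted.lin_span_uminus[OF A x] by simp
  from constant_term_unit[OF hw L(1,2) \<open>1 - x \<in> L\<close> one_neq_zero this] L(3)
  show False by blast
qed

section \<open>Quotient modules and simple modules\<close>

context left_module
begin

lemma smult_l_null: "x \<in> carrier M \<Longrightarrow> \<zero> \<odot>\<^bsub>M\<^esub> x = \<zero>\<^bsub>M\<^esub>"
proof -
  assume x: "x \<in> carrier M"
  have "\<zero> \<odot>\<^bsub>M\<^esub> x \<oplus>\<^bsub>M\<^esub> \<zero> \<odot>\<^bsub>M\<^esub> x = \<zero> \<odot>\<^bsub>M\<^esub> x"
    using smult_l_distr[of \<zero> \<zero> x] x by simp
  then show ?thesis using x by (metis M.add.r_cancel_one' smult_closed R.zero_closed)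
qed

lemma smult_minus_one: "x \<in> carrier M \<Longrightarrow> (\<ominus> \<one>) \<odot>\<^bsub>M\<^esub> x = \<ominus>\<^bsub>M\<^esub> x"
proof -
  assume x: "x \<in> carrier M"
  have "(\<ominus> \<one> \<oplus> \<one>) \<odot>\<^bsub>M\<^esub> x = (\<ominus> \<one>) \<odot>\<^bsub>M\<^esub> x \<oplus>\<^bsub>M\<^esub> x"
    using smult_l_distr[of "\<ominus> \<one>" \<one> x] x by simp
  then have "(\<ominus> \<one>) \<odot>\<^bsub>M\<^esub> x \<oplus>\<^bsub>M\<^esub> x = \<zero>\<^bsub>M\<^esub>"
    using x by (simp add: R.l_neg smult_l_null)
  then show ?thesis using x by (intro M.minus_equality[symmetric]) auto
qed

lemma left_submoduleI:
  assumes "H \<subseteq> carrier M" "\<zero>\<^bsub>M\<^esub> \<in> H" "\<And>x y. x \<in> H \<Longrightarrow> y \<in> H \<Longrightarrow> x \<oplus>\<^bsub>M\<^esub> y \<in> H"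
    and "\<And>a x. a \<in> carrier R \<Longrightarrow> x \<in> H \<Longrightarrow> a \<odot>\<^bsub>M\<^esub> x \<in> H"
  shows "submodule H R M"
proof (intro submodule.intro subgroup.intro submodule_axioms.intro)
  fix x assume x: "x \<in> H"
  then have "\<ominus>\<^bsub>M\<^esub> x \<in> H" using assms(4)[of "\<ominus> \<one>" x] assms(1) smult_minus_one[of x] by auto
  then show "inv\<^bsub>add_monoid M\<^esub> x \<in> H" by (simp add: a_inv_def)
qed (use assms in auto)

lemma submodule_zero: "submodule H R M \<Longrightarrow> \<zero>\<^bsub>M\<^esub> \<in> H"
  using subgroup.one_closed[OF submodule.axioms(1)] by fastforce

lemma submodule_subset: "submodule H R M \<Longrightarrow> H \<subseteq> carrier M"
  using subgroup.subset[OF submodule.axioms(1)] by fastforce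

lemma submodule_add: "submodule H R M \<Longrightarrow> x \<in> H \<Longrightarrow> y \<in> H \<Longrightarrow> x \<oplus>\<^bsub>M\<^esub> y \<in> H"
  using subgroup.m_closed[OF submodule.axioms(1)] by fastforce

lemma submodule_smult: "submodule H R M \<Longrightarrow> a \<in> carrier R \<Longrightarrow> x \<in> H \<Longrightarrow> a \<odot>\<^bsub>M\<^esub> x \<in> H"
  by (rule submodule.smult_closed)

end

section \<open>Epimorphisms, kernels and quotients\<close>

definition module_epi ::
  "('a, 'c) ring_scheme \<Rightarrow> ('a, 'b, 'd) module_scheme \<Rightarrow> ('a, 'e, 'f) module_scheme \<Rightarrow> ('b \<Rightarrow> 'e) \<Rightarrow> bool" where
  "module_epi R M N h \<longleftrightarrow> h ` carrier M = carrier N \<and>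
     (\<forall>x\<in>carrier M. \<forall>y\<in>carrier M. h (x \<oplus>\<^bsub>M\<^esub> y) = h x \<oplus>\<^bsub>N\<^esub> h y) \<and>
     (\<forall>a\<in>carrier R. \<forall>x\<in>carrier M. h (a \<odot>\<^bsub>M\<^esub> x) = a \<odot>\<^bsub>N\<^esub> h x)"

lemma module_epi_comp:
  assumes g: "module_epi R L M g" and h: "module_epi R M N h"
  shows "module_epi R L N (\<lambda>x. h (g x))"
proof -
  have closed: "g x \<in> carrier M" if "x \<in> carrier L" for x
    using g that by (auto simp: module_epi_def)
  have "(\<lambda>x. h (g x)) ` carrier L = h ` g ` carrier L" by (simp only: image_image)
  also have "\<dots> = carrier N" using g h by (simp add: module_epi_def)
  finally show ?thesis
    using g h by (simp add: module_epi_def closed)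
qed

lemma module_epi_eq_iff:
  assumes "left_module R M" "left_module R N" "module_epi R M N h" "x \<in> carrier M" "y \<in> carrier M"
  shows "h x = h y \<longleftrightarrow> h (x \<oplus>\<^bsub>M\<^esub> (\<ominus>\<^bsub>R\<^esub> \<one>\<^bsub>R\<^esub>) \<odot>\<^bsub>M\<^esub> y) = \<zero>\<^bsub>N\<^esub>"
proof -
  interpret M: left_module R M by fact
  interpret N: left_module R N by fact
  have hxy: "h x \<in> carrier N" "h y \<in> carrier N" using assms by (auto simp: module_epi_def)
  have "h (x \<oplus>\<^bsub>M\<^esub> (\<ominus>\<^bsub>R\<^esub> \<one>\<^bsub>R\<^esub>) \<odot>\<^bsub>M\<^esub> y) = h x \<oplus>\<^bsub>N\<^esub> (\<ominus>\<^bsub>R\<^esub> \<one>\<^bsub>R\<^esub>) \<odot>\<^bsub>N\<^esub> h y"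
    using assms by (auto simp: module_epi_def)
  also have "\<dots> = h x \<ominus>\<^bsub>N\<^esub> h y"
    using hxy by (simp add: N.smult_minus_one a_minus_def)
  finally have *: "h (x \<oplus>\<^bsub>M\<^esub> (\<ominus>\<^bsub>R\<^esub> \<one>\<^bsub>R\<^esub>) \<odot>\<^bsub>M\<^esub> y) = h x \<ominus>\<^bsub>N\<^esub> h y" .
  have "h x = h y" if "h x \<ominus>\<^bsub>N\<^esub> h y = \<zero>\<^bsub>N\<^esub>"
    using N.M.minus_equality[of "h x" "\<ominus>\<^bsub>N\<^esub> h y"] that hxy by (simp add: a_minus_def)
  moreover have "h x \<ominus>\<^bsub>N\<^esub> h y = \<zero>\<^bsub>N\<^esub>" if "h x = h y"
    using that hxy by (simp add: a_minus_def N.M.r_neg)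
  ultimately show ?thesis unfolding * by blast
qed

text \<open>Both modules are the quotient of \<open>L\<close> by the common kernel. They may have
  different element types, so they are compared through images of elements of
  \<open>L\<close>.\<close>

lemma isomorphic_modules_same_kernel:
  assumes L: "left_module R L" and M: "left_module R M" and N: "left_module R N"
    and g: "module_epi R L M g" and h: "module_epi R L N h"
    and ker: "\<And>x. x \<in> carrier L \<Longrightarrow> g x = \<zero>\<^bsub>M\<^esub> \<longleftrightarrow> h x = \<zero>\<^bsub>N\<^esub>"
  shows "isomorphic_modules R M N"
proof -
  interpret L: left_module R L by fact
  have eq: "g x = g y \<longleftrightarrow> h x = h y" if "x \<in> carrier L" "y \<in> carrier L" for x y
    using module_epi_eq_iff[OF L M g that] module_epi_eq_iff[OF L N h that] ker that by auto
  define f where "f m = h (SOME x. x \<in> carrier L \<and> g x = m)" for m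
  have f: "f (g x) = h x" if "x \<in> carrier L" for x
  proof -
    define y where "y = (SOME y. y \<in> carrier L \<and> g y = g x)"
    have "y \<in> carrier L \<and> g y = g x"
      unfolding y_def by (rule someI[of "\<lambda>y. y \<in> carrier L \<and> g y = g x" x]) (use that in simp)
    then show ?thesis using eq[of y x] that by (simp add: f_def y_def)
  qed
  have gL: "carrier M = g ` carrier L" and hL: "carrier N = h ` carrier L"
    using g h by (simp_all add: module_epi_def)
  show ?thesis
    unfolding isomorphic_modules_def
  proof (intro exI[of _ f] conjI ballI)
    show "bij_betw f (carrier M) (carrier N)"
      unfolding bij_betw_def gL hL inj_on_def image_image
      using eq by (auto simp: f)
  next
    fix x y assume "x \<in> carrier M" "y \<in> carrier M"
    then obtain a b where ab: "a \<in> carrier L" "b \<in> carrier L" "x = g a" "y = g b" by (auto simp: gL)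
    then have "x \<oplus>\<^bsub>M\<^esub> y = g (a \<oplus>\<^bsub>L\<^esub> b)" using g by (simp add: module_epi_def)
    then have "f (x \<oplus>\<^bsub>M\<^esub> y) = h (a \<oplus>\<^bsub>L\<^esub> b)" using ab by (simp add: f)
    also have "\<dots> = f x \<oplus>\<^bsub>N\<^esub> f y" using h ab by (simp add: module_epi_def f)
    finally show "f (x \<oplus>\<^bsub>M\<^esub> y) = f x \<oplus>\<^bsub>N\<^esub> f y" .
  next
    fix a x assume a: "a \<in> carrier R" and "x \<in> carrier M"
    then obtain b where b: "b \<in> carrier L" "x = g b" by (auto simp: gL)
    then have "a \<odot>\<^bsub>M\<^esub> x = g (a \<odot>\<^bsub>L\<^esub> b)" using g a by (simp add: module_epi_def)
    then have "f (a \<odot>\<^bsub>M\<^esub> x) = h (a \<odot>\<^bsub>L\<^esub> b)" using a b by (simp add: f)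
    also have "\<dots> = a \<odot>\<^bsub>N\<^esub> f x" using h a b by (simp add: module_epi_def f)
    finally show "f (a \<odot>\<^bsub>M\<^esub> x) = a \<odot>\<^bsub>N\<^esub> f x" .
  qed
qed

lemma quotient_module_projection:
  assumes M: "left_module R M" and N: "submodule N R M"
  shows "module_epi R M (quotient_module M N) (\<lambda>x. N +>\<^bsub>M\<^esub> x)"
    and "x \<in> carrier M \<Longrightarrow> N +>\<^bsub>M\<^esub> x = \<zero>\<^bsub>quotient_module M N\<^esub> \<longleftrightarrow> x \<in> N"
proof -
  interpret left_module R M by fact
  interpret N: submodule N R M by fact
  have "additive_subgroup N M"
    by (intro additive_subgroup.intro) (rule N.subgroup_axioms)
  then interpret A: abelian_subgroup N M
    by (rule abelian_subgroupI3) (rule M.abelian_group_axioms)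
  have eqI: "N +>\<^bsub>M\<^esub> y = N +>\<^bsub>M\<^esub> x" if "x \<in> carrier M" "y \<in> N +>\<^bsub>M\<^esub> x" for x y
    by (rule M.a_repr_independence[OF that(2,1) N.subgroup_axioms, symmetric])
  have smult: "a \<odot>\<^bsub>quotient_module M N\<^esub> (N +>\<^bsub>M\<^esub> x) = N +>\<^bsub>M\<^esub> (a \<odot>\<^bsub>M\<^esub> x)"
    if a: "a \<in> carrier R" and x: "x \<in> carrier M" for a x
  proof -
    have "N +>\<^bsub>M\<^esub> (a \<odot>\<^bsub>M\<^esub> y) = N +>\<^bsub>M\<^esub> (a \<odot>\<^bsub>M\<^esub> x)" if y: "y \<in> N +>\<^bsub>M\<^esub> x" for y
    proof (rule eqI[OF smult_closed[OF a x]])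
      obtain n where n: "n \<in> N" "y = n \<oplus>\<^bsub>M\<^esub> x"
        using y unfolding a_r_coset_def r_coset_def by auto
      then have "a \<odot>\<^bsub>M\<^esub> y = a \<odot>\<^bsub>M\<^esub> n \<oplus>\<^bsub>M\<^esub> a \<odot>\<^bsub>M\<^esub> x"
        using a x A.a_subset by (auto simp: smult_r_distr)
      then show "a \<odot>\<^bsub>M\<^esub> y \<in> N +>\<^bsub>M\<^esub> (a \<odot>\<^bsub>M\<^esub> x)"
        using N.smult_closed[OF a n(1)] unfolding a_r_coset_def r_coset_def by auto
    qed
    moreover have "x \<in> N +>\<^bsub>M\<^esub> x" using x by (rule A.a_rcos_self)
    ultimately have "(\<Union>y\<in>N +>\<^bsub>M\<^esub> x. N +>\<^bsub>M\<^esub> (a \<odot>\<^bsub>M\<^esub> y)) = N +>\<^bsub>M\<^esub> (a \<odot>\<^bsub>M\<^esub> x)"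
      by blast
    then show ?thesis by (simp add: quotient_module_def)
  qed
  show "module_epi R M (quotient_module M N) (\<lambda>x. N +>\<^bsub>M\<^esub> x)"
    unfolding module_epi_def
  proof (intro conjI ballI)
    show "(\<lambda>x. N +>\<^bsub>M\<^esub> x) ` carrier M = carrier (quotient_module M N)"
      by (auto simp: quotient_module_def A_RCOSETS_def RCOSETS_def a_r_coset_def)
  next
    fix x y assume "x \<in> carrier M" "y \<in> carrier M"
    then show "N +>\<^bsub>M\<^esub> (x \<oplus>\<^bsub>M\<^esub> y) = (N +>\<^bsub>M\<^esub> x) \<oplus>\<^bsub>quotient_module M N\<^esub> (N +>\<^bsub>M\<^esub> y)"
      by (simp add: quotient_module_def A.a_rcos_sum)
  qed (simp add: smult)
  show "N +>\<^bsub>M\<^esub> x = \<zero>\<^bsub>quotient_module M N\<^esub> \<longleftrightarrow> x \<in> N" if "x \<in> carrier M"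
  proof
    assume "N +>\<^bsub>M\<^esub> x = \<zero>\<^bsub>quotient_module M N\<^esub>"
    then show "x \<in> N" using A.a_rcos_self[OF that] by (simp add: quotient_module_def)
  next
    assume "x \<in> N"
    then have "N +>\<^bsub>M\<^esub> x = N" by (rule A.a_rcos_const)
    then show "N +>\<^bsub>M\<^esub> x = \<zero>\<^bsub>quotient_module M N\<^esub>" by (simp add: quotient_module_def)
  qed
qed

lemma submodule_regular_iff:
  "submodule J ring_of_type_algebra (regular_module ring_of_type_algebra) \<longleftrightarrow>
    left_ideal (J :: 'a::ring_1 set)"
proof -
  interpret left_module ring_of_type_algebra "regular_module (ring_of_type_algebra :: 'a ring)"
    by (rule left_module_regular[OF ring_ring_of_type])
  show ?thesis
  proof
    assume J: "submodule J ring_of_type_algebra (regular_module ring_of_type_algebra)"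
    show "left_ideal J"
      using submodule_zero[OF J] submodule_add[OF J] submodule_smult[OF J]
      by (simp add: left_ideal_def regular_module_def ring_of_type_algebra_def)
  next
    assume "left_ideal J"
    then show "submodule J ring_of_type_algebra (regular_module ring_of_type_algebra)"
      by (intro left_submoduleI) (auto simp: left_ideal_def regular_module_def ring_of_type_algebra_def)
  qed
qed

lemma gen_left_ideal_eq:
  "gen_left_ideal ring_of_type_algebra S = \<Inter>{J. left_ideal (J :: 'a::ring_1 set) \<and> S \<subseteq> J}"
  unfolding gen_left_ideal_def submodule_regular_iff ..

lemma left_ideal_gen_left_ideal: "left_ideal (gen_left_ideal ring_of_type_algebra (S :: 'a::ring_1 set))"
  unfolding gen_left_ideal_eq by (auto simp: left_ideal_def)

lemma gen_left_ideal_incl: "S \<subseteq> gen_left_ideal ring_of_type_algebra (S :: 'a::ring_1 set)"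
  unfolding gen_left_ideal_eq by blast

lemma gen_left_ideal_least:
  "left_ideal J \<Longrightarrow> S \<subseteq> J \<Longrightarrow> gen_left_ideal ring_of_type_algebra S \<subseteq> (J :: 'a::ring_1 set)"
  unfolding gen_left_ideal_eq by blast

text \<open>Submodules of the quotient correspond to left ideals above \<open>J\<close>. By
  \<open>greatest\<close>, \<open>A\<close> contains every proper one of these, so its image is the
  only maximal submodule and the definite description is resolved.\<close>

lemma maximal_submodule_of_cyclic:
  fixes J A :: "'a::ring_1 set"
  assumes J: "left_ideal J" and A: "left_ideal A" "J \<subseteq> A" "1 \<notin> A"
    and greatest: "\<And>L. left_ideal L \<Longrightarrow> J \<subseteq> L \<Longrightarrow> 1 \<notin> L \<Longrightarrow> L \<subseteq> A"
  defines "R \<equiv> ring_of_type_algebra :: 'a ring"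
  defines "Q \<equiv> quotient_module (regular_module R) J"
  defines "\<pi> \<equiv> \<lambda>x. J +>\<^bsub>regular_module R\<^esub> x"
  shows "submodule (\<pi> ` A) R Q" and "(THE N. maximal_submodule N R Q) = \<pi> ` A"
    and "\<pi> x \<in> \<pi> ` A \<longleftrightarrow> x \<in> A"
proof -
  have RM: "left_module R (regular_module R)"
    unfolding R_def by (rule left_module_regular[OF ring_ring_of_type])
  have JM: "submodule J R (regular_module R)"
    unfolding R_def submodule_regular_iff by (rule J)
  have QM: "left_module R Q" unfolding Q_def by (rule left_module_quotient[OF RM JM])
  interpret Q: left_module R Q by fact
  have car: "carrier R = UNIV" "carrier (regular_module R) = UNIV"
    by (simp_all add: regular_module_def R_def ring_of_type_algebra_def)
  note epi = quotient_module_projection(1)[OF RM JM, folded Q_def \<pi>_def]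
  have surj: "carrier Q = range \<pi>" and add: "\<And>x y. \<pi> (x + y) = \<pi> x \<oplus>\<^bsub>Q\<^esub> \<pi> y"
    and smult: "\<And>a x. \<pi> (a * x) = a \<odot>\<^bsub>Q\<^esub> \<pi> x"
    using epi unfolding module_epi_def car
    by (auto simp: R_def regular_module_def ring_of_type_algebra_def)
  have zero: "\<pi> x = \<zero>\<^bsub>Q\<^esub> \<longleftrightarrow> x \<in> J" for x
    using quotient_module_projection(2)[OF RM JM] by (simp add: car Q_def \<pi>_def)
  have eq: "\<pi> x = \<pi> y \<longleftrightarrow> x - y \<in> J" for x y
    using module_epi_eq_iff[OF RM QM epi, of x y] zero
    by (simp add: car R_def minus_ring_of_type)
       (simp add: regular_module_def ring_of_type_algebra_def)
  have mem: "\<pi> x \<in> \<pi> ` L \<longleftrightarrow> x \<in> L" if L: "left_ideal L" "J \<subseteq> L" for L x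
  proof
    assume "\<pi> x \<in> \<pi> ` L"
    then obtain y where "y \<in> L" "x - y \<in> J" using eq by auto
    then show "x \<in> L" using left_ideal_cong[OF L(1), of x y] L(2) by blast
  qed blast
  then show "\<pi> x \<in> \<pi> ` A \<longleftrightarrow> x \<in> A" using A by blast
  have image: "submodule (\<pi> ` L) R Q" if L: "left_ideal L" for L
  proof (rule Q.left_submoduleI)
    have "\<pi> 0 = \<zero>\<^bsub>Q\<^esub>" using zero J by (simp add: left_ideal_0)
    then show "\<zero>\<^bsub>Q\<^esub> \<in> \<pi> ` L" using left_ideal_0[OF L] by (metis imageI)
  qed (use L surj in \<open>auto simp: add[symmetric] smult[symmetric] left_ideal_add left_ideal_mult\<close>)
  show sub: "submodule (\<pi> ` A) R Q" using image A by blast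
  have below: "K \<subseteq> \<pi> ` A" if K: "submodule K R Q" "K \<noteq> carrier Q" for K
  proof -
    define L where "L = {x. \<pi> x \<in> K}"
    have JL: "x \<in> L" if "x \<in> J" for x
      using Q.submodule_zero[OF K(1)] iffD2[OF zero that] by (simp add: L_def)
    have L: "left_ideal L" "J \<subseteq> L"
      using Q.submodule_add[OF K(1)] Q.submodule_smult[OF K(1)] JL left_ideal_0[OF J]
      by (auto simp: left_ideal_def L_def add smult car)
    have KL: "K = \<pi> ` L" using Q.submodule_subset[OF K(1)] surj by (auto simp: L_def)
    have "1 \<notin> L"
    proof
      assume "1 \<in> L"
      then have "L = UNIV" using left_ideal_mult[OF L(1), of 1] by auto
      then show False using K(2) KL surj by simp
    qed
    then show ?thesis using greatest[OF L] KL by blast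
  qed
  have "1 \<notin> A" by fact
  then have proper: "\<pi> ` A \<noteq> carrier Q" using mem[OF A(1,2), of 1] surj by blast
  show "(THE N. maximal_submodule N R Q) = \<pi> ` A"
  proof (rule the_equality)
    show "maximal_submodule (\<pi> ` A) R Q"
      unfolding maximal_submodule_def using sub proper below by blast
  next
    fix N assume N: "maximal_submodule N R Q"
    then have "N \<subseteq> \<pi> ` A" using below unfolding maximal_submodule_def by blast
    then show "N = \<pi> ` A" using N sub proper unfolding maximal_submodule_def by blast
  qed
qed

text \<open>A nonzero vector generates a simple module. A left ideal \<open>L\<close> that does not
  kill \<open>m\<close> carries \<open>m\<close> onto the whole module, so some \<open>l\<close> in
  \<open>L\<close> fixes \<open>m\<close>; the element \<open>1 - l\<close> is the one to which
  locality is applied.\<close>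

lemma simple_module_generator:
  fixes M :: "('a::ring_1, 'm) module"
  assumes M: "simple_module ring_of_type_algebra M" and m: "m \<in> carrier M" "m \<noteq> \<zero>\<^bsub>M\<^esub>"
  defines "Ann \<equiv> {a. a \<odot>\<^bsub>M\<^esub> m = \<zero>\<^bsub>M\<^esub>}"
  shows "module_epi ring_of_type_algebra (regular_module ring_of_type_algebra) M (\<lambda>a. a \<odot>\<^bsub>M\<^esub> m)"
    and "left_ideal Ann" and "1 \<notin> Ann"
    and "left_ideal L \<Longrightarrow> \<not> L \<subseteq> Ann \<Longrightarrow> \<exists>l\<in>L. 1 - l \<in> Ann"
proof -
  let ?R = "ring_of_type_algebra :: 'a ring"
  interpret left_module ?R M using M by (simp add: simple_module_def)
  have R: "carrier ?R = UNIV" "x \<oplus>\<^bsub>?R\<^esub> y = x + y" "x \<otimes>\<^bsub>?R\<^esub> y = x * y" "\<zero>\<^bsub>?R\<^esub> = 0" "\<one>\<^bsub>?R\<^esub> = 1" for x y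
    by (simp_all add: ring_of_type_algebra_def)
  have closed: "a \<odot>\<^bsub>M\<^esub> m \<in> carrier M" for a using smult_closed[of a m] m by (simp add: R)
  have add: "(a + b) \<odot>\<^bsub>M\<^esub> m = a \<odot>\<^bsub>M\<^esub> m \<oplus>\<^bsub>M\<^esub> b \<odot>\<^bsub>M\<^esub> m" for a b
    using smult_l_distr[of a b m] m by (simp add: R)
  have mult: "(a * b) \<odot>\<^bsub>M\<^esub> m = a \<odot>\<^bsub>M\<^esub> (b \<odot>\<^bsub>M\<^esub> m)" for a b
    using smult_assoc1[of a b m] m by (simp add: R)
  have zero: "0 \<odot>\<^bsub>M\<^esub> m = \<zero>\<^bsub>M\<^esub>" using smult_l_null[of m] m by (simp add: R)
  have one: "1 \<odot>\<^bsub>M\<^esub> m = m" using smult_one[of m] m by (simp add: R)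
  have r_zero: "a \<odot>\<^bsub>M\<^esub> \<zero>\<^bsub>M\<^esub> = \<zero>\<^bsub>M\<^esub>" for a
    using mult[of a 0] zero by simp
  show Ann: "left_ideal Ann"
    by (simp add: left_ideal_def Ann_def zero add mult r_zero)
  show "1 \<notin> Ann" using m by (simp add: Ann_def one)
  have image: "submodule ((\<lambda>a. a \<odot>\<^bsub>M\<^esub> m) ` L) ?R M" if L: "left_ideal L" for L
  proof (rule left_submoduleI)
    show "\<zero>\<^bsub>M\<^esub> \<in> (\<lambda>a. a \<odot>\<^bsub>M\<^esub> m) ` L" using left_ideal_0[OF L] zero by (metis imageI)
  qed (use L closed in \<open>auto simp: add[symmetric] mult[symmetric] left_ideal_add left_ideal_mult\<close>)
  have full: "(\<lambda>a. a \<odot>\<^bsub>M\<^esub> m) ` L = carrier M" if "left_ideal L" "\<not> L \<subseteq> Ann" for L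
    using M image[OF that(1)] that(2) unfolding simple_module_def Ann_def by blast
  have "(\<lambda>a. a \<odot>\<^bsub>M\<^esub> m) ` UNIV = carrier M"
    by (rule full) (use \<open>1 \<notin> Ann\<close> in \<open>auto simp: left_ideal_def\<close>)
  then show "module_epi ?R (regular_module ?R) M (\<lambda>a. a \<odot>\<^bsub>M\<^esub> m)"
    by (simp add: module_epi_def regular_module_def R add mult)
  show "\<exists>l\<in>L. 1 - l \<in> Ann" if L: "left_ideal L" "\<not> L \<subseteq> Ann"
  proof -
    obtain l where l: "l \<in> L" "m = l \<odot>\<^bsub>M\<^esub> m" using full[OF L] m(1) by blast
    have "(1 - l) \<odot>\<^bsub>M\<^esub> m \<oplus>\<^bsub>M\<^esub> l \<odot>\<^bsub>M\<^esub> m = m" using add[of "1 - l" l] one by simp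
    then have "(1 - l) \<odot>\<^bsub>M\<^esub> m \<oplus>\<^bsub>M\<^esub> m = m" using l(2) by simp
    then have "(1 - l) \<odot>\<^bsub>M\<^esub> m = \<zero>\<^bsub>M\<^esub>" using closed m(1) by simp
    then show ?thesis using l(1) by (auto simp: Ann_def)
  qed
qed

lemma finite_codimension_annihilator:
  fixes M :: "('k::field_prime_char restricted_yangian, 'm) module"
  assumes M: "simple_module restricted_yangian_ring M" and fin: "finite_dimensional M"
    and m: "m \<in> carrier M" "m \<noteq> \<zero>\<^bsub>M\<^esub>"
  shows "\<exists>n. restricted.dim_mod_le n UNIV {a. a \<odot>\<^bsub>M\<^esub> m = \<zero>\<^bsub>M\<^esub>}"
proof -
  let ?R = "restricted_yangian_ring :: 'k restricted_yangian ring"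
  let ?A = "{a. a \<odot>\<^bsub>M\<^esub> m = \<zero>\<^bsub>M\<^esub>}"
  have A: "left_ideal ?A" and epi: "module_epi ?R (regular_module ?R) M (\<lambda>a. a \<odot>\<^bsub>M\<^esub> m)"
    using simple_module_generator[OF M m] by auto
  have R: "carrier ?R = UNIV" "x \<oplus>\<^bsub>?R\<^esub> y = x + y" "x \<otimes>\<^bsub>?R\<^esub> y = x * y" for x y
    by (simp_all add: ring_of_type_algebra_def)
  have M': "left_module ?R M" using M by (simp add: simple_module_def)
  interpret left_module ?R M by fact
  have RM: "left_module ?R (regular_module ?R)"
    by (rule left_module_regular[OF ring_ring_of_type])
  have car: "carrier M = range (\<lambda>a. a \<odot>\<^bsub>M\<^esub> m)"
    and add: "\<And>a b. (a + b) \<odot>\<^bsub>M\<^esub> m = a \<odot>\<^bsub>M\<^esub> m \<oplus>\<^bsub>M\<^esub> b \<odot>\<^bsub>M\<^esub> m"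
    and mult: "\<And>a b. (a * b) \<odot>\<^bsub>M\<^esub> m = a \<odot>\<^bsub>M\<^esub> (b \<odot>\<^bsub>M\<^esub> m)"
    using epi by (auto simp: module_epi_def regular_module_def R)
  obtain B where B: "finite B" "B \<subseteq> carrier M"
    and span: "\<And>x. x \<in> carrier M \<Longrightarrow> \<exists>c. x = (\<Oplus>\<^bsub>M\<^esub>b\<in>B. restricted_scalar (c b) \<odot>\<^bsub>M\<^esub> b)"
    using fin unfolding finite_dimensional_def by blast
  have "\<forall>b\<in>B. \<exists>a. b = a \<odot>\<^bsub>M\<^esub> m" using B(2) car by blast
  then obtain \<beta> where \<beta>: "\<And>b. b \<in> B \<Longrightarrow> \<beta> b \<odot>\<^bsub>M\<^esub> m = b" by metis
  have zero: "0 \<odot>\<^bsub>M\<^esub> m = \<zero>\<^bsub>M\<^esub>" using left_ideal_0[OF A] by simp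
  have sum: "(\<Sum>b\<in>C. g b) \<odot>\<^bsub>M\<^esub> m = (\<Oplus>\<^bsub>M\<^esub>b\<in>C. g b \<odot>\<^bsub>M\<^esub> m)" if "finite C" for C :: "'m set" and g
    using that
  proof induction
    case (insert b C)
    then show ?case by (subst M.finsum_insert) (auto simp: add car)
  qed (simp add: zero)
  have "x \<in> restricted.lin_span (\<beta> ` B) ?A" for x
  proof -
    obtain c where "x \<odot>\<^bsub>M\<^esub> m = (\<Oplus>\<^bsub>M\<^esub>b\<in>B. restricted_scalar (c b) \<odot>\<^bsub>M\<^esub> b)"
      using span[of "x \<odot>\<^bsub>M\<^esub> m"] car by auto
    also have "\<dots> = (\<Oplus>\<^bsub>M\<^esub>b\<in>B. (restricted_scalar (c b) * \<beta> b) \<odot>\<^bsub>M\<^esub> m)"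
    proof (rule M.finsum_cong')
      show "(\<lambda>b. (restricted_scalar (c b) * \<beta> b) \<odot>\<^bsub>M\<^esub> m) \<in> B \<rightarrow> carrier M" unfolding car by blast
    qed (simp_all add: mult \<beta>)
    also have "\<dots> = (\<Sum>b\<in>B. restricted_scalar (c b) * \<beta> b) \<odot>\<^bsub>M\<^esub> m"
      by (rule sum[OF B(1), symmetric])
    finally have "x \<odot>\<^bsub>M\<^esub> m = (\<Sum>b\<in>B. restricted_scalar (c b) * \<beta> b) \<odot>\<^bsub>M\<^esub> m" .
    then have "x - (\<Sum>b\<in>B. restricted_scalar (c b) * \<beta> b) \<in> ?A"
      using module_epi_eq_iff[OF RM M' epi, of x "\<Sum>b\<in>B. restricted_scalar (c b) * \<beta> b"]
      by (simp add: minus_ring_of_type) (simp add: regular_module_def ring_of_type_algebra_def)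
    moreover have "(\<Sum>b\<in>B. restricted_scalar (c b) * \<beta> b) \<in> restricted.lin_span (\<beta> ` B) ?A"
      by (intro restricted.lin_span_sum[OF A] restricted.lin_span.scal imageI)
    ultimately have "x - (\<Sum>b\<in>B. restricted_scalar (c b) * \<beta> b) +
        (\<Sum>b\<in>B. restricted_scalar (c b) * \<beta> b) \<in> restricted.lin_span (\<beta> ` B) ?A"
      by (intro restricted.lin_span.add[OF restricted.lin_span.base])
    then show ?thesis by simp
  qed
  then have "restricted.lin_span (\<beta> ` B) ?A = UNIV" by blast
  then show ?thesis
    using restricted.dim_mod_le_lin_span[OF A, of "\<beta> ` B"] B(1) by auto
qed

theorem theorem3p6:
  fixes M :: "('k::{alg_closed_field, field_prime_char} restricted_yangian, 'm) module"
  assumes "simple_module restricted_yangian_ring M"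
    and "finite_dimensional M"
  shows "\<exists>\<mu> :: 2 \<Rightarrow> 'k fps. restricted_tuple \<mu> \<and>
           isomorphic_modules restricted_yangian_ring M (simple_quotient \<mu>)"
proof -
  let ?R = "restricted_yangian_ring :: 'k restricted_yangian ring"
  have M: "left_module ?R M" using assms(1) by (simp add: simple_module_def)
  interpret left_module ?R M by fact
  have RM: "left_module ?R (regular_module ?R)"
    by (rule left_module_regular[OF ring_ring_of_type])
  obtain m where m: "m \<in> carrier M" "m \<noteq> \<zero>\<^bsub>M\<^esub>"
    using assms(1) M.zero_closed unfolding simple_module_def by blast
  obtain n where "restricted.dim_mod_le n UNIV {a. a \<odot>\<^bsub>M\<^esub> m = \<zero>\<^bsub>M\<^esub>}"
    using finite_codimension_annihilator[OF assms m] by blast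
  from exists_highest_weight[OF simple_module_generator(2,3)[OF assms(1) m] this]
  obtain v \<mu> where v: "v \<odot>\<^bsub>M\<^esub> m \<noteq> \<zero>\<^bsub>M\<^esub>" and \<mu>: "\<And>i. fps_nth (\<mu> i) 0 = 1"
    and hw: "highest_weight \<mu> {a. (a * v) \<odot>\<^bsub>M\<^esub> m = \<zero>\<^bsub>M\<^esub>}" by auto
  have vm: "v \<odot>\<^bsub>M\<^esub> m \<in> carrier M"
    using smult_closed[of v m] m by (simp add: ring_of_type_algebra_def)
  note gen = simple_module_generator[OF assms(1) vm v]
  define A where "A = {a. a \<odot>\<^bsub>M\<^esub> (v \<odot>\<^bsub>M\<^esub> m) = \<zero>\<^bsub>M\<^esub>}"
  have A: "left_ideal A" "1 \<notin> A" using gen by (simp_all add: A_def)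
  have "(a * v) \<odot>\<^bsub>M\<^esub> m = a \<odot>\<^bsub>M\<^esub> (v \<odot>\<^bsub>M\<^esub> m)" for a
    using smult_assoc1[of a v m] m by (simp add: ring_of_type_algebra_def)
  then have hwA: "highest_weight \<mu> A" using hw by (simp add: A_def)
  have "restricted_series (\<mu> i)" for i
    by (rule restricted_series_of_character[OF A highest_weight_d[OF hwA] \<mu>])
  then have tuple: "restricted_tuple \<mu>" by (simp add: restricted_tuple_def \<mu>)
  define S where "S = {restricted_e r | r. r > 0} \<union>
    {restricted_d i r - restricted_scalar (fps_nth (\<mu> i) r) | i r. r > 0}"
  define J where "J = gen_left_ideal ?R S"
  have J: "left_ideal J" unfolding J_def by (rule left_ideal_gen_left_ideal)
  have "S \<subseteq> J" unfolding J_def by (rule gen_left_ideal_incl)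
  then have hwJ: "highest_weight \<mu> J" by (intro highest_weightI J \<mu>) (auto simp: S_def)
  have "S \<subseteq> A" using highest_weight_e[OF hwA] highest_weight_d[OF hwA] by (auto simp: S_def)
  then have JA: "J \<subseteq> A" unfolding J_def by (rule gen_left_ideal_least[OF A(1)])
  \<comment> \<open>Simplicity of the module only makes \<open>A\<close> a maximal left ideal; that
    it contains every proper left ideal above \<open>J\<close> is the locality of the baby Verma
    module.\<close>
  have greatest: "L \<subseteq> A" if L: "left_ideal L" "J \<subseteq> L" "1 \<notin> L" for L
  proof (rule ccontr)
    assume "\<not> L \<subseteq> A"
    then obtain l where "l \<in> L" "1 - l \<in> A" using gen(4)[OF L(1)] unfolding A_def by blast
    then show False using highest_weight_local[OF hwJ L A(1) JA A(2)] by blast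
  qed
  define \<pi> where "\<pi> = (\<lambda>x. J +>\<^bsub>regular_module ?R\<^esub> x)"
  have JM: "submodule J ?R (regular_module ?R)" unfolding submodule_regular_iff by (rule J)
  have verma: "baby_verma \<mu> = quotient_module (regular_module ?R) J"
    by (simp add: baby_verma_def J_def S_def)
  have V: "left_module ?R (baby_verma \<mu>)"
    unfolding verma by (rule left_module_quotient[OF RM JM])
  have max: "submodule (\<pi> ` A) ?R (baby_verma \<mu>)"
    "(THE N. maximal_submodule N ?R (baby_verma \<mu>)) = \<pi> ` A"
    "\<And>x. \<pi> x \<in> \<pi> ` A \<longleftrightarrow> x \<in> A"
    unfolding verma \<pi>_def
    by (intro maximal_submodule_of_cyclic[OF J A(1) JA A(2)] greatest; assumption)+
  have quot: "simple_quotient \<mu> = quotient_module (baby_verma \<mu>) (\<pi> ` A)"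
    unfolding simple_quotient_def max(2) ..
  \<comment> \<open>Both modules are images of the regular module, one through the highest weight
    vector and one through the baby Verma module, with the same kernel \<open>A\<close>.\<close>
  have "isomorphic_modules ?R M (simple_quotient \<mu>)"
  proof (rule isomorphic_modules_same_kernel[OF RM M _ gen(1)])
    show "left_module ?R (simple_quotient \<mu>)"
      unfolding quot by (rule left_module_quotient[OF V max(1)])
    have p1: "module_epi ?R (regular_module ?R) (baby_verma \<mu>) \<pi>"
      using quotient_module_projection(1)[OF RM JM] unfolding verma \<pi>_def .
    show "module_epi ?R (regular_module ?R) (simple_quotient \<mu>)
        (\<lambda>a. \<pi> ` A +>\<^bsub>baby_verma \<mu>\<^esub> \<pi> a)"
      unfolding quot by (rule module_epi_comp[OF p1 quotient_module_projection(1)[OF V max(1)]])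
    fix a assume "a \<in> carrier (regular_module ?R)"
    then have "\<pi> a \<in> carrier (baby_verma \<mu>)" using p1 unfolding module_epi_def by blast
    from quotient_module_projection(2)[OF V max(1) this]
    show "a \<odot>\<^bsub>M\<^esub> (v \<odot>\<^bsub>M\<^esub> m) = \<zero>\<^bsub>M\<^esub> \<longleftrightarrow>
        \<pi> ` A +>\<^bsub>baby_verma \<mu>\<^esub> \<pi> a = \<zero>\<^bsub>simple_quotient \<mu>\<^esub>"
      unfolding quot max(3) by (simp add: A_def)
  qed
  with tuple show ?thesis by blast
qed

end
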